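(* For every $\varepsilon>0$ there is a positive constant $c_0=c_0(\varepsilon)$ such that, if $c\ge c_0$ is fixed and $G\sim G(n,c/n)$, then with high probability $$(1-\varepsilon)\cdot \tfrac{1}{2}ce^{-c}\cdot n\le \mu(G)\le (1+\varepsilon)\cdot \tfrac12 ce^{-c}\cdot n.$$
   Context: $G(n,p)$ is the binomial random graph on vertex set $[n]$ in which each pair is an edge independently with probability $p$. "With high probability" means with probability tending to $1$ as $n\to\infty$. The path cover number $\mu(G)$ of a graph $G$ is $0$ if $G$ is Hamiltonian (contains a cycle through all its vertices), and otherwise it is the minimum number $k$ such that $V(G)$ can be covered by $k$ vertex-disjoint paths (a single vertex counts as a path of length $0$). *)

theory Defs
  imports "HOL-Probability.Probability"
begin

text \<open>
  A finite simple graph is given by its vertex set \<open>V\<close> and its edge set \<open>E\<close>,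
  each edge being a two-element subset of \<open>V\<close>.
\<close>

definition vertex_pairs :: "'a set \<Rightarrow> 'a set set" where
  "vertex_pairs V = {e. e \<subseteq> V \<and> card e = 2}"

text \<open>
  The random edge set of the binomial random graph with vertex set \<open>{1..n}\<close>.
  Outside the unit interval \<open>p\<close> is clamped to it by \<^const>\<open>bernoulli_pmf\<close>; for \<open>p = c / n\<close>
  this concerns only \<open>n < c\<close>.
\<close>

definition gnp :: "nat \<Rightarrow> real \<Rightarrow> nat set set pmf" where
  "gnp n p =
     map_pmf (\<lambda>X. {e \<in> vertex_pairs {1..n}. X e})
       (Pi_pmf (vertex_pairs {1..n}) False (\<lambda>_. bernoulli_pmf p))"

text \<open>A path is the nonempty list of its vertices; a singleton list is a path of length 0.\<close>

definition is_path :: "'a set \<Rightarrow> 'a set set \<Rightarrow> 'a list \<Rightarrow> bool" where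
  "is_path V E xs \<longleftrightarrow>
     xs \<noteq> [] \<and> distinct xs \<and> set xs \<subseteq> V \<and> successively (\<lambda>u v. {u, v} \<in> E) xs"

definition is_cycle :: "'a set \<Rightarrow> 'a set set \<Rightarrow> 'a list \<Rightarrow> bool" where
  "is_cycle V E xs \<longleftrightarrow> is_path V E xs \<and> length xs \<ge> 3 \<and> {last xs, hd xs} \<in> E"

definition hamiltonian :: "'a set \<Rightarrow> 'a set set \<Rightarrow> bool" where
  "hamiltonian V E \<longleftrightarrow> (\<exists>xs. is_cycle V E xs \<and> set xs = V)"

definition is_path_cover :: "'a set \<Rightarrow> 'a set set \<Rightarrow> 'a list set \<Rightarrow> bool" where
  "is_path_cover V E P \<longleftrightarrow>
     finite P \<and> (\<forall>xs\<in>P. is_path V E xs) \<and>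
     pairwise (\<lambda>xs ys. set xs \<inter> set ys = {}) P \<and> (\<Union>xs\<in>P. set xs) = V"

text \<open>For finite \<open>V\<close> the minimum exists, since the single vertices form a path cover.\<close>

definition path_cover_number :: "'a set \<Rightarrow> 'a set set \<Rightarrow> nat" where
  "path_cover_number V E =
     (if hamiltonian V E then 0 else (LEAST k. \<exists>P. is_path_cover V E P \<and> card P = k))"

end

theory Submission
  imports Defs "HOL-Real_Asymp.Real_Asymp"
begin

text \<open>
  A path cover with \<open>k\<close> paths is the same as an ordering of the vertices in which \<open>k - 1\<close> consecutive
  pairs are non-edges; let \<open>b\<close> be the least number of such gaps, so that \<open>b \<le> \<mu>(G) \<le> b + 1\<close>.
  A vertex of degree one that is not at an end of the ordering lies in a gap, which gives the lower
  bound. Since adding an edge changes \<open>b\<close> by at most one, the Efron--Stein inequality concentrates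
  \<open>b\<close> within \<open>o(n)\<close> of its mean, so for the upper bound it is enough that \<open>b\<close> is small with a
  probability bounded away from \<open>0\<close>; Markov's inequality is then good enough for every event that
  depends on low-degree vertices.

  In an optimal ordering with fixed first vertex, reversing a suffix without creating a gap is a Posa
  rotation; at a gap this is always possible, so every vertex at a gap is an endpoint, which improves
  Posa's bound \<open>|N(R)| < 2|R|\<close> for the set \<open>R\<close> of endpoints by \<open>2b\<close>. Hence, if
  \<open>|N(S)| \<ge> 2|S| - d\<close> for all small \<open>S\<close> and \<open>2b > d + 3\<close>, then quadratically many pairs are boosters, whose
  addition decreases \<open>b\<close>. Write \<open>G(n,p) = G\<^sub>1 \<union> G\<^sub>2\<close> with \<open>G\<^sub>2 \<sim> G(n,3000/n)\<close>. The edges of \<open>G\<^sub>1\<close> together with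
  those of \<open>G\<^sub>2\<close> at vertices of low degree in \<open>G\<^sub>1\<close> expand with a deficit \<open>d\<close> of about the number of
  vertices of degree one, and the remaining edges of \<open>G\<^sub>2\<close> cannot all avoid the boosters.
\<close>

section \<open>Orderings with few gaps and rotations\<close>

text \<open>The deficit \<open>d\<close> has to be sharp, so it must count the vertices of degree
  one of the whole graph: \<open>G\<^sub>1\<close> alone has more of them by a factor of about
  \<open>exp 3000\<close>. This forces the edges of \<open>G\<^sub>2\<close> at low vertices to be
  revealed before boosters are sought. In the union bound this is free of charge, since the
  probabilities of all outcomes on those pairs add up to 1. Boosters are not added one at a time.
  The gap number of \<open>G\<^sub>1 \<union> G\<^sub>2\<close> is already attained with a set
  \<open>F\<close> of at most n of the unrevealed edges, and any further edge of
  \<open>G\<^sub>2\<close> that was a booster at that point would lower it again. Choosing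
  \<open>F\<close> costs at most \<open>exp (10 * n)\<close>, while missing about n^2 / 288 boosters
  at density 3000 / n gains about exp (- 3000 n / 288). Vertices of degree 0, low vertices close to
  each other or on short cycles, and sets of up to \<open>x\<close> vertices also enter
  \<open>d\<close>; all are kept small against \<open>c * exp (- c) * n\<close>. First moments alone
  then keep the failure probability below 1, without a second moment of any of these counts.\<close>

fun gaps :: "'a set set \<Rightarrow> 'a list \<Rightarrow> nat" where
  "gaps E (x # y # xs) = of_bool ({x, y} \<notin> E) + gaps E (y # xs)"
| "gaps E _ = 0"

fun links :: "'a list \<Rightarrow> 'a set set" where
  "links (x # y # xs) = insert {x, y} (links (y # xs))"
| "links _ = {}"

lemma gaps_Cons: "xs \<noteq> [] \<Longrightarrow> gaps E (x # xs) = of_bool ({x, hd xs} \<notin> E) + gaps E xs"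
  by (cases xs) auto

lemma links_Cons: "xs \<noteq> [] \<Longrightarrow> links (x # xs) = insert {x, hd xs} (links xs)"
  by (cases xs) auto

lemma gaps_append:
  assumes "xs \<noteq> []" "ys \<noteq> []"
  shows "gaps E (xs @ ys) = gaps E xs + of_bool ({last xs, hd ys} \<notin> E) + gaps E ys"
  using assms(1)
proof (induction xs rule: list_nonempty_induct)
  case (single x)
  then show ?case using assms(2) by (simp add: gaps_Cons)
next
  case (cons x xs)
  then show ?case by (simp add: gaps_Cons hd_append)
qed

lemma links_append:
  assumes "xs \<noteq> []" "ys \<noteq> []"
  shows "links (xs @ ys) = insert {last xs, hd ys} (links xs \<union> links ys)"
  using assms(1)
proof (induction xs rule: list_nonempty_induct)
  case (single x)
  then show ?case using assms(2) by (simp add: links_Cons)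
next
  case (cons x xs)
  then show ?case by (simp add: links_Cons hd_append insert_commute)
qed

lemma gaps_rev [simp]: "gaps E (rev xs) = gaps E xs"
proof (induction xs)
  case (Cons x xs)
  then show ?case
    by (cases "xs = []") (simp_all add: gaps_append gaps_Cons last_rev insert_commute)
qed simp

lemma links_rev [simp]: "links (rev xs) = links xs"
proof (induction xs)
  case (Cons x xs)
  then show ?case
    by (cases "xs = []") (simp_all add: links_append links_Cons last_rev insert_commute)
qed simp

lemma gaps_mono: "E \<subseteq> E' \<Longrightarrow> gaps E' xs \<le> gaps E xs"
  by (induction E xs rule: gaps.induct) (auto simp: of_bool_def)

lemma gaps_insert_notin: "x \<notin> set xs \<Longrightarrow> gaps (insert {x, y} E) xs = gaps E xs"
proof (induction E xs rule: gaps.induct)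
  case (1 E u v xs)
  then have "{u, v} \<noteq> {x, y}" by (auto simp: doubleton_eq_iff)
  then show ?case using 1 by simp
qed simp_all

text \<open>In a list without repetitions a pair is consecutive at most once, so one edge closes at
  most one gap. This is the source of the Lipschitz constant 1 used for concentration.\<close>

lemma gaps_insert_le: "distinct xs \<Longrightarrow> gaps E xs \<le> Suc (gaps (insert e E) xs)"
proof (induction xs)
  case (Cons x xs)
  show ?case
  proof (cases "xs \<noteq> [] \<and> e = {x, hd xs}")
    case True
    then show ?thesis using Cons.prems by (simp add: gaps_Cons gaps_insert_notin)
  next
    case False
    then show ?thesis using Cons by (cases "xs = []") (auto simp: gaps_Cons)
  qed
qed simp

lemma gap_split:
  assumes "gaps E xs > 0"
  obtains ys zs where "xs = ys @ zs" "ys \<noteq> []" "zs \<noteq> []" "{last ys, hd zs} \<notin> E"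
proof -
  have "\<exists>ys zs. xs = ys @ zs \<and> ys \<noteq> [] \<and> zs \<noteq> [] \<and> {last ys, hd zs} \<notin> E"
    using assms
  proof (induction xs)
    case (Cons x xs)
    have "xs \<noteq> []" using Cons.prems by auto
    show ?case
    proof (cases "{x, hd xs} \<in> E")
      case True
      then have "gaps E xs > 0" using Cons.prems \<open>xs \<noteq> []\<close> by (simp add: gaps_Cons)
      then obtain ys zs where "xs = ys @ zs" "ys \<noteq> []" "zs \<noteq> []" "{last ys, hd zs} \<notin> E"
        using Cons.IH by blast
      then show ?thesis by (intro exI[of _ "x # ys"] exI[of _ zs]) auto
    next
      case False
      then show ?thesis using \<open>xs \<noteq> []\<close> by (intro exI[of _ "[x]"] exI[of _ xs]) auto
    qed
  qed simp
  then show ?thesis using that by blast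
qed

lemma links_subset: "e \<in> links xs \<Longrightarrow> e \<subseteq> set xs"
  by (induction xs rule: links.induct) auto

lemma link_nbr_cases:
  assumes "distinct (xs @ x # ys)" "{x, w} \<in> links (xs @ x # ys)"
  shows "(xs \<noteq> [] \<and> w = last xs) \<or> (ys \<noteq> [] \<and> w = hd ys)"
proof -
  have 1: "{x, w} \<notin> links xs" "{x, w} \<notin> links ys"
    using links_subset[of "{x, w}"] assms(1) by auto
  have 2: "links (x # ys) = (if ys = [] then {} else insert {x, hd ys} (links ys))"
    by (simp add: links_Cons)
  have 3: "links (xs @ x # ys)
      = (if xs = [] then links (x # ys) else insert {last xs, x} (links xs \<union> links (x # ys)))"
    by (simp add: links_append)
  have "(xs \<noteq> [] \<and> {x, w} = {last xs, x}) \<or> (ys \<noteq> [] \<and> {x, w} = {x, hd ys})"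
    using assms(2) 1 unfolding 3 2 by (simp split: if_splits)
  then show ?thesis by (metis doubleton_eq_iff)
qed

inductive rotations :: "'a set set \<Rightarrow> 'a list \<Rightarrow> 'a list \<Rightarrow> bool" for E L where
  rot_refl: "rotations E L L"
| rot_flip: "rotations E L (xs @ ys) \<Longrightarrow> xs \<noteq> [] \<Longrightarrow> ys \<noteq> [] \<Longrightarrow>
    gaps E (xs @ rev ys) \<le> gaps E (xs @ ys) \<Longrightarrow> rotations E L (xs @ rev ys)"

lemma rotations_props:
  assumes "rotations E L L'"
  shows "set L' = set L" "distinct L' = distinct L" "L \<noteq> [] \<Longrightarrow> hd L' = hd L"
    "gaps E L' \<le> gaps E L" "length L' = length L"
  using assms by (induction rule: rotations.induct) (auto simp: hd_append)

text \<open>A flip replaces one link by another, so it is admissible if the removed link was a gap,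
  and also, as in Posa's original argument, if the added link is an edge.\<close>

lemma rotations_flip_gap:
  assumes "rotations E L (xs @ ys)" "xs \<noteq> []" "ys \<noteq> []" "{last xs, hd ys} \<notin> E"
  shows "rotations E L (xs @ rev ys)"
  using assms by (intro rotations.rot_flip) (auto simp: gaps_append)

lemma rotations_flip_edge:
  assumes "rotations E L (xs @ ys)" "xs \<noteq> []" "ys \<noteq> []" "{last xs, last ys} \<in> E"
  shows "rotations E L (xs @ rev ys)"
  using assms by (intro rotations.rot_flip) (auto simp: gaps_append hd_rev)

definition rot_ends :: "'a set set \<Rightarrow> 'a list \<Rightarrow> 'a set" where
  "rot_ends E L = {last L' | L'. rotations E L L'}"

text \<open>Vertices of \<open>S\<close> are not removed; statements about external neighbourhoods
  subtract \<open>S\<close> explicitly.\<close>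

definition nbrs :: "'a set set \<Rightarrow> 'a set \<Rightarrow> 'a set" where
  "nbrs E S = {x. \<exists>v\<in>S. {v, x} \<in> E}"

lemma rot_endsI: "rotations E L L' \<Longrightarrow> last L' = v \<Longrightarrow> v \<in> rot_ends E L"
  by (auto simp: rot_ends_def)

lemma rot_ends_subset:
  assumes "L \<noteq> []"
  shows "rot_ends E L \<subseteq> set L"
proof
  fix v assume "v \<in> rot_ends E L"
  then obtain L' where L': "rotations E L L'" "v = last L'" by (auto simp: rot_ends_def)
  have "length L' = length L" "set L' = set L" using rotations_props[OF L'(1)] by simp_all
  then have "L' \<noteq> []" using assms by (metis length_0_conv)
  then show "v \<in> set L" using L'(2) \<open>set L' = set L\<close> last_in_set by metis
qed

text \<open>Every reversal removes a link and adds a link that both contain a rotation endpoint, so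
  links avoiding the endpoints are never touched.\<close>

lemma rotations_links:
  assumes "rotations E L L'" "e \<inter> rot_ends E L = {}"
  shows "e \<in> links L' \<longleftrightarrow> e \<in> links L"
  using assms
proof (induction rule: rotations.induct)
  case (rot_flip xs ys)
  have 1: "last ys \<in> rot_ends E L" using rot_flip.hyps by (intro rot_endsI[of _ _ "xs @ ys"]) auto
  have 2: "hd ys \<in> rot_ends E L"
    using rotations.rot_flip[OF rot_flip.hyps] by (rule rot_endsI) (use rot_flip.hyps in \<open>auto simp: last_rev\<close>)
  have "e \<noteq> {last xs, hd ys}" "e \<noteq> {last xs, last ys}" using 1 2 rot_flip.prems by auto
  then show ?case using rot_flip by (auto simp: links_append hd_rev)
qed simp

text \<open>Posa's argument. If neither list neighbour of \<open>x\<close> in \<open>L\<close> were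
  an endpoint, both links at \<open>x\<close> would survive every rotation. But in a list
  \<open>L'\<close> whose last vertex is adjacent to \<open>x\<close>, a flip just after
  \<open>x\<close> turns the successor of \<open>x\<close> into an endpoint, and that successor is
  one of the two old neighbours.\<close>

lemma rot_ends_nbr:
  assumes L: "distinct L" "L \<noteq> []"
    and x: "x \<in> nbrs E (rot_ends E L)" "x \<in> set L" "x \<notin> rot_ends E L" "x \<noteq> hd L"
  shows "\<exists>r\<in>rot_ends E L. {x, r} \<in> links L"
proof (rule ccontr)
  assume neg: "\<not> ?thesis"
  obtain L' where L': "rotations E L L'" "{last L', x} \<in> E"
    using x(1) by (auto simp: nbrs_def rot_ends_def)
  note pr = rotations_props[OF L'(1)]
  obtain xs ys where split: "L' = xs @ x # ys" using pr(1) x(2) split_list by metis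
  have ysne: "ys \<noteq> []" using x(3) L'(1) split by (auto simp: rot_ends_def)
  have xsne: "xs \<noteq> []" using x(4) pr(3) L(2) split by auto
  have "rotations E L ((xs @ [x]) @ rev ys)"
    using L' split ysne by (intro rotations_flip_edge) (auto simp: insert_commute)
  then have hy: "hd ys \<in> rot_ends E L" by (rule rot_endsI) (use ysne in \<open>auto simp: last_rev\<close>)
  obtain us vs where L0: "L = us @ x # vs" using x(2) split_list by metis
  have usne: "us \<noteq> []" using x(4) L0 by auto
  have vsne: "vs \<noteq> []" using x(3) L0 by (auto intro: rot_endsI[OF rotations.rot_refl])
  have l1: "{x, last us} \<in> links L" "{x, hd vs} \<in> links L"
    using usne vsne L0 by (auto simp: links_append links_Cons insert_commute)
  then have "last us \<notin> rot_ends E L" "hd vs \<notin> rot_ends E L" using neg by auto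
  then have "{x, last us} \<in> links L'" "{x, hd vs} \<in> links L'"
    using rotations_links[OF L'(1), of "{x, last us}"] rotations_links[OF L'(1), of "{x, hd vs}"]
      l1 x(3) by auto
  then have "last us \<in> {last xs, hd ys}" "hd vs \<in> {last xs, hd ys}"
    using link_nbr_cases[of xs x ys] pr(2) L(1) split by auto
  moreover have "last us \<in> set us" "hd vs \<in> set vs" using usne vsne by auto
  then have "last us \<noteq> hd vs" using L(1) L0 by auto
  ultimately show False
    using hy \<open>last us \<notin> rot_ends E L\<close> \<open>hd vs \<notin> rot_ends E L\<close> by auto
qed

text \<open>A flip at the gap moves \<open>hd ys\<close> to the end. To reach
  \<open>last xs\<close>, an earlier gap is used: flipping there turns \<open>us @ vs @ ys\<close>
  into \<open>us @ rev ys @ rev vs\<close>, in which \<open>rev ys\<close> and \<open>rev vs\<close>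
  meet at the original gap, and a flip at that gap leaves \<open>vs\<close> at the end.\<close>

lemma gap_ends_rot_ends:
  assumes "L = xs @ ys" "xs \<noteq> []" "ys \<noteq> []" "{last xs, hd ys} \<notin> E"
  shows "hd ys \<in> rot_ends E L" "gaps E xs > 0 \<Longrightarrow> last xs \<in> rot_ends E L"
proof -
  have "rotations E L (xs @ rev ys)"
    using assms by (intro rotations_flip_gap) (auto intro: rotations.rot_refl)
  then show "hd ys \<in> rot_ends E L" by (rule rot_endsI) (use assms in \<open>auto simp: last_rev\<close>)
  assume "gaps E xs > 0"
  then obtain us vs where uv: "xs = us @ vs" "us \<noteq> []" "vs \<noteq> []" "{last us, hd vs} \<notin> E"
    by (rule gap_split)
  have "rotations E L (us @ rev (vs @ ys))"
    using assms uv by (intro rotations_flip_gap) (auto intro: rotations.rot_refl)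
  then have "rotations E L ((us @ rev ys) @ rev vs)" by simp
  then have "rotations E L ((us @ rev ys) @ rev (rev vs))"
    by (rule rotations_flip_gap)
      (use assms uv in \<open>auto simp: last_rev hd_rev insert_commute\<close>)
  then show "last xs \<in> rot_ends E L" by (rule rot_endsI) (use uv in auto)
qed

text \<open>Each endpoint has two places next to it in the list, which limits its neighbours outside
  \<open>R\<close>; a gap between two endpoints wastes two of these places. For the induction over
  prefixes, \<open>of_bool (last xs \<in> R)\<close> reserves the place to the right of the prefix.
  The left end of the first gap need not be an endpoint, so that gap is forgiven by the last
  summand.\<close>

lemma rot_ends_link_count:
  fixes E :: "'a set set"
  assumes L: "distinct L"
  defines "R \<equiv> rot_ends E L"
  assumes xs: "L = xs @ ys" "xs \<noteq> []"
  shows "card {x \<in> set xs - R. \<exists>r\<in>R. {x, r} \<in> links xs} + 2 * gaps E xs + of_bool (last xs \<in> R)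
    \<le> 2 * card (R \<inter> set xs) + 2 * of_bool (gaps E xs > 0)"
  using xs(2,1)
proof (induction xs arbitrary: ys rule: rev_nonempty_induct)
  case (single x)
  then show ?case by (auto simp: of_bool_def)
next
  case (snoc z zs)
  define X where "X = (\<lambda>xs. {x \<in> set xs - R. \<exists>r\<in>R. {x, r} \<in> links xs})"
  have IH: "card (X zs) + 2 * gaps E zs + of_bool (last zs \<in> R)
    \<le> 2 * card (R \<inter> set zs) + 2 * of_bool (gaps E zs > 0)"
    unfolding X_def by (rule snoc.IH[of "z # ys"]) (use snoc in auto)
  have z: "z \<notin> set zs" using L snoc.prems by auto
  have cR: "card (R \<inter> set (zs @ [z])) = card (R \<inter> set zs) + of_bool (z \<in> R)"
    using z by auto
  have lk: "links (zs @ [z]) = insert {last zs, z} (links zs)" using snoc.hyps by (simp add: links_append)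
  have gp: "gaps E (zs @ [z]) = gaps E zs + of_bool ({last zs, z} \<notin> E)"
    using snoc.hyps by (simp add: gaps_append)
  have fin: "finite (X zs)" by (simp add: X_def)
  have sub: "X (zs @ [z]) \<subseteq> X zs \<union> (if z \<in> R \<and> last zs \<notin> R then {last zs} else {})
      \<union> (if z \<notin> R \<and> last zs \<in> R then {z} else {})"
  proof
    fix x assume x: "x \<in> X (zs @ [z])"
    then obtain r where r: "r \<in> R" "x \<notin> R" "{x, r} = {last zs, z} \<or> {x, r} \<in> links zs"
      by (auto simp: X_def lk)
    show "x \<in> X zs \<union> (if z \<in> R \<and> last zs \<notin> R then {last zs} else {})
      \<union> (if z \<notin> R \<and> last zs \<in> R then {z} else {})"
    proof (cases "{x, r} \<in> links zs")
      case True
      then show ?thesis using r links_subset[of "{x, r}" zs] by (auto simp: X_def)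
    next
      case False
      then show ?thesis using r by (auto simp: doubleton_eq_iff)
    qed
  qed
  have "card (X (zs @ [z])) \<le> card (X zs \<union> (if z \<in> R \<and> last zs \<notin> R then {last zs} else {})
      \<union> (if z \<notin> R \<and> last zs \<in> R then {z} else {}))"
    using sub fin by (intro card_mono) auto
  also have "\<dots> \<le> card (X zs) + of_bool (z \<in> R \<and> last zs \<notin> R) + of_bool (z \<notin> R \<and> last zs \<in> R)"
    using fin by (auto simp: card_insert_if)
  finally have cX: "card (X (zs @ [z])) \<le> \<dots>" .
  have g1: "{last zs, z} \<notin> E \<Longrightarrow> z \<in> R"
    using gap_ends_rot_ends(1)[of L zs "z # ys" E] snoc by (auto simp: R_def)
  have g2: "{last zs, z} \<notin> E \<Longrightarrow> gaps E zs > 0 \<Longrightarrow> last zs \<in> R"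
    using gap_ends_rot_ends(2)[of L zs "z # ys" E] snoc by (auto simp: R_def)
  have "card (X (zs @ [z])) + 2 * gaps E (zs @ [z]) + of_bool (last (zs @ [z]) \<in> R)
    \<le> 2 * card (R \<inter> set (zs @ [z])) + 2 * of_bool (gaps E (zs @ [z]) > 0)"
    using IH cX g1 g2 unfolding cR gp last_snoc by (auto simp: of_bool_def split: if_splits)
  then show ?case unfolding X_def .
qed

text \<open>The constant 3 consists of 2 for the first gap, which \<open>rot_ends_link_count\<close>
  does not charge, and 1 for \<open>hd L\<close>, which \<open>rot_ends_nbr\<close> does not
  cover.\<close>

theorem card_nbrs_rot_ends:
  fixes E :: "'a set set"
  assumes "distinct L" "L \<noteq> []" "gaps E L > 0"
  defines "R \<equiv> rot_ends E L"
  shows "card (nbrs E R \<inter> set L - R) + 2 * gaps E L \<le> 2 * card R + 3"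
proof -
  define X where "X = {x \<in> set L - R. \<exists>r\<in>R. {x, r} \<in> links L}"
  have "nbrs E R \<inter> set L - R \<subseteq> insert (hd L) X"
    using rot_ends_nbr[OF assms(1,2)] by (auto simp: X_def R_def)
  then have "card (nbrs E R \<inter> set L - R) \<le> card (insert (hd L) X)"
    by (intro card_mono) (auto simp: X_def)
  also have "\<dots> \<le> card X + 1" by (auto simp: card_insert_if X_def)
  finally have 1: "card (nbrs E R \<inter> set L - R) \<le> card X + 1" .
  have "R \<inter> set L = R" using rot_ends_subset[OF assms(2)] by (auto simp: R_def)
  then have "card X + 2 * gaps E L \<le> 2 * card R + 2"
    using rot_ends_link_count[OF assms(1), of L "[]" E] assms by (auto simp: X_def R_def)
  with 1 show ?thesis by simp
qed

section \<open>The gap number and its boosters\<close>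

definition gap_number :: "'a set \<Rightarrow> 'a set set \<Rightarrow> nat" where
  "gap_number V E = (LEAST k. \<exists>L. distinct L \<and> set L = V \<and> gaps E L = k)"

lemma gap_number_witness:
  assumes "finite V"
  obtains L where "distinct L" "set L = V" "gaps E L = gap_number V E"
proof -
  obtain L where "distinct L" "set L = V" using finite_distinct_list[OF assms] by auto
  then have "\<exists>L. distinct L \<and> set L = V \<and> gaps E L = gap_number V E"
    unfolding gap_number_def
    by (intro LeastI_ex[where P = "\<lambda>k. \<exists>L. distinct L \<and> set L = V \<and> gaps E L = k"]) blast
  then show ?thesis using that by blast
qed

lemma gap_number_le: "distinct L \<Longrightarrow> set L = V \<Longrightarrow> gap_number V E \<le> gaps E L"
  unfolding gap_number_def by (rule Least_le) blast

lemma gap_number_mono: "finite V \<Longrightarrow> E \<subseteq> E' \<Longrightarrow> gap_number V E' \<le> gap_number V E"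
  by (metis gap_number_witness gap_number_le gaps_mono le_trans)

lemma gap_number_insert_le: "finite V \<Longrightarrow> gap_number V E \<le> Suc (gap_number V (insert e E))"
  by (metis gap_number_witness gap_number_le gaps_insert_le le_trans)

text \<open>Only the links of one optimal ordering matter, and there are at most
  \<open>card V\<close> of them. This limits the choices of fresh edges over which the union bound
  runs.\<close>

lemma gap_number_links:
  assumes "finite V"
  obtains F where "F \<subseteq> E" "finite F" "card F \<le> card V" "gap_number V (H \<union> F) = gap_number V (H \<union> E)"
proof -
  obtain L where L: "distinct L" "set L = V" "gaps (H \<union> E) L = gap_number V (H \<union> E)"
    using assms by (rule gap_number_witness)
  define F where "F = E \<inter> links L"
  have 1: "finite (links L)" "card (links L) \<le> length L"
    by (induction L rule: links.induct) (auto simp: card_insert_if)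
  have 2: "links xs \<inter> E \<subseteq> F \<Longrightarrow> gaps (H \<union> F) xs \<le> gaps (H \<union> E) xs" for xs
    by (induction E xs rule: gaps.induct) (auto simp: of_bool_def)
  have "gaps (H \<union> F) L \<le> gaps (H \<union> E) L" by (rule 2) (auto simp: F_def)
  then have 3: "gap_number V (H \<union> F) \<le> gap_number V (H \<union> E)"
    using gap_number_le[OF L(1,2)] L(3) by (metis le_trans)
  have 4: "gap_number V (H \<union> E) \<le> gap_number V (H \<union> F)"
    using assms by (intro gap_number_mono) (auto simp: F_def)
  have "card F \<le> length L"
    using 1 card_mono[of "links L" F] by (auto simp: F_def)
  also have "\<dots> = card V" using L by (metis distinct_card)
  finally show ?thesis using that[of F] 1 3 4 by (auto simp: F_def)
qed

lemma card_ordered_pairs: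
  assumes "finite B" "\<And>e. e \<in> B \<Longrightarrow> card e = 2"
  shows "finite {(u, v). {u, v} \<in> B}" "card {(u, v). {u, v} \<in> B} \<le> 2 * card B"
proof -
  have eq: "{(u, v). {u, v} \<in> B} = (\<Union>e\<in>B. {(u, v). {u, v} = e})" by auto
  have *: "finite {(u, v). {u, v} = e} \<and> card {(u, v). {u, v} = e} \<le> 2" if e: "e \<in> B" for e
  proof -
    obtain x y where xy: "e = {x, y}" using assms(2)[OF e] by (auto simp: card_2_iff)
    have eq: "{(u, v). {u, v} = e} = {(x, y), (y, x)}"
      unfolding xy by (auto simp: doubleton_eq_iff)
    show ?thesis unfolding eq using card_length[of "[(x, y), (y, x)]"] by simp
  qed
  then show "finite {(u, v). {u, v} \<in> B}" unfolding eq using assms(1) by blast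
  have "card {(u, v). {u, v} \<in> B} \<le> (\<Sum>e\<in>B. card {(u, v). {u, v} = e})"
    unfolding eq using assms(1) by (rule card_UN_le)
  also have "\<dots> \<le> (\<Sum>e\<in>B. 2)" using * by (intro sum_mono) auto
  finally show "card {(u, v). {u, v} \<in> B} \<le> 2 * card B" by simp
qed

definition boosters :: "'a set \<Rightarrow> 'a set set \<Rightarrow> 'a set set" where
  "boosters V E = {e \<in> vertex_pairs V. gap_number V (insert e E) < gap_number V E}"

text \<open>An edge between the two ends of an optimal ordering closes it cyclically, and cutting
  the cycle at an existing gap saves that gap. Reversing the rotated list puts \<open>v\<close>
  first, so \<open>v\<close> has a large set of rotation endpoints of its own as partners.\<close>

lemma rot_ends_boosters:
  assumes V: "finite V" and L: "distinct L" "set L = V" "gaps E L = gap_number V E"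
    and pos: "gap_number V E > 0" and v: "v \<in> rot_ends E L"
  shows "{hd L, v} \<in> boosters V E" "\<exists>L'. distinct L' \<and> set L' = V \<and> gaps E L' = gap_number V E \<and> hd L' = v"
proof -
  obtain L' where L': "rotations E L L'" "last L' = v" using v by (auto simp: rot_ends_def)
  note pr = rotations_props[OF L'(1)]
  have ne: "L \<noteq> []" using pos L by auto
  have ne': "L' \<noteq> []" using pr ne by auto
  have g: "gaps E L' = gap_number V E"
    using pr gap_number_le[of L' V E] L by auto
  show "\<exists>L'. distinct L' \<and> set L' = V \<and> gaps E L' = gap_number V E \<and> hd L' = v"
    using L' pr L g ne' by (intro exI[of _ "rev L'"]) (auto simp: hd_rev)
  have "gaps E L' > 0" using g pos by simp
  then obtain xs ys where s: "L' = xs @ ys" "xs \<noteq> []" "ys \<noteq> []" "{last xs, hd ys} \<notin> E"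
    by (rule gap_split)
  have hx: "hd xs = hd L" using pr(3) ne s by auto
  have ly: "last ys = v" using L'(2) s by auto
  let ?E = "insert {hd L, v} E"
  have "gaps ?E (ys @ xs) = gaps ?E ys + gaps ?E xs"
    using s hx ly by (simp add: gaps_append insert_commute)
  also have "\<dots> \<le> gaps E ys + gaps E xs"
    by (intro add_mono gaps_mono) auto
  also have "\<dots> < gaps E L'" using s by (simp add: gaps_append)
  finally have "gaps ?E (ys @ xs) < gap_number V E" using g by simp
  moreover have "distinct (ys @ xs)" "set (ys @ xs) = V" using s pr L by auto
  ultimately have "gap_number V ?E < gap_number V E"
    using gap_number_le[of "ys @ xs" V ?E] by linarith
  moreover have "hd L \<noteq> v"
  proof
    assume "hd L = v"
    then have "v \<in> set xs" "v \<in> set ys" using hx ly s by (metis hd_in_set, metis last_in_set)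
    then show False using pr L s by auto
  qed
  moreover have "hd L \<in> V" "v \<in> V"
    using ne L rot_ends_subset[OF ne, of E] v by auto
  ultimately show "{hd L, v} \<in> boosters V E" by (auto simp: boosters_def vertex_pairs_def)
qed

text \<open>An endpoint set of at most \<open>a\<close> vertices would contradict
  \<open>card_nbrs_rot_ends\<close>. So there are more than \<open>a\<close> endpoints, each of them
  starts another optimal ordering with more than \<open>a\<close> endpoints, and this yields
  quadratically many ordered pairs. Boosters touching \<open>D\<close> are discarded because the
  pairs at \<open>D\<close> will already have been revealed; this costs \<open>card D\<close> in
  each coordinate.\<close>

theorem card_boosters:
  assumes V: "finite V"
    and expand: "\<And>S. S \<subseteq> V \<Longrightarrow> card S \<le> a \<Longrightarrow> 2 * card S \<le> card (nbrs E S \<inter> V - S) + d"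
    and big: "d + 3 < 2 * gap_number V E"
    and D: "finite D"
  shows "(a - card D)\<^sup>2 \<le> 2 * card {e \<in> boosters V E. e \<inter> D = {}}"
proof -
  define B where "B = {e \<in> boosters V E. e \<inter> D = {}}"
  have finB: "finite B" using V by (auto simp: B_def boosters_def vertex_pairs_def)
  have cardB: "card e = 2" if "e \<in> B" for e
    using that by (simp add: B_def boosters_def vertex_pairs_def)
  have pos: "gap_number V E > 0" using big by simp
  have R: "a < card (rot_ends E L)" if L: "distinct L" "set L = V" "gaps E L = gap_number V E" for L
  proof (rule ccontr)
    assume neg: "\<not> ?thesis"
    have "L \<noteq> []" using pos L by auto
    then have "card (nbrs E (rot_ends E L) \<inter> V - rot_ends E L) + 2 * gaps E L \<le> 2 * card (rot_ends E L) + 3"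
      using card_nbrs_rot_ends[of L E] L pos by auto
    moreover have "2 * card (rot_ends E L) \<le> card (nbrs E (rot_ends E L) \<inter> V - rot_ends E L) + d"
      using neg expand[of "rot_ends E L"] rot_ends_subset[of L E] \<open>L \<noteq> []\<close> L by auto
    ultimately show False using big L by simp
  qed
  obtain L0 where L0: "distinct L0" "set L0 = V" "gaps E L0 = gap_number V E"
    using V by (rule gap_number_witness)
  have ne0: "L0 \<noteq> []" using pos L0 by auto
  define R0 where "R0 = rot_ends E L0 - D"
  have finR: "finite (rot_ends E L)" if "set L = V" "L \<noteq> []" for L
    using rot_ends_subset[of L E] that V by (metis finite_subset)
  have cR0: "a - card D \<le> card R0"
    using R[OF L0] diff_card_le_card_Diff[OF D, of "rot_ends E L0"] by (auto simp: R0_def)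
  have *: "\<exists>T. finite T \<and> a - card D \<le> card T \<and> (\<forall>w\<in>T. {v, w} \<in> B)" if "v \<in> R0" for v
  proof -
    have "v \<in> rot_ends E L0" using that by (auto simp: R0_def)
    from rot_ends_boosters(2)[OF V L0 pos this]
    obtain L where L: "distinct L" "set L = V" "gaps E L = gap_number V E" "hd L = v" by blast
    have ne: "L \<noteq> []" using pos L by auto
    have "a - card D \<le> card (rot_ends E L - D)"
      using R[OF L(1-3)] diff_card_le_card_Diff[OF D, of "rot_ends E L"] by auto
    moreover have "{v, w} \<in> B" if "w \<in> rot_ends E L - D" for w
      using rot_ends_boosters(1)[OF V L(1-3) pos, of w] that \<open>v \<in> R0\<close> L(4) by (auto simp: B_def R0_def)
    ultimately show ?thesis using finR[of L] ne L by (intro exI[of _ "rot_ends E L - D"]) auto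
  qed
  then obtain T where T: "\<And>v. v \<in> R0 \<Longrightarrow> finite (T v) \<and> a - card D \<le> card (T v) \<and> (\<forall>w\<in>T v. {v, w} \<in> B)"
    by (metis (no_types))
  have "(a - card D)\<^sup>2 \<le> (\<Sum>v\<in>R0. a - card D)"
    using cR0 by (simp add: power2_eq_square)
  also have "\<dots> \<le> (\<Sum>v\<in>R0. card (T v))" using T by (intro sum_mono) auto
  also have "\<dots> = card (Sigma R0 T)"
    using T finR[of L0] ne0 L0 by (intro card_SigmaI[symmetric]) (auto simp: R0_def)
  also have "\<dots> \<le> card {(u, v). {u, v} \<in> B}"
  proof (rule card_mono)
    show "finite {(u, v). {u, v} \<in> B}" using finB cardB by (rule card_ordered_pairs)
    show "Sigma R0 T \<subseteq> {(u, v). {u, v} \<in> B}" using T by blast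
  qed
  also have "\<dots> \<le> 2 * card B" using finB cardB by (rule card_ordered_pairs)
  finally show ?thesis by (simp add: B_def)
qed

section \<open>Path covers and orderings\<close>

text \<open>The last conjunct serves the induction: a new first vertex adjacent to the old one is
  prepended to the path that starts there.\<close>

lemma path_cover_of_list:
  assumes "distinct L" "L \<noteq> []"
  shows "\<exists>P. is_path_cover (set L) E P \<and> card P = gaps E L + 1 \<and> (\<exists>p\<in>P. hd p = hd L)"
  using assms(2,1)
proof (induction L rule: list_nonempty_induct)
  case (single x)
  show ?case
    by (intro exI[of _ "{[x]}"]) (simp add: is_path_cover_def is_path_def)
next
  case (cons x xs)
  then obtain P p where P: "is_path_cover (set xs) E P" "card P = gaps E xs + 1" "p \<in> P" "hd p = hd xs"
    by auto
  have fin: "finite P" and paths: "\<And>q. q \<in> P \<Longrightarrow> is_path (set xs) E q"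
    and disj: "pairwise (\<lambda>xs ys. set xs \<inter> set ys = {}) P" and un: "(\<Union>q\<in>P. set q) = set xs"
    using P(1) by (auto simp: is_path_cover_def)
  have x: "x \<notin> set xs" using cons by simp
  have paths': "is_path (set (x # xs)) E q" if "q \<in> P" for q
    using paths[OF that] by (auto simp: is_path_def)
  have notin: "x \<notin> set q" if "q \<in> P" for q using un x that by auto
  show ?case
  proof (cases "{x, hd xs} \<in> E")
    case True
    let ?P = "insert (x # p) (P - {p})"
    have "x # p \<notin> P" using notin by fastforce
    have "is_path (set (x # xs)) E (x # p)"
      using paths'[OF P(3)] notin[OF P(3)] True P(4)
      by (auto simp: is_path_def successively_Cons)
    moreover have "pairwise (\<lambda>xs ys. set xs \<inter> set ys = {}) ?P"
    proof -
      have "set p \<inter> set q = {}" if "q \<in> P - {p}" for q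
        using disj P(3) that by (auto simp: pairwise_def)
      then show ?thesis
        using notin disj by (auto simp: pairwise_insert pairwise_def)
    qed
    moreover have "(\<Union>q\<in>?P. set q) = set (x # xs)" using un P(3) by auto
    ultimately have "is_path_cover (set (x # xs)) E ?P"
      using fin paths' by (simp add: is_path_cover_def)
    moreover have "card ?P = gaps E (x # xs) + 1"
      using fin \<open>x # p \<notin> P\<close> P(2,3) cons.hyps True by (simp add: gaps_Cons card_Suc_Diff1)
    ultimately show ?thesis by (intro exI[of _ ?P]) auto
  next
    case False
    let ?P = "insert [x] P"
    have "[x] \<notin> P" using notin by fastforce
    have "pairwise (\<lambda>xs ys. set xs \<inter> set ys = {}) ?P"
      using disj notin by (simp add: pairwise_insert)
    moreover have "is_path (set (x # xs)) E [x]" by (simp add: is_path_def)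
    ultimately have "is_path_cover (set (x # xs)) E ?P"
      using fin paths' un by (simp add: is_path_cover_def)
    moreover have "card ?P = gaps E (x # xs) + 1"
      using fin \<open>[x] \<notin> P\<close> P(2) cons.hyps False by (simp add: gaps_Cons)
    ultimately show ?thesis by (intro exI[of _ ?P]) auto
  qed
qed

lemma gaps_path: "is_path V E xs \<Longrightarrow> gaps E xs = 0"
  unfolding is_path_def
  by (induction E xs rule: gaps.induct) auto

lemma gaps_concat_le: "(\<And>p. p \<in> set ps \<Longrightarrow> p \<noteq> [] \<and> gaps E p = 0) \<Longrightarrow> gaps E (concat ps) \<le> length ps"
proof (induction ps)
  case (Cons p ps)
  have "gaps E (concat ps) \<le> length ps" by (rule Cons.IH) (use Cons.prems in auto)
  moreover have "p \<noteq> []" "gaps E p = 0" using Cons.prems by auto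
  ultimately show ?case by (cases "concat ps = []") (simp_all add: gaps_append del: concat_eq_Nil_conv)
qed simp

text \<open>Concatenating the paths of a cover creates gaps only at the seams. The convention for
  Hamiltonian graphs fits, since a Hamilton cycle cut open is an ordering without gaps.\<close>

lemma gap_number_le_path_cover_number:
  assumes "finite V" "V \<noteq> {}"
  shows "gap_number V E \<le> path_cover_number V E"
proof (cases "hamiltonian V E")
  case True
  then obtain xs where "is_cycle V E xs" "set xs = V" by (auto simp: hamiltonian_def)
  then have "is_path V E xs" "distinct xs" by (auto simp: is_cycle_def is_path_def)
  then have "gap_number V E = 0"
    using gap_number_le[of xs V E] gaps_path[of V E xs] \<open>set xs = V\<close> by simp
  then show ?thesis by simp
next
  case False
  obtain L where "distinct L" "set L = V" using finite_distinct_list[OF assms(1)] by auto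
  moreover have "L \<noteq> []" using assms calculation by auto
  ultimately have "\<exists>k P. is_path_cover V E P \<and> card P = k"
    using path_cover_of_list[of L E] by blast
  then have "\<exists>P. is_path_cover V E P \<and> card P = path_cover_number V E"
    using False unfolding path_cover_number_def by (simp only: if_False) (rule LeastI_ex)
  then obtain P where P: "is_path_cover V E P" "card P = path_cover_number V E" by blast
  then obtain ps where ps: "set ps = P" "distinct ps"
    by (metis finite_distinct_list is_path_cover_def)
  have path: "is_path V E p" if "p \<in> set ps" for p using P that ps by (auto simp: is_path_cover_def)
  have "distinct (concat ps)"
    using P ps path by (intro distinct_concat) (auto simp: is_path_cover_def pairwise_def is_path_def)
  moreover have "set (concat ps) = V" using P ps by (auto simp: is_path_cover_def)
  ultimately have "gap_number V E \<le> gaps E (concat ps)" by (rule gap_number_le)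
  also have "\<dots> \<le> length ps"
  proof (rule gaps_concat_le)
    fix p assume "p \<in> set ps"
    then have "is_path V E p" by (rule path)
    then show "p \<noteq> [] \<and> gaps E p = 0" using gaps_path[of V E p] by (simp add: is_path_def)
  qed
  also have "\<dots> = path_cover_number V E" using ps P(2) distinct_card by metis
  finally show ?thesis .
qed

lemma path_cover_number_le_gap_number:
  assumes "finite V" "V \<noteq> {}"
  shows "path_cover_number V E \<le> gap_number V E + 1"
proof -
  obtain L where L: "distinct L" "set L = V" "gaps E L = gap_number V E"
    using assms(1) by (rule gap_number_witness)
  then have "L \<noteq> []" using assms(2) by auto
  then obtain P where "is_path_cover V E P" "card P = gap_number V E + 1"
    using path_cover_of_list[of L E] L by auto
  then show ?thesis unfolding path_cover_number_def by (auto intro!: Least_le)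
qed

section \<open>Gaps forced by vertices of degree one\<close>

lemma nbrs_single: "nbrs E {v} = {x. {v, x} \<in> E}"
  by (auto simp: nbrs_def)

lemma card_gap_ends: "card (\<Union>{e \<in> links L. e \<notin> E}) \<le> 2 * gaps E L"
proof (induction L)
  case (Cons x xs)
  show ?case
  proof (cases "xs = []")
    case False
    let ?U = "\<lambda>xs. \<Union>{e \<in> links xs. e \<notin> E}"
    have "?U (x # xs) = (if {x, hd xs} \<in> E then ?U xs else insert x (insert (hd xs) (?U xs)))"
      using False by (auto simp: links_Cons)
    moreover have "finite (?U xs)"
      using links_subset[of _ xs] by (intro finite_subset[of "?U xs" "set xs"]) auto
    ultimately show ?thesis using Cons False by (auto simp: gaps_Cons card_insert_if)
  qed simp
qed simp

text \<open>Each gap serves at most two vertices of degree one, which is where the factor 1/2 of the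
  theorem comes from; the \<open>+ 2\<close> is for the two ends of the ordering.\<close>

lemma card_degree_one_le:
  assumes "finite V"
  shows "card {v \<in> V. card (nbrs E {v}) = 1} \<le> 2 * gap_number V E + 2"
proof -
  obtain L where L: "distinct L" "set L = V" "gaps E L = gap_number V E"
    using assms(1) by (rule gap_number_witness)
  let ?U = "\<Union>{e \<in> links L. e \<notin> E}"
  have "{v \<in> V. card (nbrs E {v}) = 1} \<subseteq> {hd L, last L} \<union> ?U"
  proof
    fix v assume v: "v \<in> {v \<in> V. card (nbrs E {v}) = 1}"
    then obtain xs ys where s: "L = xs @ v # ys" using L split_list by (metis (no_types, lifting) mem_Collect_eq)
    show "v \<in> {hd L, last L} \<union> ?U"
    proof (cases "xs = [] \<or> ys = []")
      case False
      have l: "{last xs, v} \<in> links L" "{v, hd ys} \<in> links L"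
        using False by (auto simp: s links_append links_Cons)
      have "last xs \<in> set xs" "hd ys \<in> set ys" using False by auto
      then have ne: "last xs \<noteq> hd ys" using L s by auto
      have "\<not> ({last xs, v} \<in> E \<and> {v, hd ys} \<in> E)"
      proof
        assume "{last xs, v} \<in> E \<and> {v, hd ys} \<in> E"
        then have "last xs \<in> nbrs E {v}" "hd ys \<in> nbrs E {v}"
          by (auto simp: nbrs_single insert_commute)
        moreover obtain w where "nbrs E {v} = {w}" using v by (auto simp: card_1_singleton_iff)
        ultimately show False using ne by simp
      qed
      then show ?thesis using l by blast
    qed (auto simp: s)
  qed
  then have "card {v \<in> V. card (nbrs E {v}) = 1} \<le> card ({hd L, last L} \<union> ?U)"
    using links_subset[of _ L] by (intro card_mono) (auto intro: finite_subset[of ?U "set L"])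
  also have "\<dots> \<le> card {hd L, last L} + card ?U" by (rule card_Un_le)
  also have "\<dots> \<le> 2 + 2 * gap_number V E"
    using card_gap_ends[of L E] L card_insert_le_m1[of 2 "{last L}" "hd L"] by simp
  finally show ?thesis by simp
qed

section \<open>Expectations over a random subset\<close>

text \<open>The expectation over a random subset of \<open>A\<close> that contains each element
  independently with probability \<open>p\<close>. As a finite sum it turns exposure in rounds and
  conditioning into identities that follow by inserting one element at a time;
  \<open>prob_gnp\<close> is the only link to \<open>gnp\<close>.\<close>

definition expect :: "real \<Rightarrow> 'a set \<Rightarrow> ('a set \<Rightarrow> real) \<Rightarrow> real" where
  "expect p A f = (\<Sum>X\<in>Pow A. p ^ card X * (1 - p) ^ card (A - X) * f X)"

lemma expect_empty [simp]: "expect p {} f = f {}"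
  by (simp add: expect_def)

lemma expect_insert:
  assumes "finite A" "a \<notin> A"
  shows "expect p (insert a A) f = p * expect p A (\<lambda>X. f (insert a X)) + (1 - p) * expect p A f"
proof -
  let ?g = "\<lambda>B X. p ^ card X * (1 - p) ^ card (B - X) * f X"
  have "expect p (insert a A) f = sum (?g (insert a A)) (Pow A) + sum (?g (insert a A)) (insert a ` Pow A)"
    unfolding expect_def Pow_insert using assms by (intro sum.union_disjoint) auto
  also have "sum (?g (insert a A)) (insert a ` Pow A) = (\<Sum>X\<in>Pow A. ?g (insert a A) (insert a X))"
    using assms by (subst sum.reindex) (auto simp: inj_on_def)
  also have "\<dots> = p * expect p A (\<lambda>X. f (insert a X))"
    unfolding expect_def sum_distrib_left
  proof (intro sum.cong refl)
    fix X assume "X \<in> Pow A"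
    then have "finite X" "a \<notin> X" using assms finite_subset by auto
    then have "card (insert a X) = Suc (card X)" "insert a A - insert a X = A - X"
      using assms by auto
    then show "?g (insert a A) (insert a X)
        = p * (p ^ card X * (1 - p) ^ card (A - X) * f (insert a X))" by simp
  qed
  also have "sum (?g (insert a A)) (Pow A) = (1 - p) * expect p A f"
    unfolding expect_def sum_distrib_left
  proof (intro sum.cong refl)
    fix X assume "X \<in> Pow A"
    then have "insert a A - X = insert a (A - X)" using assms by auto
    then have "card (insert a A - X) = Suc (card (A - X))" using assms by simp
    then show "?g (insert a A) X = (1 - p) * (p ^ card X * (1 - p) ^ card (A - X) * f X)" by simp
  qed
  finally show ?thesis by simp
qed

lemma expect_cong: "(\<And>X. X \<subseteq> A \<Longrightarrow> f X = g X) \<Longrightarrow> expect p A f = expect p A g"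
  by (simp add: expect_def)

lemma expect_mono:
  assumes "0 \<le> p" "p \<le> 1" "\<And>X. X \<subseteq> A \<Longrightarrow> f X \<le> g X"
  shows "expect p A f \<le> expect p A g"
  unfolding expect_def using assms by (intro sum_mono mult_left_mono) auto

lemma expect_add: "expect p A (\<lambda>X. f X + g X) = expect p A f + expect p A g"
  by (simp add: expect_def distrib_left sum.distrib)

lemma expect_cmult: "expect p A (\<lambda>X. c * f X) = c * expect p A f"
  by (simp add: expect_def sum_distrib_left mult_ac)

lemma expect_multc: "expect p A (\<lambda>X. f X * c) = expect p A f * c"
  by (simp add: expect_def sum_distrib_left sum_distrib_right mult_ac)

lemma expect_diff: "expect p A (\<lambda>X. f X - g X) = expect p A f - expect p A g"
  by (simp add: expect_def right_diff_distrib sum_subtractf)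

lemma expect_sum: "expect p A (\<lambda>X. \<Sum>i\<in>I. f i X) = (\<Sum>i\<in>I. expect p A (f i))"
  unfolding expect_def sum_distrib_left by (rule sum.swap)

lemma expect_const: "finite A \<Longrightarrow> expect p A (\<lambda>_. c) = c"
  by (induction A rule: finite_induct) (simp_all add: expect_insert algebra_simps)

lemma expect_nonneg:
  "0 \<le> p \<Longrightarrow> p \<le> 1 \<Longrightarrow> (\<And>X. X \<subseteq> A \<Longrightarrow> 0 \<le> f X) \<Longrightarrow> 0 \<le> expect p A f"
  unfolding expect_def by (intro sum_nonneg) auto

lemma expect_Un:
  assumes "finite A" "finite B" "A \<inter> B = {}"
  shows "expect p (A \<union> B) f = expect p A (\<lambda>X. expect p B (\<lambda>Y. f (X \<union> Y)))"
  using assms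
proof (induction A arbitrary: f rule: finite_induct)
  case (insert a A)
  then have "expect p (insert a (A \<union> B)) f
     = p * expect p A (\<lambda>X. expect p B (\<lambda>Y. f (insert a (X \<union> Y)))) +
       (1 - p) * expect p A (\<lambda>X. expect p B (\<lambda>Y. f (X \<union> Y)))"
    by (subst expect_insert) auto
  then show ?case using insert by (simp add: expect_insert)
qed simp

lemma expect_split:
  assumes "finite A" "B \<subseteq> A"
  shows "expect p A f = expect p B (\<lambda>X. expect p (A - B) (\<lambda>Y. f (X \<union> Y)))"
  using expect_Un[of B "A - B" p f] assms finite_subset[of B A] by (auto simp: Un_absorb1)

lemma expect_indep:
  assumes "finite A" "B \<subseteq> A"
  shows "expect p A (\<lambda>X. g (X \<inter> B) * h (X - B)) = expect p B g * expect p (A - B) h"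
proof -
  have "expect p A (\<lambda>X. g (X \<inter> B) * h (X - B))
     = expect p B (\<lambda>X. expect p (A - B) (\<lambda>Y. g ((X \<union> Y) \<inter> B) * h (X \<union> Y - B)))"
    using assms by (rule expect_split)
  also have "\<dots> = expect p B (\<lambda>X. expect p (A - B) (\<lambda>Y. g X * h Y))"
  proof (intro expect_cong)
    fix X Y assume "X \<subseteq> B" "Y \<subseteq> A - B"
    then have "(X \<union> Y) \<inter> B = X" "X \<union> Y - B = Y" by auto
    then show "g ((X \<union> Y) \<inter> B) * h (X \<union> Y - B) = g X * h Y" by simp
  qed
  also have "\<dots> = expect p B g * expect p (A - B) h"
    by (simp add: expect_cmult expect_multc)
  finally show ?thesis .
qed

lemma expect_restrict:
  assumes "finite A" "B \<subseteq> A"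
  shows "expect p A (\<lambda>X. g (X \<inter> B)) = expect p B g"
  using expect_indep[OF assms, of p g "\<lambda>_. 1"] assms by (simp add: expect_const)

text \<open>Two-round exposure: an element is missed by both independent rounds with probability
  \<open>(1 - p) * (1 - q)\<close>.\<close>

lemma expect_union:
  assumes "finite A"
  shows "expect (p + q - p * q) A f = expect p A (\<lambda>X. expect q A (\<lambda>Y. f (X \<union> Y)))"
  using assms
proof (induction A arbitrary: f rule: finite_induct)
  case (insert a A)
  define e where "e = (\<lambda>f. expect p A (\<lambda>X. expect q A (\<lambda>Y. f (X \<union> Y))))"
  have "expect (p + q - p * q) (insert a A) f
      = (p + q - p * q) * e (\<lambda>X. f (insert a X)) + (1 - (p + q - p * q)) * e f"
    using insert by (simp add: expect_insert e_def)
  moreover have "expect p (insert a A) (\<lambda>X. expect q (insert a A) (\<lambda>Y. f (X \<union> Y)))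
      = p * (q * e (\<lambda>X. f (insert a X)) + (1 - q) * e (\<lambda>X. f (insert a X)))
        + (1 - p) * (q * e (\<lambda>X. f (insert a X)) + (1 - q) * e f)"
    using insert by (simp add: expect_insert expect_add expect_cmult e_def) (simp add: algebra_simps)
  ultimately show ?case by (simp add: algebra_simps)
qed simp

lemma expect_contains_avoids:
  assumes "finite A" "U \<subseteq> A" "W \<subseteq> A" "U \<inter> W = {}"
  shows "expect p A (\<lambda>X. of_bool (U \<subseteq> X \<and> X \<inter> W = {})) = p ^ card U * (1 - p) ^ card W"
proof -
  have fin: "finite U" "finite W" using assms by (auto intro: finite_subset)
  have "expect p A (\<lambda>X. of_bool (U \<subseteq> X \<and> X \<inter> W = {}))
      = expect p A (\<lambda>X. of_bool (X \<inter> U = U) * of_bool ((X - U) \<inter> W = {}))"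
    using assms by (intro expect_cong) auto
  also have "\<dots> = expect p U (\<lambda>X. of_bool (X = U)) * expect p (A - U) (\<lambda>X. of_bool (X \<inter> W = {}))"
    using assms(1,2) by (rule expect_indep)
  also have "expect p (A - U) (\<lambda>X. of_bool (X \<inter> W = {})) = expect p W (\<lambda>X. of_bool (X = {}))"
    using assms by (intro expect_restrict) auto
  also have "\<dots> = (1 - p) ^ card W"
  proof -
    have "expect p W (\<lambda>X. of_bool (X = {})) = (\<Sum>X\<in>Pow W. if X = {} then (1 - p) ^ card W else 0)"
      unfolding expect_def by (intro sum.cong) auto
    then show ?thesis using fin by simp
  qed
  also have "expect p U (\<lambda>X. of_bool (X = U)) = p ^ card U"
  proof -
    have "expect p U (\<lambda>X. of_bool (X = U)) = (\<Sum>X\<in>Pow U. if X = U then p ^ card U else 0)"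
      unfolding expect_def by (intro sum.cong) auto
    then show ?thesis using fin by simp
  qed
  finally show ?thesis .
qed

text \<open>Law of total variance for the status of \<open>a\<close>: the variance is the average of
  the two conditional ones plus \<open>p * (1 - p) * (m1 - m0)\<^sup>2\<close>, and the conditional
  means differ by at most \<open>K\<close>. The factor \<open>p\<close> is essential: there are
  about n^2 / 2 pairs, but for p = c / n the bound is linear in n.\<close>

lemma expect_variance_le:
  fixes p K :: real
  assumes "finite A" "0 \<le> p" "p \<le> 1"
    and "\<And>a X. a \<in> A \<Longrightarrow> X \<subseteq> A \<Longrightarrow> \<bar>f (insert a X) - f X\<bar> \<le> K"
  shows "expect p A (\<lambda>X. (f X)\<^sup>2) - (expect p A f)\<^sup>2 \<le> card A * p * K\<^sup>2"
  using assms(1,4)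
proof (induction A arbitrary: f rule: finite_induct)
  case (insert a A)
  define f' where "f' = (\<lambda>X. f (insert a X))"
  define v where "v = card A * p * K\<^sup>2"
  have IH0: "expect p A (\<lambda>X. (f X)\<^sup>2) - (expect p A f)\<^sup>2 \<le> v"
    unfolding v_def by (rule insert.IH, rule insert.prems) auto
  have IH1: "expect p A (\<lambda>X. (f' X)\<^sup>2) - (expect p A f')\<^sup>2 \<le> v"
    unfolding v_def
  proof (rule insert.IH)
    fix b X assume "b \<in> A" "X \<subseteq> A"
    then show "\<bar>f' (insert b X) - f' X\<bar> \<le> K"
      using insert.prems[of b "insert a X"] by (auto simp: f'_def insert_commute)
  qed
  have close: "\<bar>f' X - f X\<bar> \<le> K" if "X \<subseteq> A" for X
    using insert.prems[of a X] that by (auto simp: f'_def)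
  have "expect p A (\<lambda>X. f' X - f X) \<le> expect p A (\<lambda>_. K)"
    using assms(2,3) close by (intro expect_mono) (auto simp: abs_le_iff)
  then have up: "expect p A (\<lambda>X. f' X - f X) \<le> K" using insert.hyps by (simp add: expect_const)
  have "expect p A (\<lambda>_. - K) \<le> expect p A (\<lambda>X. f' X - f X)"
    using assms(2,3) close by (intro expect_mono) (auto simp: abs_le_iff intro: minus_le_iff[THEN iffD1])
  then have lo: "- K \<le> expect p A (\<lambda>X. f' X - f X)" using insert.hyps by (simp add: expect_const)
  define m1 m0 where "m1 = expect p A f'" and "m0 = expect p A f"
  have "\<bar>m1 - m0\<bar> \<le> K" using up lo by (simp add: expect_diff m1_def m0_def abs_le_iff)
  then have "(m1 - m0)\<^sup>2 \<le> K\<^sup>2" using power_mono[of "\<bar>m1 - m0\<bar>" K 2] by simp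
  moreover have "p * (1 - p) \<le> p" using assms by (simp add: mult_left_le)
  ultimately have "p * (1 - p) * (m1 - m0)\<^sup>2 \<le> p * K\<^sup>2"
    using assms by (intro mult_mono) auto
  moreover have "expect p (insert a A) (\<lambda>X. (f X)\<^sup>2) - (expect p (insert a A) f)\<^sup>2
     = p * (expect p A (\<lambda>X. (f' X)\<^sup>2) - m1\<^sup>2) + (1 - p) * (expect p A (\<lambda>X. (f X)\<^sup>2) - m0\<^sup>2)
       + p * (1 - p) * (m1 - m0)\<^sup>2"
    using insert.hyps by (simp add: expect_insert f'_def m1_def m0_def power2_eq_square algebra_simps)
  moreover have "p * (expect p A (\<lambda>X. (f' X)\<^sup>2) - m1\<^sup>2) + (1 - p) * (expect p A (\<lambda>X. (f X)\<^sup>2) - m0\<^sup>2)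
     \<le> p * v + (1 - p) * v"
    using IH0 IH1 assms unfolding m1_def m0_def by (intro add_mono mult_left_mono) auto
  moreover have "p * v + (1 - p) * v = v" by (simp add: algebra_simps)
  ultimately have "expect p (insert a A) (\<lambda>X. (f X)\<^sup>2) - (expect p (insert a A) f)\<^sup>2 \<le> v + p * K\<^sup>2"
    by linarith
  also have "\<dots> = card (insert a A) * p * K\<^sup>2"
    using insert.hyps by (simp add: v_def algebra_simps)
  finally show ?case .
qed simp

lemma expect_chebyshev:
  fixes p K :: real
  assumes "finite A" "0 \<le> p" "p \<le> 1" "t > 0"
    and "\<And>a X. a \<in> A \<Longrightarrow> X \<subseteq> A \<Longrightarrow> \<bar>f (insert a X) - f X\<bar> \<le> K"
  shows "expect p A (\<lambda>X. of_bool (\<bar>f X - expect p A f\<bar> \<ge> t)) \<le> card A * p * K\<^sup>2 / t\<^sup>2"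
proof -
  define m where "m = expect p A f"
  have "expect p A (\<lambda>X. of_bool (\<bar>f X - m\<bar> \<ge> t)) \<le> expect p A (\<lambda>X. (f X - m)\<^sup>2 * (1 / t\<^sup>2))"
  proof (rule expect_mono[OF assms(2,3)])
    fix X
    have "t\<^sup>2 \<le> (f X - m)\<^sup>2" if "t \<le> \<bar>f X - m\<bar>"
      using that assms(4) power_mono[of t "\<bar>f X - m\<bar>" 2] by simp
    then show "of_bool (\<bar>f X - m\<bar> \<ge> t) \<le> (f X - m)\<^sup>2 * (1 / t\<^sup>2)"
      using assms(4) by (auto simp: of_bool_def field_simps)
  qed
  also have "\<dots> = expect p A (\<lambda>X. (f X - m)\<^sup>2) / t\<^sup>2"
    by (simp add: expect_multc del: times_divide_eq_right) simp
  also have "expect p A (\<lambda>X. (f X - m)\<^sup>2) = expect p A (\<lambda>X. (f X)\<^sup>2 - 2 * m * f X + m\<^sup>2)"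
    by (intro expect_cong) (simp add: power2_eq_square algebra_simps)
  also have "\<dots> = expect p A (\<lambda>X. (f X)\<^sup>2) - 2 * m * m + m\<^sup>2"
    using assms(1) by (simp add: expect_add expect_diff expect_cmult expect_const flip: m_def)
  also have "\<dots> = expect p A (\<lambda>X. (f X)\<^sup>2) - (expect p A f)\<^sup>2"
    by (simp add: m_def power2_eq_square)
  also have "\<dots> / t\<^sup>2 \<le> card A * p * K\<^sup>2 / t\<^sup>2"
    using assms by (intro divide_right_mono expect_variance_le) auto
  finally show ?thesis by (simp add: m_def)
qed

section \<open>The law of the binomial random graph as a finite expectation\<close>

lemma finite_vertex_pairs: "finite V \<Longrightarrow> finite (vertex_pairs V)"
  by (simp add: vertex_pairs_def)

lemma prob_gnp:
  assumes "0 \<le> p" "p \<le> 1"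
  shows "measure_pmf.prob (gnp n p) S = expect p (vertex_pairs {1..n}) (\<lambda>E. of_bool (E \<in> S))"
proof -
  define A where "A = vertex_pairs {1..n}"
  have fin: "finite A" by (simp add: A_def finite_vertex_pairs)
  let ?P = "Pi_pmf A False (\<lambda>_. bernoulli_pmf p)"
  have sub: "set_pmf (gnp n p) \<subseteq> Pow A"
    unfolding gnp_def A_def by (auto simp: set_map_pmf)
  have pmf: "pmf (gnp n p) X = p ^ card X * (1 - p) ^ card (A - X)" if "X \<subseteq> A" for X
  proof -
    have "pmf (gnp n p) X = measure_pmf.prob ?P ((\<lambda>f. {e \<in> A. f e}) -` {X})"
      by (simp add: gnp_def pmf_map A_def)
    also have "(\<lambda>f. {e \<in> A. f e}) -` {X} = Pi A (\<lambda>e. {e \<in> X})"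
      using that by (auto simp: Pi_def)
    also have "measure_pmf.prob ?P (Pi A (\<lambda>e. {e \<in> X}))
        = (\<Prod>e\<in>A. measure_pmf.prob (bernoulli_pmf p) {e \<in> X})"
      using fin by (rule measure_Pi_pmf_Pi)
    also have "\<dots> = (\<Prod>e\<in>A. if e \<in> X then p else 1 - p)"
      using assms by (intro prod.cong) (auto simp: measure_pmf_single)
    also have "\<dots> = (\<Prod>e\<in>A \<inter> X. p) * (\<Prod>e\<in>A - X. 1 - p)"
      using fin by (subst prod.If_cases) (auto simp: Diff_eq)
    also have "\<dots> = p ^ card X * (1 - p) ^ card (A - X)"
      using that by (simp add: Int_absorb1)
    finally show ?thesis .
  qed
  have "measure_pmf.prob (gnp n p) S = measure_pmf.prob (gnp n p) (S \<inter> Pow A)"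
    using sub by (intro measure_pmf.finite_measure_eq_AE) (auto simp: AE_measure_pmf_iff)
  also have "\<dots> = (\<Sum>X\<in>S \<inter> Pow A. pmf (gnp n p) X)"
    using fin by (intro measure_measure_pmf_finite) auto
  also have "\<dots> = (\<Sum>X\<in>Pow A. if X \<in> S then pmf (gnp n p) X else 0)"
    using fin by (subst sum.inter_restrict[symmetric]) (auto simp: Int_commute)
  also have "\<dots> = expect p A (\<lambda>E. of_bool (E \<in> S))"
    unfolding expect_def using pmf by (intro sum.cong) auto
  finally show ?thesis by (simp add: A_def)
qed

section \<open>Expansion away from tangled low-degree vertices\<close>

text \<open>Disjoint stars mean that their centres are at distance at least 3.\<close>

definition star :: "'a set set \<Rightarrow> 'a \<Rightarrow> 'a set" where
  "star H u = insert u (nbrs H {u})"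

lemma nbrs_mono: "E \<subseteq> E' \<Longrightarrow> S \<subseteq> S' \<Longrightarrow> nbrs E S \<subseteq> nbrs E' S'"
  by (fastforce simp: nbrs_def)

lemma nbrs_UN: "nbrs E S = (\<Union>v\<in>S. nbrs E {v})"
  by (auto simp: nbrs_def)

lemma nbrs_subset: "E \<subseteq> vertex_pairs V \<Longrightarrow> nbrs E S \<subseteq> V"
  by (auto simp: nbrs_def vertex_pairs_def)

lemma vertex_pairs_irrefl: "E \<subseteq> vertex_pairs V \<Longrightarrow> {v, x} \<in> E \<Longrightarrow> v \<noteq> x"
  by (auto simp: vertex_pairs_def)

text \<open>In the application \<open>G\<close> is the first round and \<open>H\<close> adds the
  second-round edges at the low vertices \<open>D\<close>. The set \<open>S\<close> is split into
  tame low vertices, vertices outside \<open>D\<close>, and vertices of \<open>B\<close>. Tame low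
  vertices have disjoint neighbourhoods outside \<open>D\<close>, so they miss the goal of two
  neighbours each only through their degrees. A vertex outside \<open>D\<close> has many neighbours,
  and a set of such vertices with few neighbours would span a dense subgraph. Vertices of
  \<open>B\<close> are paid for in full: 2 for being in \<open>S\<close>, and 1 for possibly having
  been counted as a new neighbour.\<close>

lemma expansion:
  fixes V :: "'a set" and G H :: "'a set set"
  assumes V: "finite V" and GH: "G \<subseteq> H" "H \<subseteq> vertex_pairs V" and D: "D \<subseteq> V" "B \<subseteq> D"
    and deg: "\<And>v. v \<in> V - D \<Longrightarrow> 17 \<le> card (nbrs G {v})"
    and disj: "\<And>u u'. u \<in> D - B \<Longrightarrow> u' \<in> D \<Longrightarrow> u \<noteq> u' \<Longrightarrow> star H u \<inter> star H u' = {}"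
    and few: "\<And>v. v \<in> V - D \<Longrightarrow> card (nbrs G {v} \<inter> (\<Union>u\<in>D - B. star H u)) \<le> 1"
    and sparse: "\<And>T s. T \<subseteq> V \<Longrightarrow> card T = 4 * s \<Longrightarrow> x < s \<Longrightarrow> s \<le> y \<Longrightarrow> card {e \<in> G. e \<subseteq> T} < 8 * s"
    and large: "\<And>S. S \<subseteq> V \<Longrightarrow> y < card S \<Longrightarrow> card S \<le> a \<Longrightarrow> 2 * card S \<le> card (nbrs G S - S)"
    and y: "4 * y \<le> card V"
    and d: "card {v \<in> D - B. card (nbrs H {v}) = 1} + 2 * card {v \<in> D - B. nbrs H {v} = {}}
      + 3 * card B + 3 * x \<le> d"
    and S: "S \<subseteq> V" "card S \<le> a"
  shows "2 * card S \<le> card (nbrs H S \<inter> V - S) + d"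
proof (cases "y < card S")
  case True
  have "2 * card S \<le> card (nbrs G S - S)" using large S True by blast
  also have "\<dots> \<le> card (nbrs H S \<inter> V - S)"
  proof (rule card_mono)
    have "nbrs G S \<subseteq> nbrs H S" using GH(1) by (rule nbrs_mono) simp
    then show "nbrs G S - S \<subseteq> nbrs H S \<inter> V - S" using nbrs_subset[OF GH(2), of S] by blast
  qed (use V in simp)
  finally show ?thesis by simp
next
  case False
  note irr = vertex_pairs_irrefl[OF GH(2)]
  have finN: "finite (nbrs E T)" if "E \<subseteq> H" for E T
    using nbrs_subset[of E V T] that GH V finite_subset by (metis order_trans)
  define S1 S2 S3 where "S1 = S \<inter> (D - B)" and "S2 = S - D" and "S3 = S \<inter> B"
  have fin: "finite S1" "finite S2" "finite S3" "finite B" "finite D"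
    using S D V by (auto simp: S1_def S2_def S3_def intro: finite_subset)
  have Seq: "S = S1 \<union> S2 \<union> S3" using D by (auto simp: S1_def S2_def S3_def)
  have "card S = card (S1 \<union> S2) + card S3"
    unfolding Seq using fin by (intro card_Un_disjoint) (use D in \<open>auto simp: S1_def S2_def S3_def\<close>)
  also have "card (S1 \<union> S2) = card S1 + card S2"
    using fin by (intro card_Un_disjoint) (auto simp: S1_def S2_def)
  finally have cS: "card S = card S1 + card S2 + card S3" .
  have cS3: "card S3 \<le> card B" using fin by (intro card_mono) (auto simp: S3_def)
  define U where "U = nbrs H S1"
  have finU: "finite U" by (simp add: U_def finN)
  have UD: "U \<inter> D = {}"
  proof -
    have False if "x \<in> U" "x \<in> D" for x
    proof -
      obtain u where u: "u \<in> S1" "{u, x} \<in> H" using \<open>x \<in> U\<close> by (auto simp: U_def nbrs_def)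
      then have "star H u \<inter> star H x = {}"
        using irr[OF u(2)] \<open>x \<in> D\<close> by (intro disj) (auto simp: S1_def)
      moreover have "x \<in> star H u \<inter> star H x" using u by (auto simp: star_def nbrs_def)
      ultimately show False by blast
    qed
    then show ?thesis by blast
  qed
  have cU: "2 * card S1 \<le> card U + card {v \<in> D - B. card (nbrs H {v}) = 1}
      + 2 * card {v \<in> D - B. nbrs H {v} = {}}"
  proof -
    have "card U = (\<Sum>u\<in>S1. card (nbrs H {u}))"
      unfolding U_def nbrs_UN[of H S1]
    proof (rule card_UN_disjoint)
      show "\<forall>u\<in>S1. \<forall>u'\<in>S1. u \<noteq> u' \<longrightarrow> nbrs H {u} \<inter> nbrs H {u'} = {}"
        using disj unfolding S1_def star_def by blast
    qed (use fin finN in auto)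
    moreover have "2 * card S1 \<le> (\<Sum>u\<in>S1. card (nbrs H {u}) + of_bool (card (nbrs H {u}) = 1)
        + 2 * of_bool (nbrs H {u} = {}))"
    proof -
      have "(2::nat) \<le> card (nbrs H {u}) + of_bool (card (nbrs H {u}) = 1) + 2 * of_bool (nbrs H {u} = {})" for u
        using finN[of H "{u}"] by (cases "card (nbrs H {u})") (auto simp: card_eq_0_iff)
      then have "(\<Sum>u\<in>S1. 2) \<le> (\<Sum>u\<in>S1. card (nbrs H {u}) + of_bool (card (nbrs H {u}) = 1)
        + 2 * of_bool (nbrs H {u} = {}))" by (intro sum_mono) auto
      then show ?thesis by simp
    qed
    moreover have "(\<Sum>u\<in>S1. of_bool (card (nbrs H {u}) = 1)) \<le> card {v \<in> D - B. card (nbrs H {v}) = 1}"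
      using fin by (subst sum_of_bool_eq) (auto simp: S1_def intro!: card_mono)
    moreover have "(\<Sum>u\<in>S1. of_bool (nbrs H {u} = {})) \<le> card {v \<in> D - B. nbrs H {v} = {}}"
      using fin by (subst sum_of_bool_eq) (auto simp: S1_def intro!: card_mono)
    ultimately show ?thesis
      by (simp add: sum.distrib flip: sum_distrib_left)
  qed
  \<comment> \<open>Neighbours of \<open>S1\<close> that lie in \<open>S2\<close> are not external;
    this loses at most \<open>card S2\<close>.\<close>
  have cUS2: "card U \<le> card (U - S2) + card S2"
    using finU fin card_Un_le[of "U - S2" S2] card_mono[of "U - S2 \<union> S2" U] by auto
  have sub1: "U - S2 \<subseteq> nbrs H S \<inter> V - S"
  proof -
    have "U \<subseteq> nbrs H S" unfolding U_def by (rule nbrs_mono) (auto simp: S1_def)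
    moreover have "U \<subseteq> V" unfolding U_def using GH(2) by (rule nbrs_subset)
    moreover have "S - S2 \<subseteq> D" by (auto simp: S2_def)
    ultimately show ?thesis using UD by blast
  qed
  have finT: "finite (nbrs H S \<inter> V - S)" using V by auto
  show ?thesis
  \<comment> \<open>For small \<open>S2\<close> nothing is known about density, and the deficit pays
    \<open>3 * x\<close>: 2 for the vertices of \<open>S2\<close> and 1 for those they take from
    \<open>U\<close>.\<close>
  proof (cases "card S2 \<le> x")
    case True
    have "card (U - S2) \<le> card (nbrs H S \<inter> V - S)" using sub1 finT by (rule card_mono[rotated])
    then show ?thesis using cU cUS2 True d cS cS3 by linarith
  next
    case big: False
    have y2: "card S2 \<le> y" using False cS by simp
    define N2 where "N2 = nbrs G S2 - S2 - (S1 \<union> U)"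
    have finN2: "finite N2" using finN[OF GH(1)] by (simp add: N2_def)
    \<comment> \<open>Two new neighbours per vertex of \<open>S2\<close> and one more to replace the
      vertex it may take from \<open>U\<close>.\<close>
    have "3 * card S2 \<le> card N2"
    proof (rule ccontr)
      assume "\<not> ?thesis"
      then have "card (S2 \<union> N2) \<le> 4 * card S2" using card_Un_le[of S2 N2] by linarith
      \<comment> \<open>Room to pad \<open>S2 \<union> N2\<close> to exactly
        \<open>4 * card S2\<close> vertices, the size about which \<open>sparse\<close>
        speaks.\<close>
      moreover have "4 * card S2 \<le> card V" using y2 y by simp
      moreover have sub: "S2 \<union> N2 \<subseteq> V"
        using S nbrs_subset[of G V S2] GH by (auto simp: S2_def N2_def)
      ultimately obtain T where T: "S2 \<union> N2 \<subseteq> T" "T \<subseteq> V" "card T = 4 * card S2"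
        using exists_subset_between[of "S2 \<union> N2" "4 * card S2" V] V by auto
      have finT: "finite T" using T V finite_subset by auto
      have c16: "16 \<le> card (nbrs G {v} \<inter> T)" if v: "v \<in> S2" for v
      proof -
        have "v \<in> V - D" using v S by (auto simp: S2_def)
        note dg = deg[OF this] and fw = few[OF this]
        have "nbrs G {v} \<subseteq> nbrs G S2" using v by (intro nbrs_mono) auto
        moreover have "S1 \<union> U \<subseteq> (\<Union>u\<in>D - B. star H u)"
          unfolding U_def nbrs_UN[of H S1] by (auto simp: S1_def star_def)
        ultimately have "nbrs G {v} \<subseteq> (nbrs G {v} \<inter> T) \<union> (nbrs G {v} \<inter> (\<Union>u\<in>D - B. star H u))"
          using T(1) by (auto simp: N2_def)
        then have "card (nbrs G {v}) \<le> card ((nbrs G {v} \<inter> T) \<union> (nbrs G {v} \<inter> (\<Union>u\<in>D - B. star H u)))"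
          using finN[OF GH(1)] by (intro card_mono) auto
        also have "\<dots> \<le> card (nbrs G {v} \<inter> T) + card (nbrs G {v} \<inter> (\<Union>u\<in>D - B. star H u))"
          by (rule card_Un_le)
        finally show ?thesis using dg fw by linarith
      qed
      let ?E = "{e \<in> G. e \<subseteq> T}"
      have E2: "card e = 2" if "e \<in> ?E" for e using that GH by (auto simp: vertex_pairs_def)
      have finE: "finite ?E" using finT by (intro finite_subset[of ?E "Pow T"]) auto
      have "16 * card S2 = (\<Sum>v\<in>S2. 16)" by simp
      also have "\<dots> \<le> (\<Sum>v\<in>S2. card (nbrs G {v} \<inter> T))" by (intro sum_mono c16)
      also have "\<dots> = card (Sigma S2 (\<lambda>v. nbrs G {v} \<inter> T))"
        using fin finT by (intro card_SigmaI[symmetric]) auto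
      also have "\<dots> \<le> card {(u, v). {u, v} \<in> ?E}"
      proof (rule card_mono)
        show "finite {(u, v). {u, v} \<in> ?E}" using finE E2 by (rule card_ordered_pairs)
        show "Sigma S2 (\<lambda>v. nbrs G {v} \<inter> T) \<subseteq> {(u, v). {u, v} \<in> ?E}"
          using T(1) by (auto simp: nbrs_single)
      qed
      also have "\<dots> \<le> 2 * card ?E" using finE E2 by (rule card_ordered_pairs)
      also have "\<dots> < 2 * (8 * card S2)"
        using sparse[OF T(2,3)] big y2 by auto
      finally show False by simp
    qed
    moreover have "card ((U - S2) \<union> (N2 - S3)) \<le> card (nbrs H S \<inter> V - S)"
    proof (rule card_mono[OF finT])
      have "N2 - S3 \<subseteq> nbrs H S \<inter> V - S"
      proof -
        have "nbrs G S2 \<subseteq> nbrs H S" using GH(1) by (rule nbrs_mono) (auto simp: S2_def)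
        moreover have "nbrs H S \<subseteq> V" using GH(2) by (rule nbrs_subset)
        ultimately show ?thesis unfolding N2_def Seq by blast
      qed
      then show "(U - S2) \<union> (N2 - S3) \<subseteq> nbrs H S \<inter> V - S" using sub1 by blast
    qed
    moreover have "card ((U - S2) \<union> (N2 - S3)) = card (U - S2) + card (N2 - S3)"
      using finU finN2 by (intro card_Un_disjoint) (auto simp: N2_def)
    moreover have "card N2 - card S3 \<le> card (N2 - S3)" using fin by (intro diff_card_le_card_Diff)
    ultimately show ?thesis using cU cUS2 d cS cS3 by linarith
  qed
qed

section \<open>Low vertices close to each other or on short cycles\<close>

definition vertex_lists :: "'a set \<Rightarrow> nat \<Rightarrow> 'a list set" where
  "vertex_lists V k = {xs. distinct xs \<and> set xs \<subseteq> V \<and> length xs = k}"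

definition cycle_links :: "'a list \<Rightarrow> 'a set set" where
  "cycle_links xs = insert {last xs, hd xs} (links xs)"

text \<open>These configurations are the ones that spoil \<open>disj\<close> and \<open>few\<close>
  in \<open>expansion\<close>. Two meeting stars give a path with 2 or 3 vertices between low
  vertices. A vertex \<open>v\<close> with two neighbours in stars gives a path
  \<open>u1, y1, v, y2, u2\<close>, possibly shortened, between low vertices, or else a triangle or
  a 4-cycle through one low vertex.\<close>

definition tangled :: "'a set \<Rightarrow> 'a set set \<Rightarrow> 'a set \<Rightarrow> 'a set" where
  "tangled V G D = {u \<in> D.
     (\<exists>k\<in>{2..5}. \<exists>xs\<in>vertex_lists V k. hd xs = u \<and> last xs \<in> D \<and> links xs \<subseteq> G) \<or>
     (\<exists>k\<in>{3..4}. \<exists>xs\<in>vertex_lists V k. hd xs = u \<and> cycle_links xs \<subseteq> G)}"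

lemma not_tangled_path:
  assumes "u \<in> D - tangled V G D" "hd xs = u" "last xs \<in> D" "distinct xs" "set xs \<subseteq> V"
    "length xs \<in> {2..5}"
  shows "\<not> links xs \<subseteq> G"
  using assms by (auto simp: tangled_def vertex_lists_def)

lemma not_tangled_cycle:
  assumes "u \<in> D - tangled V G D" "hd xs = u" "distinct xs" "set xs \<subseteq> V" "length xs \<in> {3..4}"
  shows "\<not> cycle_links xs \<subseteq> G"
  using assms by (auto simp: tangled_def vertex_lists_def)

lemma not_tangled_stars:
  assumes G: "G \<subseteq> vertex_pairs V" and D: "D \<subseteq> V"
    and u: "u \<in> D - tangled V G D" "u' \<in> D" "u \<noteq> u'"
  shows "star G u \<inter> star G u' = {}"
proof -
  have False if z: "z \<in> star G u" "z \<in> star G u'" for z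
  proof -
    have V: "u \<in> V" "u' \<in> V" "z \<in> V"
      using u D z nbrs_subset[OF G, of "{u}"] by (auto simp: star_def)
    show False
    proof (cases "z = u \<or> z = u'")
      case True
      then have "{u, u'} \<in> G" using z u(3) by (auto simp: star_def nbrs_single insert_commute)
      then show False using not_tangled_path[OF u(1), of "[u, u']"] u V by auto
    next
      case False
      then have "{u, z} \<in> G" "{z, u'} \<in> G" using z by (auto simp: star_def nbrs_single insert_commute)
      then show False using not_tangled_path[OF u(1), of "[u, z, u']"] u V False by auto
    qed
  qed
  then show ?thesis by blast
qed

lemma not_tangled_few:
  assumes V: "finite V" and G: "G \<subseteq> vertex_pairs V" and D: "D \<subseteq> V" and v: "v \<in> V - D"
  shows "card (nbrs G {v} \<inter> (\<Union>u\<in>D - tangled V G D. star G u)) \<le> 1"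
proof -
  note irr = vertex_pairs_irrefl[OF G]
  have "y1 = y2" if y: "{v, y1} \<in> G" "{v, y2} \<in> G"
    and u1: "u1 \<in> D - tangled V G D" "y1 \<in> star G u1" and u2: "u2 \<in> D - tangled V G D" "y2 \<in> star G u2"
    for y1 y2 u1 u2
  proof (rule ccontr)
    assume ne: "y1 \<noteq> y2"
    have inV: "v \<in> V" "y1 \<in> V" "y2 \<in> V" "u1 \<in> V" "u2 \<in> V"
      using y u1 u2 v D nbrs_subset[OF G, of "{v}"] by (auto simp: nbrs_single)
    have neq: "v \<noteq> y1" "v \<noteq> y2" "v \<noteq> u1" "v \<noteq> u2" using irr y v u1 u2 by auto
    have e1: "y1 = u1 \<or> y1 \<noteq> u1 \<and> {u1, y1} \<in> G" and e2: "y2 = u2 \<or> y2 \<noteq> u2 \<and> {u2, y2} \<in> G"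
      using u1 u2 by (auto simp: star_def nbrs_single)
    show False
    proof (cases "u1 = u2")
      case True
      consider "y1 = u1" "y2 \<noteq> u1" "{u1, y2} \<in> G" | "y2 = u1" "y1 \<noteq> u1" "{u1, y1} \<in> G"
        | "y1 \<noteq> u1" "y2 \<noteq> u1" "{u1, y1} \<in> G" "{u1, y2} \<in> G"
        using e1 e2 ne True by blast
      then show False
      proof cases
        case 1
        then show False using not_tangled_cycle[OF u1(1), of "[u1, v, y2]"] inV neq ne y
          by (auto simp: cycle_links_def insert_commute)
      next
        case 2
        then show False using not_tangled_cycle[OF u1(1), of "[u1, v, y1]"] inV neq ne y
          by (auto simp: cycle_links_def insert_commute)
      next
        case 3
        then show False using not_tangled_cycle[OF u1(1), of "[u1, y1, v, y2]"] inV neq ne y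
          by (auto simp: cycle_links_def insert_commute)
      qed
    next
      case False
      have "star G u1 \<inter> star G u2 = {}"
        using not_tangled_stars[OF G D u1(1)] u2 False by auto
      then have neq': "y1 \<noteq> u2" "y2 \<noteq> u1" "u1 \<noteq> u2"
        using u1 u2 by (auto simp: star_def)
      \<comment> \<open>A neighbour of \<open>v\<close> that is itself a low vertex must not be
        repeated, so the path has 3 to 5 vertices.\<close>
      define xs where "xs = (if y1 = u1 then [u1] else [u1, y1]) @ v # (if y2 = u2 then [u2] else [y2, u2])"
      have "distinct xs" "set xs \<subseteq> V" "length xs \<in> {2..5}" "hd xs = u1" "last xs \<in> D"
        using neq neq' ne inV u2 by (auto simp: xs_def)
      then have "\<not> links xs \<subseteq> G" using not_tangled_path[OF u1(1), of xs] by auto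
      then show False using e1 e2 y by (auto simp: xs_def insert_commute split: if_splits)
    qed
  qed
  then have "\<forall>y1\<in>nbrs G {v} \<inter> (\<Union>u\<in>D - tangled V G D. star G u).
      \<forall>y2\<in>nbrs G {v} \<inter> (\<Union>u\<in>D - tangled V G D. star G u). y1 = y2"
    by (simp add: nbrs_single) blast
  moreover have "finite (nbrs G {v} \<inter> (\<Union>u\<in>D - tangled V G D. star G u))"
    using finite_subset[OF nbrs_subset[OF G] V] by blast
  ultimately show ?thesis by (simp add: card_le_Suc0_iff_eq)
qed

section \<open>Expected number of low-degree and tangled vertices\<close>

lemma sum_power_fact_le_exp:
  fixes x :: real
  assumes "0 \<le> x" "finite I"
  shows "(\<Sum>m\<in>I. x ^ m / fact m) \<le> exp x"
proof -
  have "(\<Sum>m\<in>I. x ^ m / fact m) \<le> (\<Sum>m. x ^ m / fact m)"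
    using assms summable_exp[of x] by (intro sum_le_suminf) (auto simp: field_simps)
  then show ?thesis by (simp add: exp_def scaleR_conv_of_real field_simps)
qed

lemma binomial_le_fact: "real (n choose k) \<le> real n ^ k / fact k"
  using of_nat_mono[OF binomial_fact_pow[of n k], where 'a = real] by (simp add: field_simps)

lemma binomial_le_exp:
  assumes "k > 0"
  shows "real (n choose k) \<le> (exp 1 * real n / real k) ^ k"
proof -
  have "real k ^ k / fact k \<le> exp (real k)"
    using sum_power_fact_le_exp[of "real k" "{k}"] by simp
  then have *: "real k ^ k \<le> exp 1 ^ k * fact k" by (simp add: field_simps flip: exp_of_nat_mult)
  have "real (n choose k) \<le> real n ^ k / fact k" by (rule binomial_le_fact)
  also have "\<dots> \<le> real n ^ k * (exp 1 ^ k / real k ^ k)"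
    using mult_left_mono[OF *, of "real n ^ k"] assms by (simp add: field_simps)
  also have "\<dots> = (exp 1 * real n / real k) ^ k" by (simp add: power_divide power_mult_distrib)
  finally show ?thesis .
qed

lemma expect_card_eq:
  fixes p :: real
  assumes "finite B"
  shows "expect p B (\<lambda>X. of_bool (card X = i)) = (card B choose i) * p ^ i * (1 - p) ^ (card B - i)"
proof -
  have "expect p B (\<lambda>X. of_bool (card X = i))
      = (\<Sum>X\<in>Pow B. if card X = i then p ^ i * (1 - p) ^ (card B - i) else 0)"
    unfolding expect_def using assms
    by (intro sum.cong) (auto simp: card_Diff_subset finite_subset)
  also have "\<dots> = (\<Sum>X\<in>{X. X \<subseteq> B \<and> card X = i}. p ^ i * (1 - p) ^ (card B - i))"
    using assms by (subst sum.inter_filter[symmetric]) auto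
  finally show ?thesis using assms by (simp add: n_subsets mult.assoc)
qed

text \<open>Each of the \<open>k\<close> point probabilities is bounded crudely:
  \<open>(card B choose i) * p ^ i\<close> is at most \<open>(card B * p) ^ i\<close>. The resulting
  power of \<open>c\<close> is harmless, because \<open>(1 - p) ^ N\<close> will be exponentially
  small in \<open>c\<close>.\<close>

lemma expect_card_less:
  fixes p c :: real
  assumes "finite B" "0 \<le> p" "p \<le> 1" "card B * p \<le> c" "1 \<le> c" "N + k \<le> card B"
  shows "expect p B (\<lambda>X. of_bool (card X < k)) \<le> k * c ^ k * (1 - p) ^ N"
proof -
  have "of_bool (card X < k) = (\<Sum>i<k. of_bool (card X = i) :: real)" for X :: "'a set"
    by (cases "card X < k") auto
  then have "expect p B (\<lambda>X. of_bool (card X < k)) = (\<Sum>i<k. expect p B (\<lambda>X. of_bool (card X = i)))"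
    by (simp only: expect_sum)
  also have "\<dots> \<le> (\<Sum>i<k. c ^ k * (1 - p) ^ N)"
  proof (intro sum_mono)
    fix i assume i: "i \<in> {..<k}"
    have "real (card B choose i) * p ^ i \<le> real (card B) ^ i * p ^ i"
      using assms i binomial_le_pow[of i "card B"]
      by (intro mult_right_mono) (auto simp flip: of_nat_power)
    also have "\<dots> = (card B * p) ^ i" by (simp add: power_mult_distrib)
    also have "\<dots> \<le> c ^ i" using assms by (intro power_mono) auto
    also have "\<dots> \<le> c ^ k" using assms i by (intro power_increasing) auto
    finally have 1: "real (card B choose i) * p ^ i \<le> c ^ k" .
    have "(1 - p) ^ (card B - i) \<le> (1 - p) ^ N" using assms i by (intro power_decreasing) auto
    then show "expect p B (\<lambda>X. of_bool (card X = i)) \<le> c ^ k * (1 - p) ^ N"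
      using 1 assms by (simp add: expect_card_eq mult_mono)
  qed
  finally show ?thesis by simp
qed

text \<open>Degrees become counts of random pairs from a fixed set, so that disjoint sets of pairs
  give independent counts.\<close>

definition edges_at :: "'a \<Rightarrow> 'a set \<Rightarrow> 'a set set" where
  "edges_at u W = (\<lambda>w. {u, w}) ` W"

lemma inj_edges_at: "inj (\<lambda>w. {u, w})"
  by (auto simp: inj_def doubleton_eq_iff)

lemma card_edges_at [simp]: "card (edges_at u W) = card W"
  unfolding edges_at_def by (intro card_image) (auto intro: inj_on_subset[OF inj_edges_at])

lemma card_Int_edges_at: "card (E \<inter> edges_at u W) = card (nbrs E {u} \<inter> W)"
proof -
  have "E \<inter> edges_at u W = edges_at u (nbrs E {u} \<inter> W)"
    by (auto simp: edges_at_def nbrs_single)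
  then show ?thesis by simp
qed

lemma edges_at_subset: "u \<in> V \<Longrightarrow> W \<subseteq> V - {u} \<Longrightarrow> edges_at u W \<subseteq> vertex_pairs V"
  by (auto simp: edges_at_def vertex_pairs_def card_insert_if)

lemma card_nbrs_eq: "E \<subseteq> vertex_pairs V \<Longrightarrow> card (nbrs E {u}) = card (E \<inter> edges_at u (V - {u}))"
proof -
  assume E: "E \<subseteq> vertex_pairs V"
  have "nbrs E {u} \<subseteq> V - {u}" using nbrs_subset[OF E, of "{u}"] vertex_pairs_irrefl[OF E] by (auto simp: nbrs_single)
  then show ?thesis by (simp add: card_Int_edges_at Int_absorb2)
qed

lemma expect_degree_count:
  fixes p :: real
  assumes V: "finite V"
  shows "expect p (vertex_pairs V) (\<lambda>E. card {v \<in> V. card (nbrs E {v}) = i})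
    = card V * ((card V - 1 choose i) * p ^ i * (1 - p) ^ (card V - 1 - i))"
proof -
  have "expect p (vertex_pairs V) (\<lambda>E. card {v \<in> V. card (nbrs E {v}) = i})
      = expect p (vertex_pairs V) (\<lambda>E. \<Sum>v\<in>V. of_bool (card (E \<inter> edges_at v (V - {v})) = i))"
    using V by (intro expect_cong) (simp add: card_nbrs_eq Int_def)
  also have "\<dots> = (\<Sum>v\<in>V. expect p (vertex_pairs V) (\<lambda>E. of_bool (card (E \<inter> edges_at v (V - {v})) = i)))"
    by (rule expect_sum)
  also have "\<dots> = (\<Sum>v\<in>V. (card V - 1 choose i) * p ^ i * (1 - p) ^ (card V - 1 - i))"
  proof (intro sum.cong refl)
    fix v assume v: "v \<in> V"
    have "expect p (vertex_pairs V) (\<lambda>E. of_bool (card (E \<inter> edges_at v (V - {v})) = i))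
       = expect p (edges_at v (V - {v})) (\<lambda>E. of_bool (card E = i))"
      using V v by (intro expect_restrict finite_vertex_pairs edges_at_subset) auto
    then show "expect p (vertex_pairs V) (\<lambda>E. of_bool (card (E \<inter> edges_at v (V - {v})) = i))
       = (card V - 1 choose i) * p ^ i * (1 - p) ^ (card V - 1 - i)"
      using V v by (simp add: expect_card_eq edges_at_def card_edges_at[unfolded edges_at_def])
  qed
  finally show ?thesis by simp
qed

text \<open>The threshold makes a set of \<open>s\<close> other vertices, each losing at most one neighbour, span \<open>8s\<close> edges
  together with a neighbourhood of fewer than \<open>3s\<close> vertices, which is too dense.\<close>

definition low :: "'a set \<Rightarrow> 'a set set \<Rightarrow> 'a set" where
  "low V E = {v \<in> V. card (nbrs E {v}) < 17}"

text \<open>Meant for fewer than 17 edges from one vertex into all but at most 5 vertices, 5 being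
  the largest number of vertices on a path in \<open>tangled\<close>. The exponent is
  \<open>n - 5 - 17\<close>, and \<open>17 * c ^ 17\<close> bounds the contributions of the counts 0
  to 16.\<close>

definition low_bound :: "real \<Rightarrow> real \<Rightarrow> nat \<Rightarrow> real" where
  "low_bound c p n = 17 * c ^ 17 * (1 - p) ^ (n - 22)"

lemma low_bound_nonneg: "0 \<le> c \<Longrightarrow> p \<le> 1 \<Longrightarrow> 0 \<le> low_bound c p n"
  by (simp add: low_bound_def)

lemma expect_few_edges_at:
  fixes p c :: real
  assumes "finite V" "0 \<le> p" "p \<le> 1" "card V * p \<le> c" "1 \<le> c" "22 \<le> card V"
    "W \<subseteq> V" "card V \<le> card W + 5"
  shows "expect p (edges_at u W) (\<lambda>X. of_bool (card X < 17)) \<le> low_bound c p (card V)"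
proof -
  have "card W \<le> card V" using assms card_mono by blast
  then have "card W * p \<le> c" using assms by (meson mult_right_mono of_nat_mono order_trans)
  then have "expect p (edges_at u W) (\<lambda>X. of_bool (card X < 17)) \<le> real 17 * c ^ 17 * (1 - p) ^ (card V - 22)"
    using assms finite_subset[of W V]
    by (intro expect_card_less) (auto simp: edges_at_def card_edges_at[unfolded edges_at_def])
  then show ?thesis by (simp add: low_bound_def)
qed

lemma low_few_edges_at:
  assumes "finite V" "E \<subseteq> vertex_pairs V" "u \<in> low V E"
  shows "card (E \<inter> edges_at u W) < 17"
proof -
  have "card (nbrs E {u} \<inter> W) \<le> card (nbrs E {u})"
    using nbrs_subset[OF assms(2), of "{u}"] assms(1) finite_subset by (intro card_mono) auto
  then show ?thesis using assms(3) by (simp add: card_Int_edges_at low_def)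
qed

lemma expect_card_low:
  fixes p c :: real
  assumes "finite V" "0 \<le> p" "p \<le> 1" "card V * p \<le> c" "1 \<le> c" "22 \<le> card V"
  shows "expect p (vertex_pairs V) (\<lambda>E. card (low V E)) \<le> card V * low_bound c p (card V)"
proof -
  have "expect p (vertex_pairs V) (\<lambda>E. card (low V E))
    \<le> expect p (vertex_pairs V) (\<lambda>E. \<Sum>v\<in>V. of_bool (card (E \<inter> edges_at v (V - {v})) < 17))"
  proof (rule expect_mono[OF assms(2,3)])
    fix E assume "E \<subseteq> vertex_pairs V"
    then have "low V E \<subseteq> {v \<in> V. card (E \<inter> edges_at v (V - {v})) < 17}"
      using low_few_edges_at[OF assms(1)] by (auto simp: low_def)
    then have "card (low V E) \<le> card {v \<in> V. card (E \<inter> edges_at v (V - {v})) < 17}"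
      using assms(1) by (intro card_mono) auto
    then show "real (card (low V E)) \<le> (\<Sum>v\<in>V. of_bool (card (E \<inter> edges_at v (V - {v})) < 17))"
      using assms(1) by (simp add: Int_def)
  qed
  also have "\<dots> = (\<Sum>v\<in>V. expect p (vertex_pairs V) (\<lambda>E. of_bool (card (E \<inter> edges_at v (V - {v})) < 17)))"
    by (rule expect_sum)
  also have "\<dots> \<le> (\<Sum>v\<in>V. low_bound c p (card V))"
  proof (intro sum_mono)
    fix v assume v: "v \<in> V"
    have "expect p (vertex_pairs V) (\<lambda>E. of_bool (card (E \<inter> edges_at v (V - {v})) < 17))
       = expect p (edges_at v (V - {v})) (\<lambda>E. of_bool (card E < 17))"
      using assms v by (intro expect_restrict finite_vertex_pairs edges_at_subset) auto
    also have "\<dots> \<le> low_bound c p (card V)"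
      using assms v by (intro expect_few_edges_at) auto
    finally show "expect p (vertex_pairs V) (\<lambda>E. of_bool (card (E \<inter> edges_at v (V - {v})) < 17)) \<le> \<dots>" .
  qed
  finally show ?thesis by simp
qed

lemma card_links: "distinct xs \<Longrightarrow> card (links xs) = length xs - 1"
proof (induction xs rule: links.induct)
  case (1 x y xs)
  have "{x, y} \<notin> links (y # xs)" using links_subset[of "{x, y}" "y # xs"] 1 by auto
  moreover have "finite (links zs)" for zs :: "'a list" by (induction zs rule: links.induct) auto
  ultimately show ?case using 1 by simp
qed auto

lemma finite_links: "finite (links xs)"
  by (induction xs rule: links.induct) auto

lemma links_vertex_pairs: "distinct xs \<Longrightarrow> set xs \<subseteq> V \<Longrightarrow> links xs \<subseteq> vertex_pairs V"
  by (induction xs rule: links.induct) (auto simp: vertex_pairs_def)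

lemma cycle_links_props:
  assumes "distinct xs" "3 \<le> length xs" "set xs \<subseteq> V"
  shows "card (cycle_links xs) = length xs" "cycle_links xs \<subseteq> vertex_pairs V"
proof -
  obtain x y zs where xs: "xs = x # y # zs" "zs \<noteq> []"
    using assms(2) by (cases xs; cases "tl xs"; cases "tl (tl xs)") auto
  have "{last zs, x} \<notin> links xs"
    using link_nbr_cases[of "[]" x "y # zs" "last zs"] assms(1) xs by (auto simp: insert_commute)
  then have "{last xs, hd xs} \<notin> links xs" using xs by simp
  then show "card (cycle_links xs) = length xs"
    using assms by (auto simp: cycle_links_def card_links finite_links)
  have "last zs \<noteq> x" using assms(1) xs last_in_set[of zs] by auto
  then show "cycle_links xs \<subseteq> vertex_pairs V"
    using assms xs links_vertex_pairs[of xs V] last_in_set[of zs]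
    by (auto simp: cycle_links_def vertex_pairs_def)
qed

lemma expect_union_contains:
  assumes "finite A" "Q \<subseteq> A"
  shows "expect p A (\<lambda>X. expect q A (\<lambda>Y. of_bool (Q \<subseteq> X \<union> Y))) = (p + q - p * q) ^ card Q"
  using expect_contains_avoids[OF assms, of "{}" "p + q - p * q"]
  by (simp add: expect_union[OF assms(1), of p q "\<lambda>X. of_bool (Q \<subseteq> X)", symmetric])

text \<open>Lowness of an end is relaxed to having few edges into \<open>V - set xs\<close>. The
  pairs at the first vertex, the pairs at the last vertex and the links of the path are then
  disjoint, so the three events are independent.\<close>

lemma expect_low_pair_path:
  fixes p1 p2 c :: real
  assumes V: "finite V" "22 \<le> card V" and p: "0 \<le> p1" "p1 \<le> 1" "0 \<le> p2" "p2 \<le> 1"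
    and c: "card V * p1 \<le> c" "1 \<le> c"
    and xs: "distinct xs" "set xs \<subseteq> V" "length xs \<in> {2..5}"
  defines "A \<equiv> vertex_pairs V"
  shows "expect p1 A (\<lambda>X. expect p2 A (\<lambda>Y.
      of_bool (hd xs \<in> low V X \<and> last xs \<in> low V X \<and> links xs \<subseteq> X \<union> Y)))
    \<le> (p1 + p2 - p1 * p2) ^ (length xs - 1) * (low_bound c p1 (card V))\<^sup>2"
proof -
  define Q where "Q = links xs"
  define W where "W = V - set xs"
  define S1 where "S1 = edges_at (hd xs) W"
  define S2 where "S2 = edges_at (last xs) W"
  \<comment> \<open>The probability, given the first round, that the second one completes the path.
    The second round matters only here, as lowness refers to the first round alone.\<close>
  define g where "g = (\<lambda>X. expect p2 A (\<lambda>Y. of_bool (Q \<subseteq> X \<union> Y)))"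
  define few where "few = (\<lambda>X::'a set set. of_bool (card X < 17) :: real)"
  have finA: "finite A" using V by (simp add: A_def finite_vertex_pairs)
  have QA: "Q \<subseteq> A" using xs by (simp add: Q_def A_def links_vertex_pairs)
  have ne: "xs \<noteq> []" using xs by auto
  have ends: "hd xs \<in> set xs" "last xs \<in> set xs" using ne by auto
  have hl: "hd xs \<noteq> last xs"
    using xs by (cases xs) (auto split: if_splits)
  have SA: "S1 \<subseteq> A" "S2 \<subseteq> A"
    unfolding S1_def S2_def A_def W_def by (rule edges_at_subset; use ends xs in blast)+
  have S12: "S1 \<inter> S2 = {}" using hl ends by (auto simp: S1_def S2_def edges_at_def W_def doubleton_eq_iff)
  have SQ: "S1 \<inter> Q = {}" "S2 \<inter> Q = {}"
    using links_subset[of _ xs] by (auto simp: S1_def S2_def edges_at_def W_def Q_def)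
  have cW: "card V \<le> card W + 5"
    using xs V by (auto simp: W_def card_Diff_subset distinct_card)
  have "expect p1 A (\<lambda>X. expect p2 A (\<lambda>Y.
      of_bool (hd xs \<in> low V X \<and> last xs \<in> low V X \<and> Q \<subseteq> X \<union> Y)))
    \<le> expect p1 A (\<lambda>X. expect p2 A (\<lambda>Y. of_bool (Q \<subseteq> X \<union> Y) * (few (X \<inter> S1) * few (X \<inter> S2))))"
    using low_few_edges_at[OF V(1)] unfolding A_def few_def S1_def S2_def
    by (intro expect_mono p) auto
  also have "\<dots> = expect p1 A (\<lambda>X. g (X \<inter> Q) * (few ((X - Q) \<inter> S1) * few ((X - Q) \<inter> S2)))"
  proof (intro expect_cong)
    fix X assume "X \<subseteq> A"
    have 1: "(X - Q) \<inter> S1 = X \<inter> S1" "(X - Q) \<inter> S2 = X \<inter> S2" using SQ by auto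
    have 2: "Q \<subseteq> X \<union> Y \<longleftrightarrow> Q \<subseteq> X \<inter> Q \<union> Y" for Y by auto
    show "expect p2 A (\<lambda>Y. of_bool (Q \<subseteq> X \<union> Y) * (few (X \<inter> S1) * few (X \<inter> S2)))
      = g (X \<inter> Q) * (few ((X - Q) \<inter> S1) * few ((X - Q) \<inter> S2))"
      unfolding 1 g_def expect_multc using 2 by simp
  qed
  also have "\<dots> = expect p1 Q g * expect p1 (A - Q) (\<lambda>X. few (X \<inter> S1) * few (X \<inter> S2))"
    using finA QA by (rule expect_indep)
  also have "expect p1 Q g = (p1 + p2 - p1 * p2) ^ card Q"
  proof -
    have "expect p1 Q g = expect p1 A (\<lambda>X. g (X \<inter> Q))" using finA QA by (simp add: expect_restrict)
    also have "\<dots> = expect p1 A (\<lambda>X. expect p2 A (\<lambda>Y. of_bool (Q \<subseteq> X \<union> Y)))"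
    proof (intro expect_cong)
      fix X
      have "Q \<subseteq> X \<union> Y \<longleftrightarrow> Q \<subseteq> X \<inter> Q \<union> Y" for Y by auto
      then show "g (X \<inter> Q) = expect p2 A (\<lambda>Y. of_bool (Q \<subseteq> X \<union> Y))" by (simp add: g_def)
    qed
    also have "\<dots> = (p1 + p2 - p1 * p2) ^ card Q" using finA QA by (rule expect_union_contains)
    finally show ?thesis .
  qed
  also have "expect p1 (A - Q) (\<lambda>X. few (X \<inter> S1) * few (X \<inter> S2))
     = expect p1 (A - Q) (\<lambda>X. few (X \<inter> S1) * few ((X - S1) \<inter> S2))"
  proof (intro expect_cong)
    fix X
    have "(X - S1) \<inter> S2 = X \<inter> S2" using S12 by auto
    then show "few (X \<inter> S1) * few (X \<inter> S2) = few (X \<inter> S1) * few ((X - S1) \<inter> S2)" by simp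
  qed
  also have "\<dots> = expect p1 S1 few * expect p1 (A - Q - S1) (\<lambda>X. few (X \<inter> S2))"
    using finA SA SQ by (intro expect_indep) auto
  also have "expect p1 (A - Q - S1) (\<lambda>X. few (X \<inter> S2)) = expect p1 S2 few"
    using finA SA SQ S12 by (intro expect_restrict) auto
  also have "(p1 + p2 - p1 * p2) ^ card Q * (expect p1 S1 few * expect p1 S2 few)
    \<le> (p1 + p2 - p1 * p2) ^ card Q * (low_bound c p1 (card V) * low_bound c p1 (card V))"
  proof (intro mult_left_mono mult_mono)
    show "expect p1 S1 few \<le> low_bound c p1 (card V)" "expect p1 S2 few \<le> low_bound c p1 (card V)"
      unfolding S1_def S2_def few_def using V p c cW
      by (auto intro!: expect_few_edges_at simp: W_def)
    show "0 \<le> low_bound c p1 (card V)" using c p by (simp add: low_bound_nonneg)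
    show "0 \<le> expect p1 S2 few" using p by (intro expect_nonneg) (auto simp: few_def)
    have "0 \<le> p1 * (1 - p2) + p2" using p by simp
    then show "0 \<le> (p1 + p2 - p1 * p2) ^ card Q" by (simp add: algebra_simps)
  qed
  finally show ?thesis using xs by (simp add: Q_def card_links power2_eq_square)
qed

lemma finite_vertex_lists: "finite V \<Longrightarrow> finite (vertex_lists V k)"
  unfolding vertex_lists_def by (rule finite_subset[OF _ finite_lists_length_eq[of V k]]) auto

lemma card_vertex_lists: "finite V \<Longrightarrow> card (vertex_lists V k) \<le> card V ^ k"
  unfolding vertex_lists_def
  by (subst card_lists_length_eq[symmetric], simp, rule card_mono) (auto intro: finite_lists_length_eq)

lemma card_tangled_le:
  assumes "finite V"
  shows "card (tangled V G D)
    \<le> (\<Sum>k\<in>{2..5}. \<Sum>xs\<in>vertex_lists V k. of_bool (hd xs \<in> D \<and> last xs \<in> D \<and> links xs \<subseteq> G)) +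
      (\<Sum>k\<in>{3..4}. \<Sum>xs\<in>vertex_lists V k. of_bool (cycle_links xs \<subseteq> G))"
proof -
  define P where "P = (\<lambda>k. {xs \<in> vertex_lists V k. hd xs \<in> D \<and> last xs \<in> D \<and> links xs \<subseteq> G})"
  define C where "C = (\<lambda>k. {xs \<in> vertex_lists V k. cycle_links xs \<subseteq> G})"
  have fin: "finite (P k)" "finite (C k)" for k
    using finite_vertex_lists[OF assms] by (auto simp: P_def C_def)
  have "tangled V G D \<subseteq> hd ` (\<Union>k\<in>{2..5}. P k) \<union> hd ` (\<Union>k\<in>{3..4}. C k)"
    by (auto simp: tangled_def P_def C_def)
  then have "card (tangled V G D) \<le> card (hd ` (\<Union>k\<in>{2..5}. P k) \<union> hd ` (\<Union>k\<in>{3..4}. C k))"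
    using fin by (intro card_mono) auto
  also have "\<dots> \<le> card (hd ` (\<Union>k\<in>{2..5}. P k)) + card (hd ` (\<Union>k\<in>{3..4}. C k))" by (rule card_Un_le)
  also have "\<dots> \<le> card (\<Union>k\<in>{2..5}. P k) + card (\<Union>k\<in>{3..4}. C k)"
    using fin by (intro add_mono card_image_le) auto
  also have "\<dots> \<le> (\<Sum>k\<in>{2..5}. card (P k)) + (\<Sum>k\<in>{3..4}. card (C k))"
    by (intro add_mono card_UN_le) auto
  also have "\<dots> = (\<Sum>k\<in>{2..5}. \<Sum>xs\<in>vertex_lists V k. of_bool (hd xs \<in> D \<and> last xs \<in> D \<and> links xs \<subseteq> G)) +
      (\<Sum>k\<in>{3..4}. \<Sum>xs\<in>vertex_lists V k. of_bool (cycle_links xs \<subseteq> G))"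
    using finite_vertex_lists[OF assms] by (simp add: P_def C_def Int_def)
  finally show ?thesis .
qed

text \<open>A path on k vertices can be placed in at most n^k ways and has k - 1 edges, which leaves
  one factor n; the square of \<open>low_bound\<close> makes this term negligible against
  \<open>c * exp (- c) * n\<close> for large \<open>c\<close>. A cycle has as many edges as
  vertices, so its expected number is bounded independently of n, even without using lowness. The
  factors 4 and 2 count the possible values of k.\<close>

lemma expect_card_tangled:
  fixes p1 p2 c :: real
  assumes V: "finite V" "22 \<le> card V" and p: "0 \<le> p1" "p1 \<le> 1" "0 \<le> p2" "p2 \<le> 1"
    and c: "card V * p1 \<le> c" "card V * (p1 + p2 - p1 * p2) \<le> c" "1 \<le> c"
  defines "A \<equiv> vertex_pairs V"
  shows "expect p1 A (\<lambda>X. expect p2 A (\<lambda>Y. card (tangled V (X \<union> Y) (low V X))))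
    \<le> 4 * card V * c ^ 4 * (low_bound c p1 (card V))\<^sup>2 + 2 * c ^ 4"
proof -
  define n where "n = card V"
  define p where "p = p1 + p2 - p1 * p2"
  define b where "b = low_bound c p1 (card V)"
  have finA: "finite A" using V by (simp add: A_def finite_vertex_pairs)
  have "0 \<le> p1 * (1 - p2) + p2" using p by simp
  then have p0: "0 \<le> p" by (simp add: p_def algebra_simps)
  have np: "real n * p \<le> c" using c by (simp add: n_def p_def)
  have cpow: "(n * p) ^ k \<le> c ^ 4" if "k \<le> 4" for k
  proof -
    have "(n * p) ^ k \<le> c ^ k" using np p0 by (intro power_mono) auto
    also have "\<dots> \<le> c ^ 4" using c that by (intro power_increasing) auto
    finally show ?thesis .
  qed
  let ?e = "\<lambda>f. expect p1 A (\<lambda>X. expect p2 A (\<lambda>Y. f X Y))"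
  let ?P = "\<lambda>xs X Y. of_bool (hd xs \<in> low V X \<and> last xs \<in> low V X \<and> links xs \<subseteq> X \<union> Y) :: real"
  let ?C = "\<lambda>xs X Y. of_bool (cycle_links xs \<subseteq> X \<union> Y) :: real"
  have "?e (\<lambda>X Y. card (tangled V (X \<union> Y) (low V X)))
     \<le> ?e (\<lambda>X Y. (\<Sum>k\<in>{2..5}. \<Sum>xs\<in>vertex_lists V k. ?P xs X Y) + (\<Sum>k\<in>{3..4}. \<Sum>xs\<in>vertex_lists V k. ?C xs X Y))"
    using of_nat_mono[OF card_tangled_le[OF V(1)], where 'a = real]
    by (intro expect_mono p) (simp add: of_nat_sum)
  also have "\<dots> = (\<Sum>k\<in>{2..5}. \<Sum>xs\<in>vertex_lists V k. ?e (?P xs)) + (\<Sum>k\<in>{3..4}. \<Sum>xs\<in>vertex_lists V k. ?e (?C xs))"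
    by (simp add: expect_add expect_sum)
  also have "\<dots> \<le> (\<Sum>k\<in>{2..5::nat}. n * c ^ 4 * b\<^sup>2) + (\<Sum>k\<in>{3..4::nat}. c ^ 4)"
  proof (intro add_mono sum_mono)
    fix k :: nat assume k: "k \<in> {2..5}"
    have "(\<Sum>xs\<in>vertex_lists V k. ?e (?P xs)) \<le> (\<Sum>xs\<in>vertex_lists V k. p ^ (k - 1) * b\<^sup>2)"
      using V p c k by (intro sum_mono)
        (auto simp: vertex_lists_def p_def b_def A_def intro!: expect_low_pair_path[THEN order_trans])
    also have "\<dots> = card (vertex_lists V k) * (p ^ (k - 1) * b\<^sup>2)" by simp
    also have "\<dots> \<le> n ^ k * (p ^ (k - 1) * b\<^sup>2)"
      using card_vertex_lists[OF V(1), of k] p0 unfolding n_def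
      by (intro mult_right_mono) (auto simp flip: of_nat_power)
    also have "\<dots> = n * (n * p) ^ (k - 1) * b\<^sup>2"
      using k by (cases k) (auto simp: power_mult_distrib)
    also have "\<dots> \<le> n * c ^ 4 * b\<^sup>2"
      using cpow[of "k - 1"] k by (intro mult_right_mono mult_left_mono) auto
    finally show "(\<Sum>xs\<in>vertex_lists V k. ?e (?P xs)) \<le> n * c ^ 4 * b\<^sup>2" .
  next
    fix k :: nat assume k: "k \<in> {3..4}"
    have "(\<Sum>xs\<in>vertex_lists V k. ?e (?C xs)) = (\<Sum>xs\<in>vertex_lists V k. p ^ k)"
    proof (intro sum.cong refl)
      fix xs assume "xs \<in> vertex_lists V k"
      then have "distinct xs" "3 \<le> length xs" "set xs \<subseteq> V" "length xs = k"
        using k by (auto simp: vertex_lists_def)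
      then show "?e (?C xs) = p ^ k"
        using cycle_links_props[of xs V] finA by (simp add: expect_union_contains A_def p_def)
    qed
    also have "\<dots> = card (vertex_lists V k) * p ^ k" by simp
    also have "\<dots> \<le> n ^ k * p ^ k"
      using card_vertex_lists[OF V(1), of k] p0 unfolding n_def
      by (intro mult_right_mono) (auto simp flip: of_nat_power)
    also have "\<dots> \<le> c ^ 4" using cpow[of k] k by (simp add: power_mult_distrib)
    finally show "(\<Sum>xs\<in>vertex_lists V k. ?e (?C xs)) \<le> c ^ 4" .
  qed
  finally show ?thesis by (simp add: n_def b_def)
qed

section \<open>Union bounds\<close>

lemma card_vertex_pairs: "finite V \<Longrightarrow> card (vertex_pairs V) = card V choose 2"
  unfolding vertex_pairs_def by (rule n_subsets)

lemma of_bool_le_sum: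
  assumes "finite I" "P \<Longrightarrow> \<exists>i\<in>I. Q i"
  shows "(of_bool P :: real) \<le> (\<Sum>i\<in>I. of_bool (Q i))"
proof (cases P)
  case True
  then obtain i where "i \<in> I" "Q i" using assms by blast
  then have "(1::real) \<le> (\<Sum>i\<in>I. of_bool (Q i))"
    using member_le_sum[of i I "\<lambda>i. of_bool (Q i) :: real"] assms(1) by simp
  then show ?thesis by simp
qed (simp add: sum_nonneg)

lemma expect_exists_le:
  assumes "0 \<le> p" "p \<le> 1" "finite I" "\<And>X. X \<subseteq> A \<Longrightarrow> P X \<Longrightarrow> \<exists>i\<in>I. Q i X"
  shows "expect p A (\<lambda>X. of_bool (P X)) \<le> (\<Sum>i\<in>I. expect p A (\<lambda>X. of_bool (Q i X)))"
  unfolding expect_sum[symmetric] using assms by (intro expect_mono of_bool_le_sum) auto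

lemma expect_dense:
  fixes p :: real
  assumes V: "finite V" and p: "0 \<le> p" "p \<le> 1"
  shows "expect p (vertex_pairs V) (\<lambda>E. of_bool (\<exists>s\<in>{x<..y}. \<exists>T. T \<subseteq> V \<and> card T = 4 * s \<and> 8 * s \<le> card {e \<in> E. e \<subseteq> T}))
    \<le> (\<Sum>s\<in>{x<..y}. real (card V choose (4 * s)) * real ((4 * s choose 2) choose (8 * s)) * p ^ (8 * s))"
proof -
  define I where "I = (\<lambda>s. Sigma {T. T \<subseteq> V \<and> card T = 4 * s} (\<lambda>T. {F. F \<subseteq> vertex_pairs T \<and> card F = 8 * s}))"
  have finT: "finite T" if "T \<subseteq> V" for T using that V finite_subset by auto
  have fin: "finite (I s)" for s
    unfolding I_def using V finT by (intro finite_SigmaI) (auto simp: finite_vertex_pairs)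
  have cI: "card (I s) = (card V choose (4 * s)) * ((4 * s choose 2) choose (8 * s))" for s
    unfolding I_def using V finT
    by (subst card_SigmaI) (auto simp: n_subsets finite_vertex_pairs card_vertex_pairs)
  have "expect p (vertex_pairs V) (\<lambda>E. of_bool (\<exists>s\<in>{x<..y}. \<exists>T. T \<subseteq> V \<and> card T = 4 * s \<and> 8 * s \<le> card {e \<in> E. e \<subseteq> T}))
    \<le> (\<Sum>s\<in>{x<..y}. expect p (vertex_pairs V) (\<lambda>E. of_bool (\<exists>T. T \<subseteq> V \<and> card T = 4 * s \<and> 8 * s \<le> card {e \<in> E. e \<subseteq> T})))"
    using p by (intro expect_exists_le) auto
  also have "\<dots> \<le> (\<Sum>s\<in>{x<..y}. \<Sum>i\<in>I s. expect p (vertex_pairs V) (\<lambda>E. of_bool (snd i \<subseteq> E \<and> E \<inter> {} = {})))"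
  proof (intro sum_mono expect_exists_le p fin)
    fix s E assume E: "E \<subseteq> vertex_pairs V"
      and "\<exists>T. T \<subseteq> V \<and> card T = 4 * s \<and> 8 * s \<le> card {e \<in> E. e \<subseteq> T}"
    then obtain T where T: "T \<subseteq> V" "card T = 4 * s" "8 * s \<le> card {e \<in> E. e \<subseteq> T}" by blast
    obtain F where F: "F \<subseteq> {e \<in> E. e \<subseteq> T}" "card F = 8 * s"
      using T(3) by (rule obtain_subset_with_card_n)
    then have "F \<subseteq> E" by auto
    moreover have "F \<subseteq> vertex_pairs T" using F(1) E by (auto simp: vertex_pairs_def)
    then have "(T, F) \<in> I s" using T F(2) by (simp add: I_def)
    ultimately show "\<exists>i\<in>I s. snd i \<subseteq> E \<and> E \<inter> {} = {}" by (intro bexI[of _ "(T, F)"]) auto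
  qed
  also have "\<dots> = (\<Sum>s\<in>{x<..y}. \<Sum>i\<in>I s. p ^ (8 * s))"
  proof (intro sum.cong HOL.refl)
    fix s i assume "i \<in> I s"
    then have "fst i \<subseteq> V" "snd i \<subseteq> vertex_pairs (fst i)" "card (snd i) = 8 * s"
      by (auto simp: I_def)
    moreover from this have "snd i \<subseteq> vertex_pairs V" unfolding vertex_pairs_def by blast
    ultimately show "expect p (vertex_pairs V) (\<lambda>E. of_bool (snd i \<subseteq> E \<and> E \<inter> {} = {})) = p ^ (8 * s)"
      using expect_contains_avoids[OF finite_vertex_pairs[OF V], of "snd i" "{}" p] by simp
  qed
  finally show ?thesis by (simp add: cI)
qed

text \<open>A small external neighbourhood is enlarged to a set \<open>T\<close> of exactly
  \<open>2 * s\<close> vertices; then none of the pairs between \<open>S\<close> and the at least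
  \<open>card V - 3 * s\<close> vertices outside \<open>S\<close> and \<open>T\<close> is an
  edge.\<close>

lemma expect_nonexpanding:
  fixes p :: real
  assumes V: "finite V" and p: "0 \<le> p" "p \<le> 1" and a: "3 * a \<le> card V"
  shows "expect p (vertex_pairs V) (\<lambda>E. of_bool (\<exists>S. S \<subseteq> V \<and> y < card S \<and> card S \<le> a \<and> card (nbrs E S - S) < 2 * card S))
    \<le> (\<Sum>s\<in>{y<..a}. real (card V choose s) * real (card V choose (2 * s)) * (1 - p) ^ (s * (card V - 3 * s)))"
proof -
  define n where "n = card V"
  define I where "I = (\<lambda>s. {S. S \<subseteq> V \<and> card S = s} \<times> {T. T \<subseteq> V \<and> card T = 2 * s})"
  define C where "C = (\<lambda>(S, T). \<Union>u\<in>S. edges_at u (V - S - T))"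
  have fin: "finite (I s)" for s using V by (simp add: I_def)
  have cI: "card (I s) = (n choose s) * (n choose (2 * s))" for s
    using V by (simp add: I_def n_subsets n_def card_cartesian_product)
  have "expect p (vertex_pairs V) (\<lambda>E. of_bool (\<exists>S. S \<subseteq> V \<and> y < card S \<and> card S \<le> a \<and> card (nbrs E S - S) < 2 * card S))
    \<le> (\<Sum>s\<in>{y<..a}. expect p (vertex_pairs V) (\<lambda>E. of_bool (\<exists>S. S \<subseteq> V \<and> card S = s \<and> card (nbrs E S - S) < 2 * s)))"
    using p by (intro expect_exists_le) (auto simp: Bex_def)
  also have "\<dots> \<le> (\<Sum>s\<in>{y<..a}. \<Sum>i\<in>I s. expect p (vertex_pairs V) (\<lambda>E. of_bool ({} \<subseteq> E \<and> E \<inter> C i = {})))"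
  proof (intro sum_mono expect_exists_le p fin)
    fix s E assume s: "s \<in> {y<..a}" and E: "E \<subseteq> vertex_pairs V"
      and "\<exists>S. S \<subseteq> V \<and> card S = s \<and> card (nbrs E S - S) < 2 * s"
    then obtain S where S: "S \<subseteq> V" "card S = s" "card (nbrs E S - S) < 2 * s" by blast
    have "nbrs E S - S \<subseteq> V" using nbrs_subset[OF E, of S] by auto
    then obtain T where T: "nbrs E S - S \<subseteq> T" "T \<subseteq> V" "card T = 2 * s"
      using exists_subset_between[of "nbrs E S - S" "2 * s" V] S V s a by auto
    have "E \<inter> C (S, T) = {}"
      using T by (auto simp: C_def edges_at_def nbrs_def)
    then show "\<exists>i\<in>I s. {} \<subseteq> E \<and> E \<inter> C i = {}"
      using S T by (intro bexI[of _ "(S, T)"]) (auto simp: I_def)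
  qed
  also have "\<dots> \<le> (\<Sum>s\<in>{y<..a}. \<Sum>i\<in>I s. (1 - p) ^ (s * (n - 3 * s)))"
  proof (intro sum_mono)
    fix s i assume i: "i \<in> I s"
    then obtain S T where ST: "i = (S, T)" "S \<subseteq> V" "T \<subseteq> V" "card S = s" "card T = 2 * s"
      by (auto simp: I_def)
    have finS: "finite S" "finite T" using ST V finite_subset by auto
    have "card (C i) = (\<Sum>u\<in>S. card (edges_at u (V - S - T)))"
      unfolding C_def ST(1) prod.case
    proof (rule card_UN_disjoint[OF finS(1)])
      show "\<forall>u\<in>S. finite (edges_at u (V - S - T))" using V by (auto simp: edges_at_def)
      show "\<forall>u\<in>S. \<forall>v\<in>S. u \<noteq> v \<longrightarrow> edges_at u (V - S - T) \<inter> edges_at v (V - S - T) = {}"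
        by (auto simp: edges_at_def doubleton_eq_iff)
    qed
    also have "\<dots> = s * card (V - S - T)" using ST by simp
    finally have cC: "card (C i) = s * card (V - S - T)" .
    have "n - 3 * s \<le> card (V - (S \<union> T))"
      using diff_card_le_card_Diff[of "S \<union> T" V] card_Un_le[of S T] finS ST by (simp add: n_def)
    then have "s * (n - 3 * s) \<le> card (C i)" by (simp add: cC Diff_eq Int_assoc mult_le_mono2)
    then have "(1 - p) ^ card (C i) \<le> (1 - p) ^ (s * (n - 3 * s))"
      using p by (intro power_decreasing) auto
    moreover have "C i \<subseteq> vertex_pairs V"
      unfolding C_def ST(1) prod.case using ST(2) by (intro UN_least edges_at_subset) auto
    ultimately show "expect p (vertex_pairs V) (\<lambda>E. of_bool ({} \<subseteq> E \<and> E \<inter> C i = {})) \<le> (1 - p) ^ (s * (n - 3 * s))"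
      using expect_contains_avoids[OF finite_vertex_pairs[OF V], of "{}" "C i" p] by simp
  qed
  finally show ?thesis by (simp add: cI n_def)
qed

text \<open>Union bound over the edges of \<open>Y\<close> touching \<open>D\<close> and over the fresh edges \<open>F\<close> used by an optimal
  ordering: the remaining fresh edges would all have to miss the many boosters of \<open>X \<union> F\<close>.\<close>

lemma expect_no_booster:
  fixes p :: real
  assumes V: "finite V" and p: "0 \<le> p" "p \<le> 1" and D: "D \<subseteq> V" and N: "2 * N \<le> (a - card D)\<^sup>2"
  defines "A \<equiv> vertex_pairs V"
  shows "expect p A (\<lambda>Y. of_bool (
      (\<forall>S. S \<subseteq> V \<longrightarrow> card S \<le> a \<longrightarrow>
         2 * card S \<le> card (nbrs (X \<union> {e \<in> Y. e \<inter> D \<noteq> {}}) S \<inter> V - S) + d) \<and>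
      d + 3 < 2 * gap_number V (X \<union> Y)))
    \<le> (\<Sum>m\<le>card V. real (card A choose m) * p ^ m) * (1 - p) ^ N"
proof -
  define AD where "AD = {e \<in> A. e \<inter> D \<noteq> {}}"
  define FS where "FS = {F. F \<subseteq> A - AD \<and> card F \<le> card V}"
  define C where "C = (\<lambda>(Y', F). {e \<in> boosters V (X \<union> Y' \<union> F). e \<inter> D = {}})"
  define I where "I = {i \<in> Pow AD \<times> FS. N \<le> card (C i)}"
  have finA: "finite A" using V by (simp add: A_def finite_vertex_pairs)
  have finAD: "finite AD" "AD \<subseteq> A" using finA by (auto simp: AD_def)
  have finFS: "finite FS" using finA by (simp add: FS_def)
  have finD: "finite D" using D V finite_subset by auto
  have finI: "finite I" using finAD finFS by (simp add: I_def)
  have CA: "C i \<subseteq> A" "C i \<inter> AD = {}" for i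
    by (auto simp: C_def AD_def A_def boosters_def split: prod.splits)
  have CF: "C (Y', F) \<inter> F = {}" for Y' F by (auto simp: C_def boosters_def insert_absorb)
  have "expect p A (\<lambda>Y. of_bool (
      (\<forall>S. S \<subseteq> V \<longrightarrow> card S \<le> a \<longrightarrow>
         2 * card S \<le> card (nbrs (X \<union> {e \<in> Y. e \<inter> D \<noteq> {}}) S \<inter> V - S) + d) \<and>
      d + 3 < 2 * gap_number V (X \<union> Y)))
    \<le> (\<Sum>i\<in>I. expect p A (\<lambda>Y. of_bool (fst i \<union> snd i \<subseteq> Y \<and> Y \<inter> (AD - fst i \<union> C i) = {})))"
  proof (intro expect_exists_le p finI, elim conjE)
    fix Y assume Y: "Y \<subseteq> A"
      and ex: "\<forall>S. S \<subseteq> V \<longrightarrow> card S \<le> a \<longrightarrow>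
         2 * card S \<le> card (nbrs (X \<union> {e \<in> Y. e \<inter> D \<noteq> {}}) S \<inter> V - S) + d"
      and big: "d + 3 < 2 * gap_number V (X \<union> Y)"
    define Y' where "Y' = {e \<in> Y. e \<inter> D \<noteq> {}}"
    have XY: "X \<union> Y' \<union> (Y - Y') = X \<union> Y" by (auto simp: Y'_def)
    obtain F where F: "F \<subseteq> Y - Y'" "card F \<le> card V" "gap_number V (X \<union> Y' \<union> F) = gap_number V (X \<union> Y)"
      using gap_number_links[OF V, of "Y - Y'" "X \<union> Y'"] XY by metis
    have "(a - card D)\<^sup>2 \<le> 2 * card {e \<in> boosters V (X \<union> Y' \<union> F). e \<inter> D = {}}"
    proof (rule card_boosters[OF V _ _ finD])
      fix S assume S: "S \<subseteq> V" "card S \<le> a"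
      have "card (nbrs (X \<union> Y') S \<inter> V - S) \<le> card (nbrs (X \<union> Y' \<union> F) S \<inter> V - S)"
        using V nbrs_mono[of "X \<union> Y'" "X \<union> Y' \<union> F" S S] by (intro card_mono) auto
      then show "2 * card S \<le> card (nbrs (X \<union> Y' \<union> F) S \<inter> V - S) + d"
        using ex S unfolding Y'_def by (meson add_le_mono1 order_trans)
    qed (use F big in simp)
    then have "N \<le> card (C (Y', F))" using N by (simp add: C_def)
    moreover have "Y' \<in> Pow AD" using Y by (auto simp: Y'_def AD_def)
    moreover have "F \<in> FS" using F Y by (auto simp: FS_def AD_def Y'_def)
    moreover have "Y \<inter> (AD - Y') = {}" by (auto simp: AD_def Y'_def)
    \<comment> \<open>Adding an edge of \<open>Y\<close> stays inside \<open>X \<union> Y\<close>,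
      whose gap number \<open>F\<close> already attains, so such an edge cannot be a
      booster.\<close>
    moreover have "e \<notin> Y" if "e \<in> C (Y', F)" for e
    proof
      assume "e \<in> Y"
      then have "gap_number V (X \<union> Y) \<le> gap_number V (insert e (X \<union> Y' \<union> F))"
        using F(1) V by (intro gap_number_mono) (auto simp: Y'_def)
      then show False using that F(3) by (auto simp: C_def boosters_def)
    qed
    moreover have "Y' \<union> F \<subseteq> Y" using F(1) by (auto simp: Y'_def)
    ultimately show "\<exists>i\<in>I. fst i \<union> snd i \<subseteq> Y \<and> Y \<inter> (AD - fst i \<union> C i) = {}"
      by (intro bexI[of _ "(Y', F)"]) (auto simp: I_def)
  qed
  also have "\<dots> \<le> (\<Sum>i\<in>I. p ^ card (fst i) * (1 - p) ^ card (AD - fst i) * (p ^ card (snd i) * (1 - p) ^ N))"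
  proof (intro sum_mono)
    fix i assume i: "i \<in> I"
    obtain Y' F where YF: "i = (Y', F)" by (cases i)
    have sub: "Y' \<subseteq> AD" "F \<subseteq> A - AD" "N \<le> card (C i)" using i by (auto simp: YF I_def FS_def)
    have finYF: "finite Y'" "finite F" "finite (C i)"
      using sub CA[of i] finA finAD by (auto intro: finite_subset)
    have "expect p A (\<lambda>Y. of_bool (Y' \<union> F \<subseteq> Y \<and> Y \<inter> (AD - Y' \<union> C i) = {}))
       = p ^ card (Y' \<union> F) * (1 - p) ^ card (AD - Y' \<union> C i)"
      using sub CA[of i] CF[of Y' F] finAD unfolding YF
      by (intro expect_contains_avoids[OF finA]) blast+
    also have "card (Y' \<union> F) = card Y' + card F"
      using finYF sub by (intro card_Un_disjoint) auto
    also have "card (AD - Y' \<union> C i) = card (AD - Y') + card (C i)"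
      using finYF finAD CA[of i] by (intro card_Un_disjoint) auto
    also have "p ^ (card Y' + card F) * (1 - p) ^ (card (AD - Y') + card (C i))
       = p ^ card Y' * (1 - p) ^ card (AD - Y') * (p ^ card F * (1 - p) ^ card (C i))"
      by (simp add: power_add)
    also have "\<dots> \<le> p ^ card Y' * (1 - p) ^ card (AD - Y') * (p ^ card F * (1 - p) ^ N)"
      using p sub(3) by (intro mult_left_mono power_decreasing) auto
    finally show "expect p A (\<lambda>Y. of_bool (fst i \<union> snd i \<subseteq> Y \<and> Y \<inter> (AD - fst i \<union> C i) = {}))
       \<le> p ^ card (fst i) * (1 - p) ^ card (AD - fst i) * (p ^ card (snd i) * (1 - p) ^ N)"
      by (simp add: YF)
  qed
  also have "\<dots> \<le> (\<Sum>i\<in>Pow AD \<times> FS. p ^ card (fst i) * (1 - p) ^ card (AD - fst i) * (p ^ card (snd i) * (1 - p) ^ N))"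
    using finAD finFS p by (intro sum_mono2) (auto simp: I_def)
  also have "\<dots> = (\<Sum>Y'\<in>Pow AD. p ^ card Y' * (1 - p) ^ card (AD - Y')) * (\<Sum>F\<in>FS. p ^ card F * (1 - p) ^ N)"
    by (simp add: sum_product sum.cartesian_product case_prod_unfold)
  \<comment> \<open>The outcomes on the pairs touching \<open>D\<close> have total probability 1, so
    revealing these pairs costs nothing, however many there are.\<close>
  also have "(\<Sum>Y'\<in>Pow AD. p ^ card Y' * (1 - p) ^ card (AD - Y')) = 1"
    using expect_const[OF finAD(1), of p 1] by (simp add: expect_def)
  also have "(\<Sum>F\<in>FS. p ^ card F * (1 - p) ^ N) \<le> (\<Sum>m\<le>card V. real (card A choose m) * p ^ m) * (1 - p) ^ N"
  proof -
    have "(\<Sum>F\<in>FS. p ^ card F) \<le> (\<Sum>F\<in>(\<Union>m\<le>card V. {F. F \<subseteq> A \<and> card F = m}). p ^ card F)"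
      using finA p by (intro sum_mono2) (auto simp: FS_def)
    also have "\<dots> = (\<Sum>m\<le>card V. \<Sum>F\<in>{F. F \<subseteq> A \<and> card F = m}. p ^ card F)"
      using finA by (intro sum.UNION_disjoint) auto
    also have "\<dots> = (\<Sum>m\<le>card V. real (card A choose m) * p ^ m)"
      using finA by (intro sum.cong HOL.refl) (simp add: n_subsets)
    finally show ?thesis using p by (simp add: mult_right_mono flip: sum_distrib_right)
  qed
  finally show ?thesis by simp
qed

text \<open>Each term is at most \<open>(n * y) ^ m / fact m\<close>; pulling out
  \<open>y ^ n\<close> leaves a partial sum of the exponential series at n.\<close>

lemma sum_binomial_power_le:
  fixes p y :: real
  assumes "0 \<le> p" "1 \<le> y" "real M * p \<le> real n * y"
  shows "(\<Sum>m\<le>n. real (M choose m) * p ^ m) \<le> (y * exp 1) ^ n"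
proof -
  have "(\<Sum>m\<le>n. real (M choose m) * p ^ m) \<le> (\<Sum>m\<le>n. y ^ n * (real n ^ m / fact m))"
  proof (intro sum_mono)
    fix m assume m: "m \<in> {..n}"
    have "real (M choose m) * p ^ m \<le> real M ^ m / fact m * p ^ m"
      using assms by (intro mult_right_mono binomial_le_fact) auto
    also have "\<dots> = (real M * p) ^ m / fact m" by (simp add: power_mult_distrib)
    also have "\<dots> \<le> (real n * y) ^ m / fact m"
      using assms by (intro divide_right_mono power_mono) auto
    also have "\<dots> = y ^ m * (real n ^ m / fact m)" by (simp add: power_mult_distrib)
    also have "\<dots> \<le> y ^ n * (real n ^ m / fact m)"
      using assms m by (intro mult_right_mono power_increasing) auto
    finally show "real (M choose m) * p ^ m \<le> \<dots>" .
  qed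
  also have "\<dots> = y ^ n * (\<Sum>m\<le>n. real n ^ m / fact m)" by (simp add: sum_distrib_left)
  also have "\<dots> \<le> y ^ n * exp (real n)"
    using assms by (intro mult_left_mono sum_power_fact_le_exp) auto
  also have "\<dots> = (y * exp 1) ^ n" by (simp add: power_mult_distrib flip: exp_of_nat_mult)
  finally show ?thesis .
qed

lemma one_minus_power_le_exp: "p \<le> 1 \<Longrightarrow> (1 - p) ^ m \<le> exp (- (real m * p))"
proof -
  assume "p \<le> 1"
  then have "(1 - p) ^ m \<le> exp (- p) ^ m"
    using exp_ge_add_one_self[of "- p"] by (intro power_mono) auto
  then show ?thesis by (simp flip: exp_of_nat_mult)
qed

lemma nbrs_touching:
  assumes "v \<in> D"
  shows "nbrs (X \<union> {e \<in> Y. e \<inter> D \<noteq> {}}) {v} = nbrs (X \<union> Y) {v}"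
  using assms by (auto simp: nbrs_single)

text \<open>An instance of \<open>expansion\<close> with \<open>X\<close> as the sparse dense-free
  graph. Lowness is decided by the first round, but all edges of \<open>X \<union> Y\<close> at
  \<open>D\<close> are present, so the deficits at \<open>D\<close> are governed by degrees in the
  whole graph. Tangledness refers to \<open>X \<union> Y\<close>, whose stars contain those of the
  smaller graph.\<close>

lemma large_gap_number_cases:
  fixes V :: "'a set"
  defines "A \<equiv> vertex_pairs V"
  assumes V: "finite V" and XY: "X \<subseteq> A" "Y \<subseteq> A" and y: "4 * y \<le> card V"
  defines "D \<equiv> low V X"
  assumes gap: "d + 3 < 2 * gap_number V (X \<union> Y)"
    and few: "card {v \<in> V. card (nbrs (X \<union> Y) {v}) = 1} + 2 * card {v \<in> V. card (nbrs (X \<union> Y) {v}) = 0}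
      + 3 * card (tangled V (X \<union> Y) D) + 3 * x \<le> d"
    and sparse: "\<not> (\<exists>s\<in>{x<..y}. \<exists>T. T \<subseteq> V \<and> card T = 4 * s \<and> 8 * s \<le> card {e \<in> X. e \<subseteq> T})"
    and large: "\<not> (\<exists>S. S \<subseteq> V \<and> y < card S \<and> card S \<le> a \<and> card (nbrs X S - S) < 2 * card S)"
    and S: "S \<subseteq> V" "card S \<le> a"
  shows "2 * card S \<le> card (nbrs (X \<union> {e \<in> Y. e \<inter> D \<noteq> {}}) S \<inter> V - S) + d"
proof -
  define G where "G = X \<union> Y"
  define H where "H = X \<union> {e \<in> Y. e \<inter> D \<noteq> {}}"
  define B where "B = tangled V G D"
  have G: "G \<subseteq> vertex_pairs V" "H \<subseteq> G" "X \<subseteq> H" using XY by (auto simp: G_def H_def A_def)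
  have DV: "D \<subseteq> V" "B \<subseteq> D" by (auto simp: D_def low_def B_def tangled_def)
  have finD: "finite D" using DV V finite_subset by auto
  have finN: "finite (nbrs G {v})" for v using nbrs_subset[OF G(1)] V finite_subset by blast
  have stars: "star H u \<subseteq> star G u" for u using nbrs_mono[OF G(2)] by (auto simp: star_def)
  have nH: "nbrs H {v} = nbrs G {v}" if "v \<in> D" for v
    unfolding H_def G_def using that by (rule nbrs_touching)
  have "2 * card S \<le> card (nbrs H S \<inter> V - S) + d"
  proof (rule expansion[OF V G(3) _ DV, where x = x and y = y and a = a])
    show "H \<subseteq> vertex_pairs V" using G by auto
    show "17 \<le> card (nbrs X {v})" if "v \<in> V - D" for v
      using that by (auto simp: D_def low_def)
    show "star H u \<inter> star H u' = {}" if "u \<in> D - B" "u' \<in> D" "u \<noteq> u'" for u u'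
      using not_tangled_stars[OF G(1) DV(1), of u u'] that stars[of u] stars[of u'] by (auto simp: B_def)
    show "card (nbrs X {v} \<inter> (\<Union>u\<in>D - B. star H u)) \<le> 1" if "v \<in> V - D" for v
    proof -
      have "card (nbrs X {v} \<inter> (\<Union>u\<in>D - B. star H u)) \<le> card (nbrs G {v} \<inter> (\<Union>u\<in>D - B. star G u))"
      proof (rule card_mono)
        have "nbrs X {v} \<subseteq> nbrs G {v}" using G by (intro nbrs_mono) auto
        then show "nbrs X {v} \<inter> (\<Union>u\<in>D - B. star H u) \<subseteq> nbrs G {v} \<inter> (\<Union>u\<in>D - B. star G u)"
          using stars by blast
      qed (simp add: finN)
      also have "\<dots> \<le> 1" using not_tangled_few[OF V G(1) DV(1) that] by (simp add: B_def)
      finally show ?thesis .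
    qed
    show "card {e \<in> X. e \<subseteq> T} < 8 * s" if "T \<subseteq> V" "card T = 4 * s" "x < s" "s \<le> y" for T s
      using sparse that by force
    show "2 * card S \<le> card (nbrs X S - S)" if "S \<subseteq> V" "y < card S" "card S \<le> a" for S
      using large that by force
    have "card {v \<in> D - B. card (nbrs H {v}) = 1} \<le> card {v \<in> V. card (nbrs G {v}) = 1}"
      using V DV nH by (intro card_mono) auto
    moreover have "card {v \<in> D - B. nbrs H {v} = {}} \<le> card {v \<in> V. card (nbrs G {v}) = 0}"
      using V DV nH by (intro card_mono) auto
    ultimately show "card {v \<in> D - B. card (nbrs H {v}) = 1} + 2 * card {v \<in> D - B. nbrs H {v} = {}}
        + 3 * card B + 3 * x \<le> d"
      using few unfolding B_def G_def by linarith
  qed (use S y in auto)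
  then show ?thesis by (simp add: H_def)
qed

text \<open>One summand for each possible reason: the deficit is too big (Markov), more than
  \<open>a / 2\<close> vertices are low (Markov), the first round has a dense small set, it has a
  non-expanding medium set, or the second round misses all boosters. The bound on low vertices
  ensures that enough boosters avoid them.\<close>

lemma expect_gap_number_large:
  fixes p1 p2 c t :: real
  assumes V: "finite V" "22 \<le> card V" and p: "0 \<le> p1" "p1 \<le> 1" "0 \<le> p2" "p2 \<le> 1"
  defines "p \<equiv> p1 + p2 - p1 * p2" and "n \<equiv> card V" and "A \<equiv> vertex_pairs V"
  assumes c: "n * p1 \<le> c" "n * p \<le> c" "1 \<le> c" and y: "4 * y \<le> n"
  defines "a \<equiv> n div 6"
  assumes N: "2 * N \<le> (a - a div 2)\<^sup>2" and t: "0 < t" "t + 3 * real x \<le> d + 1"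
  shows "expect p A (\<lambda>E. of_bool (d + 3 < 2 * gap_number V E)) \<le>
      (n * (real (n - 1) * p * (1 - p) ^ (n - 2)) + 2 * (n * (1 - p) ^ (n - 1))
        + 3 * (4 * real n * c ^ 4 * (low_bound c p1 n)\<^sup>2 + 2 * c ^ 4)) / t
    + 2 * (n * low_bound c p1 n) / a
    + (\<Sum>s\<in>{x<..y}. real (n choose (4 * s)) * real ((4 * s choose 2) choose (8 * s)) * p1 ^ (8 * s))
    + (\<Sum>s\<in>{y<..a}. real (n choose s) * real (n choose (2 * s)) * (1 - p1) ^ (s * (n - 3 * s)))
    + (\<Sum>m\<le>n. real (card A choose m) * p2 ^ m) * (1 - p2) ^ N"
proof -
  have finA: "finite A" using V by (simp add: A_def finite_vertex_pairs)
  define f where "f = (\<lambda>X Y. real (card {v \<in> V. card (nbrs (X \<union> Y) {v}) = 1})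
    + 2 * real (card {v \<in> V. card (nbrs (X \<union> Y) {v}) = 0}) + 3 * real (card (tangled V (X \<union> Y) (low V X))))"
  define dense where "dense = (\<lambda>X. \<exists>s\<in>{x<..y}. \<exists>T. T \<subseteq> V \<and> card T = 4 * s \<and> 8 * s \<le> card {e \<in> X. e \<subseteq> T})"
  define thin where "thin = (\<lambda>X. \<exists>S. S \<subseteq> V \<and> y < card S \<and> card S \<le> a \<and> card (nbrs X S - S) < 2 * card S)"
  define stuck where "stuck = (\<lambda>X Y. (\<forall>S. S \<subseteq> V \<longrightarrow> card S \<le> a \<longrightarrow>
         2 * card S \<le> card (nbrs (X \<union> {e \<in> Y. e \<inter> low V X \<noteq> {}}) S \<inter> V - S) + d) \<and>
      d + 3 < 2 * gap_number V (X \<union> Y))"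
  let ?e1 = "expect p1 A" and ?e2 = "expect p2 A"
  have a: "a > 0" using V by (simp add: a_def n_def)
  have "expect p A (\<lambda>E. of_bool (d + 3 < 2 * gap_number V E))
      = ?e1 (\<lambda>X. ?e2 (\<lambda>Y. of_bool (d + 3 < 2 * gap_number V (X \<union> Y))))"
    unfolding p_def using finA by (rule expect_union)
  also have "\<dots> \<le> ?e1 (\<lambda>X. ?e2 (\<lambda>Y. f X Y / t + 2 * card (low V X) / a + of_bool (dense X) + of_bool (thin X)
      + of_bool (2 * card (low V X) \<le> a \<and> stuck X Y)))"
  proof (intro expect_mono p)
    fix X Y assume XY: "X \<subseteq> A" "Y \<subseteq> A"
    have f0: "0 \<le> f X Y / t" using t by (simp add: f_def)
    have l0: "0 \<le> 2 * card (low V X) / a" by simp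
    consider "\<not> d + 3 < 2 * gap_number V (X \<union> Y)" | "2 * card (low V X) > a" | "dense X" | "thin X"
      | "d + 1 \<le> card {v \<in> V. card (nbrs (X \<union> Y) {v}) = 1} + 2 * card {v \<in> V. card (nbrs (X \<union> Y) {v}) = 0}
          + 3 * card (tangled V (X \<union> Y) (low V X)) + 3 * x"
      | "2 * card (low V X) \<le> a" "stuck X Y"
    proof -
      have "stuck X Y" if g: "d + 3 < 2 * gap_number V (X \<union> Y)" and "\<not> dense X" "\<not> thin X"
        "card {v \<in> V. card (nbrs (X \<union> Y) {v}) = 1} + 2 * card {v \<in> V. card (nbrs (X \<union> Y) {v}) = 0}
          + 3 * card (tangled V (X \<union> Y) (low V X)) + 3 * x \<le> d"
        unfolding stuck_def
        using large_gap_number_cases[OF V(1) XY[unfolded A_def] y[unfolded n_def] g that(4)]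
          that unfolding dense_def thin_def by blast
      moreover have "2 * card (low V X) > a \<or> 2 * card (low V X) \<le> a" by linarith
      moreover have "d + 1 \<le> k \<or> k \<le> d" for k by linarith
      ultimately show thesis using that by blast
    qed
    then show "of_bool (d + 3 < 2 * gap_number V (X \<union> Y)) \<le> f X Y / t + 2 * card (low V X) / a
      + of_bool (dense X) + of_bool (thin X) + of_bool (2 * card (low V X) \<le> a \<and> stuck X Y)"
    proof cases
      case 2
      then have "1 \<le> 2 * card (low V X) / a" using a by (simp add: field_simps)
      then show ?thesis using f0 by (auto simp: of_bool_def)
    next
      case 5
      then have "real d + 1 \<le> f X Y + 3 * real x" unfolding f_def by linarith
      then have "1 \<le> f X Y / t" using t by (simp add: field_simps)
      then show ?thesis by (auto simp: of_bool_def add_increasing2)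
    qed (use f0 l0 in \<open>auto simp: of_bool_def\<close>)
  qed
  also have "\<dots> = ?e1 (\<lambda>X. ?e2 (\<lambda>Y. f X Y)) / t + 2 * ?e1 (\<lambda>X. card (low V X)) / a + ?e1 (\<lambda>X. of_bool (dense X))
      + ?e1 (\<lambda>X. of_bool (thin X)) + ?e1 (\<lambda>X. ?e2 (\<lambda>Y. of_bool (2 * card (low V X) \<le> a \<and> stuck X Y)))"
    using finA
    by (simp add: expect_add expect_const divide_inverse expect_multc expect_cmult del: of_bool_conj)
  also have "\<dots> \<le> (n * (real (n - 1) * p * (1 - p) ^ (n - 2)) + 2 * (n * (1 - p) ^ (n - 1))
        + 3 * (4 * real n * c ^ 4 * (low_bound c p1 n)\<^sup>2 + 2 * c ^ 4)) / t
    + 2 * (n * low_bound c p1 n) / a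
    + (\<Sum>s\<in>{x<..y}. real (n choose (4 * s)) * real ((4 * s choose 2) choose (8 * s)) * p1 ^ (8 * s))
    + (\<Sum>s\<in>{y<..a}. real (n choose s) * real (n choose (2 * s)) * (1 - p1) ^ (s * (n - 3 * s)))
    + (\<Sum>m\<le>n. real (card A choose m) * p2 ^ m) * (1 - p2) ^ N"
  proof (intro add_mono divide_right_mono mult_left_mono)
    have deg: "?e1 (\<lambda>X. ?e2 (\<lambda>Y. real (card {v \<in> V. card (nbrs (X \<union> Y) {v}) = i})))
        = n * ((n - 1 choose i) * p ^ i * (1 - p) ^ (n - 1 - i))" for i
      using expect_union[OF finA, of p1 p2 "\<lambda>E. real (card {v \<in> V. card (nbrs E {v}) = i})"]
        expect_degree_count[OF V(1), of p i] by (simp add: p_def n_def A_def)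
    have "?e1 (\<lambda>X. ?e2 (\<lambda>Y. f X Y)) = n * (real (n - 1) * p * (1 - p) ^ (n - 2)) + 2 * (n * (1 - p) ^ (n - 1))
        + 3 * ?e1 (\<lambda>X. ?e2 (\<lambda>Y. card (tangled V (X \<union> Y) (low V X))))"
      using deg[of 1] deg[of 0] unfolding f_def by (simp add: expect_add expect_cmult numeral_2_eq_2)
    then show "?e1 (\<lambda>X. ?e2 (\<lambda>Y. f X Y)) \<le> n * (real (n - 1) * p * (1 - p) ^ (n - 2)) + 2 * (n * (1 - p) ^ (n - 1))
        + 3 * (4 * real n * c ^ 4 * (low_bound c p1 n)\<^sup>2 + 2 * c ^ 4)"
      using expect_card_tangled[OF V p, of c] c by (simp add: A_def n_def p_def)
    show "?e1 (\<lambda>X. real (card (low V X))) \<le> n * low_bound c p1 n"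
      using expect_card_low[OF V(1) p(1,2), of c] V c by (simp add: A_def n_def)
    show "?e1 (\<lambda>X. of_bool (dense X))
      \<le> (\<Sum>s\<in>{x<..y}. real (n choose (4 * s)) * real ((4 * s choose 2) choose (8 * s)) * p1 ^ (8 * s))"
      unfolding dense_def A_def n_def using V(1) p(1,2) by (rule expect_dense)
    show "?e1 (\<lambda>X. of_bool (thin X))
      \<le> (\<Sum>s\<in>{y<..a}. real (n choose s) * real (n choose (2 * s)) * (1 - p1) ^ (s * (n - 3 * s)))"
      unfolding thin_def A_def n_def using V(1) p(1,2) by (rule expect_nonexpanding) (simp add: a_def n_def)
    have bound: "?e2 (\<lambda>Y. of_bool (2 * card (low V X) \<le> a \<and> stuck X Y))
        \<le> (\<Sum>m\<le>n. real (card A choose m) * p2 ^ m) * (1 - p2) ^ N" for X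
    proof (cases "2 * card (low V X) \<le> a")
      case True
      have "a - a div 2 \<le> a - card (low V X)" using True by simp
      then have "2 * N \<le> (a - card (low V X))\<^sup>2" using N by (meson order_trans power_mono zero_le)
      then show ?thesis
        using expect_no_booster[OF V(1) p(3,4), of "low V X" N a X d] True
        unfolding stuck_def A_def n_def by (simp add: low_def)
    next
      case False
      then show ?thesis using p finA by (simp add: expect_const sum_nonneg)
    qed
    have "?e1 (\<lambda>X. ?e2 (\<lambda>Y. of_bool (2 * card (low V X) \<le> a \<and> stuck X Y)))
      \<le> ?e1 (\<lambda>_. (\<Sum>m\<le>n. real (card A choose m) * p2 ^ m) * (1 - p2) ^ N)"
      by (intro expect_mono p bound)
    then show "?e1 (\<lambda>X. ?e2 (\<lambda>Y. of_bool (2 * card (low V X) \<le> a \<and> stuck X Y)))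
      \<le> (\<Sum>m\<le>n. real (card A choose m) * p2 ^ m) * (1 - p2) ^ N"
      using finA by (simp add: expect_const)
  qed (use t in auto)
  finally show ?thesis .
qed

section \<open>Asymptotics\<close>

text \<open>After the usual binomial estimates the base of the power \<open>4 * s\<close> is
  \<open>exp 1 ^ 3 * (c\<^sup>2 * s / n) / 4\<close>, which is small as long as s is at most n / (20
  c^2). Larger sets are left to \<open>thin_term_le\<close>.\<close>

lemma dense_term_le:
  fixes c p :: real
  assumes s: "s > 0" "20 * c\<^sup>2 * s \<le> n" and p: "0 \<le> p" "n * p \<le> c" and c: "c > 0"
  shows "real (n choose (4 * s)) * real ((4 * s choose 2) choose (8 * s)) * p ^ (8 * s) \<le> (1 / 2) ^ s"
proof -
  have n: "real n > 0" using s c by (smt (verit) mult_pos_pos of_nat_0_less_iff zero_less_power)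
  have pc: "p \<le> c / n" using p n by (simp add: field_simps)
  have 1: "real (n choose (4 * s)) \<le> (exp 1 * n / (4 * s)) ^ (4 * s)"
    using binomial_le_exp[of "4 * s" n] s by simp
  have "4 * s choose 2 \<le> 8 * s * s" by (simp add: choose_two algebra_simps div_le_mono)
  then have "real (4 * s choose 2) \<le> 8 * real s * real s" using of_nat_mono by fastforce
  then have M: "exp 1 * real (4 * s choose 2) / (8 * s) \<le> exp 1 * s"
    using s by (simp add: field_simps)
  have "real ((4 * s choose 2) choose (8 * s)) \<le> (exp 1 * real (4 * s choose 2) / (8 * s)) ^ (8 * s)"
    using binomial_le_exp[of "8 * s" "4 * s choose 2"] s by simp
  also have "\<dots> \<le> (exp 1 * s) ^ (8 * s)" using M by (intro power_mono) auto
  finally have 2: "real ((4 * s choose 2) choose (8 * s)) \<le> (exp 1 * s) ^ (8 * s)" .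
  have 3: "p ^ (8 * s) \<le> (c / n) ^ (8 * s)" using p pc by (intro power_mono)
  have e: "z ^ (8 * s) = (z\<^sup>2) ^ (4 * s)" for z :: real by (simp flip: power_mult)
  have "real (n choose (4 * s)) * real ((4 * s choose 2) choose (8 * s)) * p ^ (8 * s)
    \<le> (exp 1 * n / (4 * s)) ^ (4 * s) * (exp 1 * s) ^ (8 * s) * (c / n) ^ (8 * s)"
    using 1 2 3 p by (intro mult_mono) auto
  also have "\<dots> = ((exp 1 * n / (4 * s)) * ((exp 1 * s) * (c / n))\<^sup>2) ^ (4 * s)"
    unfolding e by (simp only: power_mult_distrib mult.assoc)
  also have "(exp 1 * n / (4 * s)) * ((exp 1 * s) * (c / n))\<^sup>2 = exp 1 ^ 3 * (c\<^sup>2 * s / n) / 4"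
    using n s by (simp add: field_simps power2_eq_square power3_eq_cube)
  also have "\<dots> ^ (4 * s) \<le> (1 / 2) ^ (4 * s)"
  proof (intro power_mono)
    have "c\<^sup>2 * s / n \<le> 1 / 20" using s n by (simp add: field_simps)
    moreover have "exp 1 ^ 3 \<le> (2.72 :: real) ^ 3" using e_less_272 by (intro power_mono) auto
    ultimately have "exp 1 ^ 3 * (c\<^sup>2 * s / n) \<le> 2.72 ^ 3 * (1 / 20)" using n by (intro mult_mono) auto
    moreover have "2.72 ^ 3 * (1 / 20) \<le> (2 :: real)" by (simp add: power3_eq_cube)
    ultimately have "exp 1 ^ 3 * (c\<^sup>2 * s / n) \<le> 2" by (rule order_trans)
    then have "exp 1 ^ 3 * (c\<^sup>2 * s / n) / 4 \<le> 2 / 4" by (rule divide_right_mono) simp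
    also have "(2 / 4 :: real) = 1 / 2" by simp
    finally show "exp 1 ^ 3 * (c\<^sup>2 * s / n) / 4 \<le> 1 / 2" .
  qed (use n in auto)
  also have "\<dots> \<le> (1 / 2) ^ s" by (intro power_decreasing) auto
  finally show ?thesis .
qed

text \<open>Here n / s is at most 20 c^2, so the choice of the two sets costs a fixed power of
  \<open>c\<close> per vertex of the smaller one. Since \<open>s \<le> n div 6\<close>, each such
  vertex misses at least n / 2 others, which gains \<open>exp (- k / 2)\<close>.\<close>

lemma thin_term_le:
  fixes c p k :: real
  assumes s: "s > 0" "n \<le> 20 * c\<^sup>2 * s" "s \<le> n div 6" and p: "0 \<le> p" "p \<le> 1" "k \<le> n * p"
    and c: "c > 0" "(20 * exp 1 * c\<^sup>2) ^ 3 * exp (- k / 2) \<le> 1 / 2"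
  shows "real (n choose s) * real (n choose (2 * s)) * (1 - p) ^ (s * (n - 3 * s)) \<le> (1 / 2) ^ s"
proof -
  define b where "b = 20 * exp 1 * c\<^sup>2"
  have b: "b > 0" "exp 1 * n / s \<le> b" using s c by (auto simp: b_def field_simps)
  have "real (n choose s) \<le> (exp 1 * n / s) ^ s" using binomial_le_exp[of s n] s by simp
  also have "\<dots> \<le> b ^ s" using b by (intro power_mono) auto
  finally have 1: "real (n choose s) \<le> b ^ s" .
  have "real (n choose (2 * s)) \<le> (exp 1 * n / (2 * s)) ^ (2 * s)" using binomial_le_exp[of "2 * s" n] s by simp
  also have "\<dots> \<le> (exp 1 * n / s) ^ (2 * s)" using s by (intro power_mono frac_le) auto
  also have "\<dots> \<le> b ^ (2 * s)" using b by (intro power_mono) auto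
  finally have 2: "real (n choose (2 * s)) \<le> b ^ (2 * s)" .
  have "6 * s \<le> n" using s(3) by (simp add: less_eq_div_iff_mult_less_eq mult.commute)
  then have "real n / 2 \<le> real (n - 3 * s)" by simp
  then have "real s * (real n / 2) * p \<le> real (s * (n - 3 * s)) * p"
    using p unfolding of_nat_mult by (intro mult_right_mono mult_left_mono) auto
  moreover have "real s * (k / 2) \<le> real s * (real n / 2) * p"
    using p(3) mult_left_mono[of k "n * p" "real s / 2"] by (simp add: field_simps)
  ultimately have ks: "real s * (k / 2) \<le> real (s * (n - 3 * s)) * p" by linarith
  have "(1 - p) ^ (s * (n - 3 * s)) \<le> exp (- (real (s * (n - 3 * s)) * p))"
    using p by (intro one_minus_power_le_exp)
  also have "\<dots> \<le> exp (real s * (- k / 2))" using ks by simp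
  also have "\<dots> = exp (- k / 2) ^ s" by (rule exp_of_nat_mult)
  finally have 3: "(1 - p) ^ (s * (n - 3 * s)) \<le> exp (- k / 2) ^ s" .
  have "real (n choose s) * real (n choose (2 * s)) * (1 - p) ^ (s * (n - 3 * s))
    \<le> b ^ s * b ^ (2 * s) * exp (- k / 2) ^ s"
    using 1 2 3 b p by (intro mult_mono) auto
  also have "\<dots> = (b ^ 3 * exp (- k / 2)) ^ s"
    by (simp add: power_mult_distrib power_add[symmetric] flip: power_mult)
  also have "\<dots> \<le> (1 / 2) ^ s" using c b unfolding b_def by (intro power_mono) auto
  finally show ?thesis .
qed

lemma sum_half_powers_le: "(\<Sum>s\<in>{x<..y}. (1 / 2 :: real) ^ s) \<le> (1 / 2) ^ x"
proof (cases "x \<le> y")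
  case True
  then have "(\<Sum>s\<in>{x<..y}. (1 / 2 :: real) ^ s) = (1 / 2) ^ x - (1 / 2) ^ y"
  proof (induction y rule: dec_induct)
    case (step y)
    have "{x<..Suc y} = insert (Suc y) {x<..y}" using step by auto
    then show ?case using step by simp
  qed simp
  then show ?thesis by simp
qed simp

lemma half_power_floor_tendsto:
  fixes k :: real
  assumes "k > 0"
  shows "(\<lambda>n. (1 / 2 :: real) ^ nat \<lfloor>k * real n\<rfloor>) \<longlonglongrightarrow> 0"
proof -
  have "filterlim (\<lambda>n. nat \<lfloor>k * real n\<rfloor>) at_top sequentially"
    using assms by real_asymp
  then show ?thesis by (rule filterlim_compose[rotated]) (simp add: LIMSEQ_power_zero)
qed

lemma choose_two_le: "real (n choose 2) \<le> real n * real n / 2"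
proof -
  have "2 * (n choose 2) \<le> n * (n - 1)" by (simp add: choose_two)
  also have "\<dots> \<le> n * n" by simp
  finally have "real (2 * (n choose 2)) \<le> real (n * n)" by (rule of_nat_mono)
  then show ?thesis by simp
qed

text \<open>The constant \<open>3000\<close> is chosen so that \<open>3000 / 288 > 10 > ln (1500 * e)\<close>.\<close>

lemma booster_term_le:
  fixes n :: nat
  assumes "n > 3000"
  defines "a \<equiv> n div 6"
  shows "(\<Sum>m\<le>n. real ((n choose 2) choose m) * (3000 / real n) ^ m) * (1 - 3000 / real n) ^ (a * a div 8)
    \<le> exp (10 * real n - ((real n / 6 - 1)\<^sup>2 / 8 - 1) * (3000 / real n))"
proof -
  have n: "real n > 0" using assms by simp
  have "real (n choose 2) \<le> real n * real n / 2" by (rule choose_two_le)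
  then have "real (n choose 2) * (3000 / real n) \<le> (real n * real n / 2) * (3000 / real n)"
    by (intro mult_right_mono) auto
  then have "(\<Sum>m\<le>n. real ((n choose 2) choose m) * (3000 / real n) ^ m) \<le> (1500 * exp 1) ^ n"
    using n by (intro sum_binomial_power_le) (auto simp: field_simps)
  also have "\<dots> \<le> exp 10 ^ n"
  proof (intro power_mono)
    have "(2.5 :: real) \<le> exp 1" using exp_lower_Taylor_quadratic[of 1] by simp
    then have "(2.5 :: real) ^ 10 \<le> exp 1 ^ 10" by (intro power_mono) auto
    also have "\<dots> = exp 10" by (simp flip: exp_of_nat_mult)
    finally have "(2.5 :: real) ^ 10 \<le> exp 10" .
    moreover have "1500 * exp 1 \<le> 1500 * (2.72 :: real)" using e_less_272 by simp
    moreover have "1500 * (2.72 :: real) \<le> 2.5 ^ 10" by (simp add: power_numeral_reduce)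
    ultimately show "1500 * exp 1 \<le> (exp 10 :: real)" by linarith
  qed simp
  also have "\<dots> = exp (10 * real n)" by (simp flip: exp_of_nat_mult add: mult.commute)
  finally have 1: "(\<Sum>m\<le>n. real ((n choose 2) choose m) * (3000 / real n) ^ m) \<le> exp (10 * real n)" .
  \<comment> \<open>As \<open>a\<close> is about n / 6, the number \<open>a * a div 8\<close> of
    boosters is about n^2 / 288; the next lines account for the rounding.\<close>
  have "n \<le> 6 * a + 5" unfolding a_def by linarith
  then have "real n / 6 - 1 \<le> real a" by linarith
  then have "(real n / 6 - 1)\<^sup>2 \<le> (real a)\<^sup>2" using assms by (intro power_mono) auto
  moreover have "a * a \<le> 8 * (a * a div 8) + 7" by linarith
  then have "real (a * a) / 8 - 1 \<le> real (a * a div 8)" by linarith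
  ultimately have "(real n / 6 - 1)\<^sup>2 / 8 - 1 \<le> real (a * a div 8)"
    using power2_eq_square[of "real a"] by simp
  then have "((real n / 6 - 1)\<^sup>2 / 8 - 1) * (3000 / real n) \<le> real (a * a div 8) * (3000 / real n)"
    by (intro mult_right_mono) auto
  moreover have "(1 - 3000 / real n) ^ (a * a div 8) \<le> exp (- (real (a * a div 8) * (3000 / real n)))"
    using assms by (intro one_minus_power_le_exp) auto
  ultimately have 2: "(1 - 3000 / real n) ^ (a * a div 8) \<le> exp (- (((real n / 6 - 1)\<^sup>2 / 8 - 1) * (3000 / real n)))"
    by (smt (verit) exp_le_cancel_iff)
  show ?thesis
    unfolding diff_conv_add_uminus[of "10 * real n"] exp_add
    using 1 2 assms by (intro mult_mono) (auto intro!: sum_nonneg)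
qed

text \<open>The extra unit in 3001 absorbs the 22 missing factors, because
  \<open>22 * (c - 3000) / n\<close> is at most 1.\<close>

lemma low_bound_le:
  fixes c p :: real
  assumes "c \<ge> 3001" "(c - 3000) / n \<le> p" "p \<le> 1" "22 * c \<le> n"
  shows "low_bound c p n \<le> 17 * c ^ 17 * exp (3001 - c)"
proof -
  have n: "22 \<le> n" using assms by linarith
  have "c - 3001 \<le> (real n - 22) * ((c - 3000) / n)"
  proof -
    have "22 * (c - 3000) / n \<le> 1" using assms n by (simp add: field_simps)
    moreover have "(real n - 22) * ((c - 3000) / n) = (c - 3000) - 22 * (c - 3000) / n"
      using n by (simp add: field_simps)
    ultimately show ?thesis by linarith
  qed
  also have "\<dots> \<le> (real n - 22) * p" using assms n by (intro mult_left_mono) auto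
  finally have "c - 3001 \<le> real (n - 22) * p" using n by (simp add: of_nat_diff)
  moreover have "(1 - p) ^ (n - 22) \<le> exp (- (real (n - 22) * p))"
    using assms by (intro one_minus_power_le_exp)
  ultimately have "(1 - p) ^ (n - 22) \<le> exp (3001 - c)" by (smt (verit) exp_le_cancel_iff)
  then show ?thesis unfolding low_bound_def using assms by (intro mult_left_mono) auto
qed

lemma one_minus_power_limit:
  fixes c :: real
  shows "(\<lambda>n. (1 - c / n) ^ (n - k)) \<longlonglongrightarrow> exp (- c)"
proof (rule Lim_transform_eventually)
  have e: "(\<lambda>n. (1 - c / n) ^ n) \<longlonglongrightarrow> exp (- c)"
    using tendsto_exp_limit_sequentially[of "- c"] by simp
  have q: "(\<lambda>n. 1 - c / real n) \<longlonglongrightarrow> 1" by real_asymp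
  have "(\<lambda>n. (1 - c / n) ^ n / (1 - c / n) ^ k) \<longlonglongrightarrow> exp (- c) / 1 ^ k"
    by (intro tendsto_divide e tendsto_power q) auto
  then show "(\<lambda>n. (1 - c / n) ^ n / (1 - c / n) ^ k) \<longlonglongrightarrow> exp (- c)" by simp
  have "\<forall>\<^sub>F n::nat in sequentially. c < real n" by real_asymp
  then show "\<forall>\<^sub>F n in sequentially. (1 - c / n) ^ n / (1 - c / n) ^ k = (1 - c / n) ^ (n - k)"
    using eventually_ge_at_top[of "max 1 k"]
  proof eventually_elim
    case (elim n)
    then have "1 - c / n \<noteq> 0" "k \<le> n" by (auto simp: field_simps)
    then show ?case by (simp add: power_diff)
  qed
qed

lemma degree_one_limit:
  fixes c :: real
  shows "(\<lambda>n. real (n - 1) * (c / n) * (1 - c / n) ^ (n - 2)) \<longlonglongrightarrow> c * exp (- c)"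
proof (intro tendsto_mult one_minus_power_limit)
  show "(\<lambda>n. real (n - 1) * (c / n)) \<longlonglongrightarrow> c" by real_asymp
qed

lemma degree_sum_limit:
  fixes c L :: real
  shows "(\<lambda>n. real (n - 1) * (c / n) * (1 - c / n) ^ (n - 2) + 2 * (1 - c / n) ^ (n - 1) + 12 * c ^ 4 * L\<^sup>2 + 6 * c ^ 4 / n)
    \<longlonglongrightarrow> c * exp (- c) + 2 * exp (- c) + 12 * c ^ 4 * L\<^sup>2"
proof -
  have "(\<lambda>n. 6 * c ^ 4 / real n) \<longlonglongrightarrow> 0" by real_asymp
  then have "(\<lambda>n. real (n - 1) * (c / n) * (1 - c / n) ^ (n - 2) + 2 * (1 - c / n) ^ (n - 1) + 12 * c ^ 4 * L\<^sup>2 + 6 * c ^ 4 / n)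
    \<longlonglongrightarrow> c * exp (- c) + 2 * exp (- c) + 12 * c ^ 4 * L\<^sup>2 + 0"
    by (intro tendsto_add degree_one_limit tendsto_mult one_minus_power_limit tendsto_const)
  then show ?thesis by simp
qed

text \<open>Markov's inequality compares a mean of at most (1 + \<epsilon>/8) \<mu> n with the
  threshold (1 + \<epsilon>/4) \<mu> n, which leaves a margin of \<open>2 * \<rho>\<close> below 1.
  The low vertices use up \<open>\<rho> / 2\<close>, the terms tending to 0 another
  \<open>\<rho> / 2\<close>, and \<open>\<rho>\<close> remains.\<close>

lemma gap_number_not_large:
  fixes \<epsilon> c :: real
  defines "\<mu> \<equiv> c * exp (- c)" and "L \<equiv> 17 * c ^ 17 * exp (3001 - c)"
  assumes \<epsilon>: "\<epsilon> > 0" and c: "c \<ge> 3001"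
    and c1: "2 * exp (- c) + 12 * c ^ 4 * L\<^sup>2 \<le> \<epsilon> / 16 * \<mu>"
    and c2: "24 * L \<le> (1 - (1 + \<epsilon> / 8) / (1 + \<epsilon> / 4)) / 4"
    and c3: "(20 * exp 1 * c\<^sup>2) ^ 3 * exp (- (c - 3000) / 2) \<le> 1 / 2"
  shows "\<exists>\<rho>>0. \<forall>\<^sub>F n in sequentially. expect (c / real n) (vertex_pairs {1..n})
    (\<lambda>E. of_bool ((1 + \<epsilon> / 2) * \<mu> * n + 3 < 2 * real (gap_number {1..n} E))) \<le> 1 - \<rho>"
proof -
  define \<rho> where "\<rho> = (1 - (1 + \<epsilon> / 8) / (1 + \<epsilon> / 4)) / 2"
  have \<rho>: "\<rho> > 0" using \<epsilon> by (simp add: \<rho>_def field_simps)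
  have \<mu>: "\<mu> > 0" using c by (simp add: \<mu>_def)
  define R where "R = (\<lambda>n::nat. real (n - 1) * (c / n) * (1 - c / n) ^ (n - 2) + 2 * (1 - c / n) ^ (n - 1)
    + 12 * c ^ 4 * L\<^sup>2 + 6 * c ^ 4 / n)"
  have "R \<longlonglongrightarrow> c * exp (- c) + 2 * exp (- c) + 12 * c ^ 4 * L\<^sup>2"
    unfolding R_def by (rule degree_sum_limit)
  moreover have "c * exp (- c) + 2 * exp (- c) + 12 * c ^ 4 * L\<^sup>2 < (1 + \<epsilon> / 8) * \<mu>"
  proof -
    have "\<epsilon> * \<mu> > 0" using \<epsilon> \<mu> by simp
    then have "\<epsilon> / 16 * \<mu> < \<epsilon> / 8 * \<mu>" by simp
    then show ?thesis using c1 by (simp add: \<mu>_def distrib_right)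
  qed
  ultimately have ev1: "\<forall>\<^sub>F n in sequentially. R n < (1 + \<epsilon> / 8) * \<mu>" by (rule order_tendstoD)
  \<comment> \<open>\<open>3 * k1\<close> is the gap \<epsilon>/4 * \<mu> between the thresholds
    defining \<open>t\<close> and \<open>d\<close>, spent on \<open>3 * x\<close>; \<open>k2\<close>
    marks the set size at which the estimate for dense sets hands over to the one for non-expanding
    sets.\<close>
  define k1 where "k1 = \<epsilon> * \<mu> / 12"
  define k2 where "k2 = 1 / (20 * c\<^sup>2)"
  have k: "k1 > 0" "k2 > 0" using \<epsilon> \<mu> c by (auto simp: k1_def k2_def)
  define Z where "Z = (\<lambda>n::nat. (1 / 2 :: real) ^ nat \<lfloor>k1 * n\<rfloor> + (1 / 2) ^ nat \<lfloor>k2 * n\<rfloor>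
    + exp (10 * real n - ((real n / 6 - 1)\<^sup>2 / 8 - 1) * (3000 / real n)))"
  have "(\<lambda>n::nat. exp (10 * real n - ((real n / 6 - 1)\<^sup>2 / 8 - 1) * (3000 / real n))) \<longlonglongrightarrow> 0"
  proof (rule Lim_transform_eventually)
    show "(\<lambda>n::nat. exp (125 + 2625 / real n - 5 / 12 * real n)) \<longlonglongrightarrow> 0" by real_asymp
    show "\<forall>\<^sub>F n::nat in sequentially. exp (125 + 2625 / real n - 5 / 12 * real n)
      = exp (10 * real n - ((real n / 6 - 1)\<^sup>2 / 8 - 1) * (3000 / real n))"
      using eventually_gt_at_top[of 0]
      by eventually_elim (simp add: field_simps power2_eq_square)
  qed
  then have "Z \<longlonglongrightarrow> 0 + 0 + 0"
    unfolding Z_def by (intro tendsto_add half_power_floor_tendsto k)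
  then have ev2: "\<forall>\<^sub>F n in sequentially. Z n < \<rho> / 2" using \<rho> by (intro order_tendstoD) auto
  have ev3: "\<forall>\<^sub>F n in sequentially. n > 3000 \<and> 22 * c \<le> real n"
    using eventually_gt_at_top[of 3000] eventually_ge_at_top[of "nat \<lceil>22 * c\<rceil>"]
    by eventually_elim (simp add: nat_le_iff ceiling_le_iff)
  have "\<forall>\<^sub>F n in sequentially. expect (c / real n) (vertex_pairs {1..n})
    (\<lambda>E. of_bool ((1 + \<epsilon> / 2) * \<mu> * n + 3 < 2 * real (gap_number {1..n} E))) \<le> 1 - \<rho>"
    using ev1 ev2 ev3
  proof eventually_elim
    case (elim n)
    define p where "p = c / n"
    define p2 where "p2 = 3000 / real n"
    define p1 where "p1 = (p - p2) / (1 - p2)"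
    define x where "x = nat \<lfloor>k1 * n\<rfloor>"
    define y where "y = nat \<lfloor>k2 * n\<rfloor>"
    define a where "a = n div 6"
    define d where "d = nat \<lfloor>(1 + \<epsilon> / 2) * \<mu> * n\<rfloor>"
    define t where "t = (1 + \<epsilon> / 4) * \<mu> * n"
    define V where "V = {1..n}"
    have n: "n > 3000" "22 * c \<le> n" "real n > 0" using elim by auto
    have V: "finite V" "card V = n" by (auto simp: V_def)
    have p2: "0 \<le> p2" "p2 < 1" using n by (auto simp: p2_def)
    have p: "p2 \<le> p" "p \<le> 1" "0 \<le> p" "n * p = c"
      using n c by (auto simp: p_def p2_def field_simps)
    have p1: "0 \<le> p1" "p1 \<le> 1" using p p2 by (auto simp: p1_def field_simps)
    have "p1 * (1 - p2) = p - p2" using p2 by (simp add: p1_def)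
    then have pp: "p1 + p2 - p1 * p2 = p" by (simp add: algebra_simps)
    have p1p: "p1 \<le> p" using pp p2 p1 mult_left_le[of p1 p2] by (simp add: mult.commute)
    have p1l: "(c - 3000) / n \<le> p1"
    proof -
      have "p - p2 \<le> p1" using pp p1 p2 by (smt (verit) mult_nonneg_nonneg)
      then show ?thesis by (simp add: p_def p2_def diff_divide_distrib)
    qed
    have np1: "n * p1 \<le> c" using mult_left_mono[OF p1p, of n] p by simp
    have c0: "c > 0" "1 \<le> c" using c by auto
    have xle: "real x \<le> k1 * n" using k by (simp add: x_def)
    have yle: "real y \<le> k2 * n" using k by (simp add: y_def)
    have yle': "20 * c\<^sup>2 * real y \<le> n" using yle c0 by (simp add: k2_def field_simps)
    have y4: "4 * y \<le> n"
    proof -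
      have "1 \<le> c\<^sup>2" using c0 by simp
      then have "4 * real y \<le> 20 * c\<^sup>2 * real y" by (intro mult_right_mono) auto
      then show ?thesis using yle' by linarith
    qed
    have t0: "0 < t" using \<epsilon> \<mu> n by (simp add: t_def)
    have td: "t + 3 * real x \<le> d + 1"
    proof -
      have "t + 3 * real x \<le> t + 3 * (k1 * n)" using xle by simp
      also have "\<dots> = (1 + \<epsilon> / 2) * \<mu> * n" by (simp add: t_def k1_def algebra_simps)
      also have "\<dots> \<le> d + 1" unfolding d_def by linarith
      finally show ?thesis .
    qed
    have N: "2 * (a * a div 8) \<le> (a - a div 2)\<^sup>2"
    proof -
      have "a \<le> 2 * (a - a div 2)" by linarith
      then have "a * a \<le> (2 * (a - a div 2)) * (2 * (a - a div 2))" by (rule mult_le_mono) (simp_all)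
      then have "a * a \<le> 4 * (a - a div 2)\<^sup>2" by (simp add: power2_eq_square)
      then show ?thesis by linarith
    qed
    have lb: "0 \<le> low_bound c p1 n" "low_bound c p1 n \<le> L"
      unfolding L_def using low_bound_le[of c n p1] c p1l p1 n c0 by (auto intro: low_bound_nonneg)
    have L0: "0 \<le> L" using lb by linarith
    have "expect p (vertex_pairs V) (\<lambda>E. of_bool ((1 + \<epsilon> / 2) * \<mu> * n + 3 < 2 * real (gap_number V E)))
      \<le> expect p (vertex_pairs V) (\<lambda>E. of_bool (d + 3 < 2 * gap_number V E))"
    proof (intro expect_mono p)
      fix E
      have "real d \<le> (1 + \<epsilon> / 2) * \<mu> * n" using \<epsilon> \<mu> by (simp add: d_def)
      then show "of_bool ((1 + \<epsilon> / 2) * \<mu> * n + 3 < 2 * real (gap_number V E))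
        \<le> (of_bool (d + 3 < 2 * gap_number V E) :: real)" by auto
    qed
    also have "\<dots> \<le> (n * (real (n - 1) * p * (1 - p) ^ (n - 2)) + 2 * (n * (1 - p) ^ (n - 1))
        + 3 * (4 * real n * c ^ 4 * (low_bound c p1 n)\<^sup>2 + 2 * c ^ 4)) / t
      + 2 * (n * low_bound c p1 n) / a
      + (\<Sum>s\<in>{x<..y}. real (n choose (4 * s)) * real ((4 * s choose 2) choose (8 * s)) * p1 ^ (8 * s))
      + (\<Sum>s\<in>{y<..a}. real (n choose s) * real (n choose (2 * s)) * (1 - p1) ^ (s * (n - 3 * s)))
      + (\<Sum>m\<le>n. real ((n choose 2) choose m) * p2 ^ m) * (1 - p2) ^ (a * a div 8)"
      using expect_gap_number_large[of V p1 p2 c y "a * a div 8" t x d] V p1 p2 c0 np1 p y4 N t0 td n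
      unfolding pp card_vertex_pairs[OF V(1)] V(2) a_def by simp
    also have "\<dots> \<le> (1 + \<epsilon> / 8) / (1 + \<epsilon> / 4) + 24 * L + (1 / 2) ^ x + (1 / 2) ^ y
      + exp (10 * real n - ((real n / 6 - 1)\<^sup>2 / 8 - 1) * (3000 / real n))"
    proof (intro add_mono)
      have "(n * (real (n - 1) * p * (1 - p) ^ (n - 2)) + 2 * (n * (1 - p) ^ (n - 1))
        + 3 * (4 * real n * c ^ 4 * (low_bound c p1 n)\<^sup>2 + 2 * c ^ 4))
        \<le> (n * (real (n - 1) * p * (1 - p) ^ (n - 2)) + 2 * (n * (1 - p) ^ (n - 1))
        + 3 * (4 * real n * c ^ 4 * L\<^sup>2 + 2 * c ^ 4))"
        using lb p c0 by (intro add_mono mult_left_mono power_mono) auto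
      also have "\<dots> = n * R n" using n by (simp add: R_def p_def field_simps)
      also have "\<dots> \<le> n * ((1 + \<epsilon> / 8) * \<mu>)" using elim by (intro mult_left_mono) auto
      finally have "(n * (real (n - 1) * p * (1 - p) ^ (n - 2)) + 2 * (n * (1 - p) ^ (n - 1))
        + 3 * (4 * real n * c ^ 4 * (low_bound c p1 n)\<^sup>2 + 2 * c ^ 4)) / t \<le> n * ((1 + \<epsilon> / 8) * \<mu>) / t"
        using t0 by (intro divide_right_mono) auto
      also have "\<dots> = (1 + \<epsilon> / 8) / (1 + \<epsilon> / 4)" using n \<mu> by (simp add: t_def)
      finally show "(n * (real (n - 1) * p * (1 - p) ^ (n - 2)) + 2 * (n * (1 - p) ^ (n - 1))
        + 3 * (4 * real n * c ^ 4 * (low_bound c p1 n)\<^sup>2 + 2 * c ^ 4)) / t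
        \<le> (1 + \<epsilon> / 8) / (1 + \<epsilon> / 4)" .
      have "n \<le> 12 * a" using n unfolding a_def by linarith
      then have "2 * (real n * low_bound c p1 n) \<le> 2 * (real (12 * a) * L)"
        using lb by (intro mult_left_mono mult_mono) auto
      then show "2 * (n * low_bound c p1 n) / a \<le> 24 * L"
        using n by (simp add: a_def field_simps)
      show "(\<Sum>s\<in>{x<..y}. real (n choose (4 * s)) * real ((4 * s choose 2) choose (8 * s)) * p1 ^ (8 * s))
        \<le> (1 / 2) ^ x"
      proof -
        have "(\<Sum>s\<in>{x<..y}. real (n choose (4 * s)) * real ((4 * s choose 2) choose (8 * s)) * p1 ^ (8 * s))
          \<le> (\<Sum>s\<in>{x<..y}. (1 / 2) ^ s)"
        proof (intro sum_mono dense_term_le p1 np1 c0)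
          fix s assume s: "s \<in> {x<..y}"
          then have "20 * c\<^sup>2 * real s \<le> 20 * c\<^sup>2 * real y" by (intro mult_left_mono) auto
          then show "20 * c\<^sup>2 * real s \<le> real n" using yle' by linarith
        qed (use np1 c0 in auto)
        also have "\<dots> \<le> (1 / 2) ^ x" by (rule sum_half_powers_le)
        finally show ?thesis .
      qed
      show "(\<Sum>s\<in>{y<..a}. real (n choose s) * real (n choose (2 * s)) * (1 - p1) ^ (s * (n - 3 * s))) \<le> (1 / 2) ^ y"
      proof -
        have "(\<Sum>s\<in>{y<..a}. real (n choose s) * real (n choose (2 * s)) * (1 - p1) ^ (s * (n - 3 * s)))
          \<le> (\<Sum>s\<in>{y<..a}. (1 / 2) ^ s)"
        proof (intro sum_mono thin_term_le p1 c0 c3)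
          fix s assume s: "s \<in> {y<..a}"
          then have "k2 * n \<le> real s" unfolding y_def by (simp add: nat_less_iff) linarith
          then show "real n \<le> 20 * c\<^sup>2 * real s" using c0 by (simp add: k2_def field_simps)
          show "c - 3000 \<le> real n * p1" using p1l n by (simp add: field_simps)
        qed (use c0 c3 in \<open>auto simp: a_def\<close>)
        also have "\<dots> \<le> (1 / 2) ^ y" by (rule sum_half_powers_le)
        finally show ?thesis .
      qed
      show "(\<Sum>m\<le>n. real ((n choose 2) choose m) * p2 ^ m) * (1 - p2) ^ (a * a div 8)
        \<le> exp (10 * real n - ((real n / 6 - 1)\<^sup>2 / 8 - 1) * (3000 / real n))"
        unfolding p2_def a_def using n(1) by (rule booster_term_le)
    qed
    also have "\<dots> = (1 + \<epsilon> / 8) / (1 + \<epsilon> / 4) + 24 * L + Z n" by (simp add: Z_def x_def y_def)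
    also have "\<dots> \<le> 1 - \<rho>"
    proof -
      have "24 * L \<le> \<rho> / 2" using c2 by (simp add: \<rho>_def)
      moreover have "(1 + \<epsilon> / 8) / (1 + \<epsilon> / 4) = 1 - 2 * \<rho>"
        using \<epsilon> by (simp add: \<rho>_def field_simps)
      ultimately show ?thesis using elim(2) by linarith
    qed
    finally show ?case by (simp add: p_def V_def)
  qed
  then show ?thesis using \<rho> by blast
qed

section \<open>Concentration and conclusion\<close>

text \<open>The variance is at most about n^2 / 2 * (c / n) * K^2, linear in n, whereas the squared
  deviation is quadratic.\<close>

lemma expect_deviation_le:
  fixes c t K :: real
  assumes n: "real n \<ge> c" "n > 0" and c: "c \<ge> 0" and t: "t > 0"
    and lip: "\<And>e E. e \<in> vertex_pairs {1..n} \<Longrightarrow> E \<subseteq> vertex_pairs {1..n} \<Longrightarrow> \<bar>f (insert e E) - f E\<bar> \<le> K"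
  defines "A \<equiv> vertex_pairs {1..n}"
  shows "expect (c / n) A (\<lambda>E. of_bool (t * n \<le> \<bar>f E - expect (c / n) A f\<bar>)) \<le> c * K\<^sup>2 / (2 * t\<^sup>2) / n"
proof -
  have p: "0 \<le> c / n" "c / n \<le> 1" using n c by auto
  have "expect (c / n) A (\<lambda>E. of_bool (t * n \<le> \<bar>f E - expect (c / n) A f\<bar>))
     \<le> card A * (c / n) * K\<^sup>2 / (t * n)\<^sup>2"
    unfolding A_def using n t p lip by (intro expect_chebyshev finite_vertex_pairs) auto
  also have "\<dots> \<le> (real n * real n / 2) * (c / n) * K\<^sup>2 / (t * n)\<^sup>2"
    using choose_two_le[of n] p unfolding A_def
    by (intro divide_right_mono mult_right_mono) (auto simp: card_vertex_pairs)
  also have "\<dots> = c * K\<^sup>2 / (2 * t\<^sup>2) / n"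
    using n t by (simp add: field_simps power2_eq_square)
  finally show ?thesis .
qed

lemma gap_number_lipschitz:
  assumes "finite V"
  shows "\<bar>real (gap_number V (insert e E)) - real (gap_number V E)\<bar> \<le> 1"
proof -
  have "gap_number V (insert e E) \<le> gap_number V E" using assms by (intro gap_number_mono) auto
  moreover have "gap_number V E \<le> Suc (gap_number V (insert e E))" using assms by (rule gap_number_insert_le)
  ultimately show ?thesis by linarith
qed

lemma degree_count_lipschitz:
  assumes V: "finite V" and e: "e \<in> vertex_pairs V"
  shows "\<bar>real (card {v \<in> V. card (nbrs (insert e E) {v}) = i}) - real (card {v \<in> V. card (nbrs E {v}) = i})\<bar> \<le> 2"
proof -
  define S where "S = (\<lambda>E. {v \<in> V. card (nbrs E {v}) = i})"
  have ce: "card e = 2" "finite e" using e V by (auto simp: vertex_pairs_def intro: finite_subset)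
  have same: "nbrs (insert e E) {v} = nbrs E {v}" if "v \<notin> e" for v
    using that by (auto simp: nbrs_single)
  have "S (insert e E) \<subseteq> S E \<union> e" "S E \<subseteq> S (insert e E) \<union> e"
    using same by (auto simp: S_def)
  moreover have "finite (S E)" "finite (S (insert e E))" using V by (auto simp: S_def)
  ultimately have "card (S (insert e E)) \<le> card (S E \<union> e)" "card (S E) \<le> card (S (insert e E) \<union> e)"
    using ce by (auto intro!: card_mono)
  then have "card (S (insert e E)) \<le> card (S E) + 2" "card (S E) \<le> card (S (insert e E)) + 2"
    using card_Un_le[of "S E" e] card_Un_le[of "S (insert e E)" e] ce by linarith+
  then show ?thesis by (simp add: S_def)
qed

text \<open>If the mean exceeded \<open>q / 2 + \<tau> * n\<close>, every graph with
  \<open>2 * b E \<le> q\<close> would deviate by \<open>\<tau> * n\<close> from it; these have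
  probability at least \<open>\<rho>\<close>, which contradicts concentration. So the mean is small,
  and a second use of concentration carries this over to almost all graphs.\<close>

lemma path_cover_number_upper:
  fixes \<epsilon> c \<rho> :: real
  defines "\<mu> \<equiv> c * exp (- c)"
  assumes \<epsilon>: "\<epsilon> > 0" and c: "c > 0" and \<rho>: "\<rho> > 0"
    and likely: "\<forall>\<^sub>F n in sequentially. expect (c / real n) (vertex_pairs {1..n})
    (\<lambda>E. of_bool ((1 + \<epsilon> / 2) * \<mu> * n + 3 < 2 * real (gap_number {1..n} E))) \<le> 1 - \<rho>"
  shows "(\<lambda>n. expect (c / real n) (vertex_pairs {1..n})
    (\<lambda>E. of_bool ((1 + \<epsilon>) * \<mu> * n / 2 < real (path_cover_number {1..n} E)))) \<longlonglongrightarrow> 0"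
proof (rule tendsto_sandwich[OF _ _ tendsto_const])
  \<comment> \<open>The slack between \<epsilon>/2 and \<epsilon> amounts to
    \<open>4 * (\<tau> * n)\<close>: one part bounds the mean, one the deviation, and two absorb the
    additive constants.\<close>
  define \<tau> where "\<tau> = \<epsilon> * \<mu> / 16"
  have \<tau>: "\<tau> > 0" using \<epsilon> c by (simp add: \<tau>_def \<mu>_def)
  show "(\<lambda>n. c * 1\<^sup>2 / (2 * \<tau>\<^sup>2) / real n) \<longlonglongrightarrow> 0" by real_asymp
  then have ev1: "\<forall>\<^sub>F n in sequentially. c * 1\<^sup>2 / (2 * \<tau>\<^sup>2) / real n < \<rho>"
    using \<rho> by (rule order_tendstoD)
  have ev2: "\<forall>\<^sub>F n::nat in sequentially. c \<le> real n" by real_asymp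
  have ev3: "\<forall>\<^sub>F n::nat in sequentially. 3 \<le> 2 * (\<tau> * n)" using \<tau> by real_asymp
  show "\<forall>\<^sub>F n in sequentially. 0 \<le> expect (c / real n) (vertex_pairs {1..n})
    (\<lambda>E. of_bool ((1 + \<epsilon>) * \<mu> * n / 2 < real (path_cover_number {1..n} E)))"
    using ev2
  proof eventually_elim
    case (elim n)
    then show ?case using c by (intro expect_nonneg) auto
  qed
  show "\<forall>\<^sub>F n in sequentially. expect (c / real n) (vertex_pairs {1..n})
    (\<lambda>E. of_bool ((1 + \<epsilon>) * \<mu> * n / 2 < real (path_cover_number {1..n} E))) \<le> c * 1\<^sup>2 / (2 * \<tau>\<^sup>2) / real n"
    using likely ev1 ev2 ev3 eventually_gt_at_top[of 0]
  proof eventually_elim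
    case (elim n)
    define A where "A = vertex_pairs {1..n}"
    define p where "p = c / real n"
    define b where "b = (\<lambda>E. real (gap_number {1..n} E))"
    define m where "m = expect p A b"
    define q where "q = (1 + \<epsilon> / 2) * \<mu> * n + 3"
    have p: "0 \<le> p" "p \<le> 1" using elim c by (auto simp: p_def)
    have dev: "expect p A (\<lambda>E. of_bool (\<tau> * n \<le> \<bar>b E - m\<bar>)) \<le> c * 1\<^sup>2 / (2 * \<tau>\<^sup>2) / real n"
      unfolding p_def A_def m_def b_def using elim c \<tau>
      by (intro expect_deviation_le gap_number_lipschitz) auto
    have m: "m \<le> q / 2 + \<tau> * n"
    proof (rule ccontr)
      assume neg: "\<not> ?thesis"
      have "1 = expect p A (\<lambda>_. 1)" by (simp add: expect_const A_def finite_vertex_pairs)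
      also have "\<dots> \<le> expect p A (\<lambda>E. of_bool (q < 2 * b E) + of_bool (\<tau> * n \<le> \<bar>b E - m\<bar>))"
        using neg by (intro expect_mono p) (auto simp: of_bool_def)
      also have "\<dots> \<le> 1 - \<rho> + c * 1\<^sup>2 / (2 * \<tau>\<^sup>2) / real n"
        unfolding expect_add using elim(1) dev
        by (intro add_mono) (simp_all add: q_def b_def p_def A_def)
      finally show False using elim(2) by simp
    qed
    have "expect p A (\<lambda>E. of_bool ((1 + \<epsilon>) * \<mu> * n / 2 < real (path_cover_number {1..n} E)))
      \<le> expect p A (\<lambda>E. of_bool (\<tau> * n \<le> \<bar>b E - m\<bar>))"
    proof (intro expect_mono p)
      fix E
      have "real (path_cover_number {1..n} E) \<le> b E + 1"
        using path_cover_number_le_gap_number[of "{1..n}" E] elim by (simp add: b_def)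
      moreover have eq: "(1 + \<epsilon>) * \<mu> * n / 2 = q / 2 - 3 / 2 + 4 * (\<tau> * n)"
        by (simp add: \<tau>_def q_def field_simps)
      ultimately have "\<tau> * n \<le> b E - m" if "(1 + \<epsilon>) * \<mu> * n / 2 < real (path_cover_number {1..n} E)"
        using that[unfolded eq] m elim(4) by linarith
      then show "of_bool ((1 + \<epsilon>) * \<mu> * n / 2 < real (path_cover_number {1..n} E))
        \<le> (of_bool (\<tau> * n \<le> \<bar>b E - m\<bar>) :: real)" by (fastforce simp: of_bool_def)
    qed
    then show ?case using dev by (simp add: p_def A_def)
  qed
qed

text \<open>Here concentration is applied to the number of degree-one vertices, whose mean is known
  to be asymptotically \<open>\<mu> * n\<close>. An edge affects only the degrees of its two ends,
  hence the constant 2.\<close>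

lemma path_cover_number_lower:
  fixes \<epsilon> c :: real
  defines "\<mu> \<equiv> c * exp (- c)"
  assumes \<epsilon>: "\<epsilon> > 0" and c: "c > 0"
  shows "(\<lambda>n. expect (c / real n) (vertex_pairs {1..n})
    (\<lambda>E. of_bool (real (path_cover_number {1..n} E) < (1 - \<epsilon>) * \<mu> * n / 2))) \<longlonglongrightarrow> 0"
proof (rule tendsto_sandwich[OF _ _ tendsto_const])
  define \<tau> where "\<tau> = \<epsilon> * \<mu> / 4"
  have \<tau>: "\<tau> > 0" using \<epsilon> c by (simp add: \<tau>_def \<mu>_def)
  show "(\<lambda>n. c * 2\<^sup>2 / (2 * \<tau>\<^sup>2) / real n) \<longlonglongrightarrow> 0" by real_asymp
  have ev2: "\<forall>\<^sub>F n::nat in sequentially. c \<le> real n" by real_asymp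
  have ev3: "\<forall>\<^sub>F n::nat in sequentially. 2 \<le> \<tau> * n" using \<tau> by real_asymp
  have "(\<lambda>n. real (n - 1) * (c / n) * (1 - c / n) ^ (n - 2)) \<longlonglongrightarrow> \<mu>"
    unfolding \<mu>_def by (rule degree_one_limit)
  then have ev4: "\<forall>\<^sub>F n in sequentially. \<mu> - \<tau> < real (n - 1) * (c / n) * (1 - c / n) ^ (n - 2)"
    using \<tau> by (intro order_tendstoD) auto
  show "\<forall>\<^sub>F n in sequentially. 0 \<le> expect (c / real n) (vertex_pairs {1..n})
    (\<lambda>E. of_bool (real (path_cover_number {1..n} E) < (1 - \<epsilon>) * \<mu> * n / 2))"
    using ev2
  proof eventually_elim
    case (elim n)
    then show ?case using c by (intro expect_nonneg) auto
  qed
  show "\<forall>\<^sub>F n in sequentially. expect (c / real n) (vertex_pairs {1..n})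
    (\<lambda>E. of_bool (real (path_cover_number {1..n} E) < (1 - \<epsilon>) * \<mu> * n / 2)) \<le> c * 2\<^sup>2 / (2 * \<tau>\<^sup>2) / real n"
    using ev2 ev3 ev4 eventually_gt_at_top[of 0]
  proof eventually_elim
    case (elim n)
    define A where "A = vertex_pairs {1..n}"
    define p where "p = c / real n"
    define Y where "Y = (\<lambda>E. real (card {v \<in> {1..n}. card (nbrs E {v}) = 1}))"
    define m where "m = expect p A Y"
    have p: "0 \<le> p" "p \<le> 1" using elim c by (auto simp: p_def)
    have dev: "expect p A (\<lambda>E. of_bool (\<tau> * n \<le> \<bar>Y E - m\<bar>)) \<le> c * 2\<^sup>2 / (2 * \<tau>\<^sup>2) / real n"
      unfolding p_def A_def m_def Y_def using elim c \<tau>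
      by (intro expect_deviation_le degree_count_lipschitz) auto
    have "m = n * (real (n - 1) * p * (1 - p) ^ (n - 2))"
      unfolding m_def A_def Y_def
      using expect_degree_count[of "{1..n}" p 1] by (simp add: numeral_2_eq_2)
    moreover have "n * (\<mu> - \<tau>) \<le> n * (real (n - 1) * p * (1 - p) ^ (n - 2))"
      unfolding p_def using elim(3) by (intro mult_left_mono) auto
    ultimately have m: "n * (\<mu> - \<tau>) \<le> m" by simp
    have "expect p A (\<lambda>E. of_bool (real (path_cover_number {1..n} E) < (1 - \<epsilon>) * \<mu> * n / 2))
      \<le> expect p A (\<lambda>E. of_bool (\<tau> * n \<le> \<bar>Y E - m\<bar>))"
    proof (intro expect_mono p)
      fix E
      have "gap_number {1..n} E \<le> path_cover_number {1..n} E"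
        using elim by (intro gap_number_le_path_cover_number) auto
      then have Y: "Y E \<le> 2 * real (path_cover_number {1..n} E) + 2"
        using card_degree_one_le[of "{1..n}" E] by (simp add: Y_def)
      have "(1 - \<epsilon>) * \<mu> * n / 2 = (n * (\<mu> - \<tau>) - 3 * (\<tau> * n)) / 2"
        by (simp add: \<tau>_def field_simps)
      then have eq: "k < (1 - \<epsilon>) * \<mu> * n / 2 \<longleftrightarrow> 2 * k < n * (\<mu> - \<tau>) - 3 * (\<tau> * n)" for k
        by (simp only: less_divide_eq_numeral1 mult.commute[of k])
      have arith: "y \<le> 2 * k + 2 \<Longrightarrow> 2 * k < Q - 3 * T \<Longrightarrow> Q \<le> m \<Longrightarrow> 2 \<le> T \<Longrightarrow> T \<le> m - y"
        for y k Q T :: real by linarith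
      have "\<tau> * n \<le> m - Y E" if "real (path_cover_number {1..n} E) < (1 - \<epsilon>) * \<mu> * n / 2"
        using Y that[unfolded eq] m elim(2) by (rule arith)
      then show "of_bool (real (path_cover_number {1..n} E) < (1 - \<epsilon>) * \<mu> * n / 2)
        \<le> (of_bool (\<tau> * n \<le> \<bar>Y E - m\<bar>) :: real)" by (fastforce simp: of_bool_def)
    qed
    then show ?case using dev by (simp add: p_def A_def)
  qed
qed

theorem theorem1:
  fixes \<epsilon> :: real
  assumes "\<epsilon> > 0"
  shows "\<exists>c\<^sub>0::real. c\<^sub>0 > 0 \<and> (\<forall>c\<ge>c\<^sub>0.
    (\<lambda>n::nat. measure_pmf.prob (gnp n (c / real n))
       {E. (1 - \<epsilon>) * (1 / 2 * c * exp (- c)) * real n \<le> real (path_cover_number {1..n} E) \<and>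
           real (path_cover_number {1..n} E) \<le> (1 + \<epsilon>) * (1 / 2 * c * exp (- c)) * real n})
      \<longlonglongrightarrow> 1)"
proof -
  define \<rho> where "\<rho> = (1 - (1 + \<epsilon> / 8) / (1 + \<epsilon> / 4)) / 4"
  have "\<rho> > 0" using assms by (simp add: \<rho>_def field_simps)
  have "\<forall>\<^sub>F c in at_top. c \<ge> (3001 :: real)" by (rule eventually_ge_at_top)
  \<comment> \<open>The left side decays like \<open>exp (- 2 * c)\<close> up to powers of
    \<open>c\<close>, apart from \<open>2 * exp (- c)\<close>, which lacks the factor
    \<open>c\<close> of the right side.\<close>
  moreover have "\<forall>\<^sub>F c in at_top. 2 * exp (- c) + 12 * c ^ 4 * (17 * c ^ 17 * exp (3001 - c))\<^sup>2
      \<le> \<epsilon> / 16 * (c * exp (- c))"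
    using assms by real_asymp
  moreover have "\<forall>\<^sub>F c in at_top. 24 * (17 * c ^ 17 * exp (3001 - c)) \<le> \<rho>"
    using \<open>\<rho> > 0\<close> by real_asymp
  moreover have "\<forall>\<^sub>F c in at_top. (20 * exp 1 * c\<^sup>2) ^ 3 * exp (- (c - 3000) / 2) \<le> (1 / 2 :: real)"
    by real_asymp
  ultimately have "\<forall>\<^sub>F c in at_top. c \<ge> (3001 :: real) \<and>
      2 * exp (- c) + 12 * c ^ 4 * (17 * c ^ 17 * exp (3001 - c))\<^sup>2 \<le> \<epsilon> / 16 * (c * exp (- c)) \<and>
      24 * (17 * c ^ 17 * exp (3001 - c)) \<le> \<rho> \<and>
      (20 * exp 1 * c\<^sup>2) ^ 3 * exp (- (c - 3000) / 2) \<le> 1 / 2"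
    by eventually_elim simp
  then obtain c\<^sub>0 where c\<^sub>0: "\<And>c. c \<ge> c\<^sub>0 \<Longrightarrow> c \<ge> (3001 :: real) \<and>
      2 * exp (- c) + 12 * c ^ 4 * (17 * c ^ 17 * exp (3001 - c))\<^sup>2 \<le> \<epsilon> / 16 * (c * exp (- c)) \<and>
      24 * (17 * c ^ 17 * exp (3001 - c)) \<le> \<rho> \<and>
      (20 * exp 1 * c\<^sup>2) ^ 3 * exp (- (c - 3000) / 2) \<le> 1 / 2"
    unfolding eventually_at_top_linorder by blast
  show ?thesis
  proof (intro exI[of _ c\<^sub>0] conjI allI impI)
    show "c\<^sub>0 > 0" using c\<^sub>0[of c\<^sub>0] by simp
    fix c assume "c \<ge> c\<^sub>0"
    note c = c\<^sub>0[OF this]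
    have c0: "c > 0" using c by simp
    let ?e = "\<lambda>n. expect (c / real n) (vertex_pairs {1..n})"
    let ?low = "\<lambda>(n :: nat) (E :: nat set set). real (path_cover_number {1..n} E) < (1 - \<epsilon>) * (c * exp (- c)) * n / 2"
    let ?high = "\<lambda>(n :: nat) (E :: nat set set). (1 + \<epsilon>) * (c * exp (- c)) * n / 2 < real (path_cover_number {1..n} E)"
    let ?S = "\<lambda>n :: nat. {E. (1 - \<epsilon>) * (1 / 2 * c * exp (- c)) * real n \<le> real (path_cover_number {1..n} E) \<and>
           real (path_cover_number {1..n} E) \<le> (1 + \<epsilon>) * (1 / 2 * c * exp (- c)) * real n}"
    obtain \<rho>' where "\<rho>' > 0" "\<forall>\<^sub>F n in sequentially. ?e n
        (\<lambda>E. of_bool ((1 + \<epsilon> / 2) * (c * exp (- c)) * n + 3 < 2 * real (gap_number {1..n} E))) \<le> 1 - \<rho>'"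
      using gap_number_not_large[OF assms, of c] c unfolding \<rho>_def by blast
    then have high: "(\<lambda>n. ?e n (\<lambda>E. of_bool (?high n E))) \<longlonglongrightarrow> 0"
      by (intro path_cover_number_upper[OF assms c0])
    have low: "(\<lambda>n. ?e n (\<lambda>E. of_bool (?low n E))) \<longlonglongrightarrow> 0"
      by (rule path_cover_number_lower[OF assms c0])
    show "(\<lambda>n. measure_pmf.prob (gnp n (c / real n)) (?S n)) \<longlonglongrightarrow> 1"
    proof (rule tendsto_sandwich)
      show "(\<lambda>n. 1 - ?e n (\<lambda>E. of_bool (?low n E)) - ?e n (\<lambda>E. of_bool (?high n E))) \<longlonglongrightarrow> 1"
        using tendsto_diff[OF tendsto_diff[OF tendsto_const[of 1] low] high] by simp
      have "\<forall>\<^sub>F n::nat in sequentially. c \<le> real n" by real_asymp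
      then show "\<forall>\<^sub>F n in sequentially. 1 - ?e n (\<lambda>E. of_bool (?low n E)) - ?e n (\<lambda>E. of_bool (?high n E))
        \<le> measure_pmf.prob (gnp n (c / real n)) (?S n)"
        using eventually_gt_at_top[of 0]
      proof eventually_elim
        case (elim n)
        have p: "0 \<le> c / n" "c / n \<le> 1" using elim c0 by auto
        have "1 = ?e n (\<lambda>_. 1)" by (simp add: expect_const finite_vertex_pairs)
        also have "\<dots> \<le> ?e n (\<lambda>E. of_bool (E \<in> ?S n) + of_bool (?low n E) + of_bool (?high n E))"
          by (intro expect_mono p) (auto simp: of_bool_def)
        also have "\<dots> = measure_pmf.prob (gnp n (c / real n)) (?S n)
            + ?e n (\<lambda>E. of_bool (?low n E)) + ?e n (\<lambda>E. of_bool (?high n E))"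
          by (simp only: expect_add prob_gnp[OF p])
        finally show ?case by simp
      qed
      show "\<forall>\<^sub>F n in sequentially. measure_pmf.prob (gnp n (c / real n)) (?S n) \<le> 1" by simp
    qed (rule tendsto_const)
  qed
qed

end
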